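(* Let $k\geq 2$ be a constant integer. There exists an algorithm that computes $\iota^M_k(T)$ and $\iota^m_k(T)$ for every weighted tree $T=(V,E,\omega,c)$ on $n$ vertices in time $O\big(n^{\lfloor (3k-1)/2\rfloor}/(k-1)!\big)$. Also, there exists an algorithm that computes $\tilde\iota^M_k(T)$ in time $O\big((n+S(2k^2-6k-2,k))\, n^{2k^2-6k-3}/(k-2)!\big)$, where $S(N,K)$ is the Stirling number of the second kind.
   Context: A weighted tree $T=(V,E,\omega,c)$ is a finite tree with $\omega:V\to\mathbb{Q}^+$, $c:E\to\mathbb{Q}^+$. For $A\subseteq V$, $\omega(A)=\sum_{u\in A}\omega(u)$ and $c(A)$ is the sum of $c(e)$ over edges with exactly one end in $A$. $\mathcal{D}_k(V)$: families of $k$ pairwise disjoint nonempty subsets of $V$; $\mathcal{P}_k(V)$: those with union $V$. $\iota^m_k=\min_{\mathcal{D}_k(V)}\frac1k\sum_i c(A_i)/\omega(A_i)$, $\iota^M_k=\min_{\mathcal{D}_k(V)}\max_i c(A_i)/\omega(A_i)$, $\tilde\iota^M_k=\min_{\mathcal{P}_k(V)}\max_i c(A_i)/\omega(A_i)$.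
   Formalization: The second time bound is claimed only for k ≥ 4, since for k = 2, 3 the exponent 2k²-6k-3 is negative and the bound would tend to 0, which no algorithm meets; the trees are those with n ≥ k vertices, for which the minima exist. *)

theory Defs
  imports
    Complex_Main
    "HOL-Library.Disjoint_Sets"
    "HOL-Library.Landau_Symbols"
    "HOL-Combinatorics.Stirling"
begin

section \<open>Weighted trees and isoperimetric numbers\<close>

definition graph_connected :: "'a set \<Rightarrow> 'a set set \<Rightarrow> bool" where
  "graph_connected V E \<longleftrightarrow> (\<forall>u\<in>V. \<forall>v\<in>V. (u, v) \<in> {(x, y). {x, y} \<in> E}\<^sup>*)"

definition graph_acyclic :: "'a set set \<Rightarrow> bool" where
  "graph_acyclic E \<longleftrightarrow>
     \<not> (\<exists>xs. 3 \<le> length xs \<and> distinct xs \<and>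
           (\<forall>i<length xs. {xs ! i, xs ! (Suc i mod length xs)} \<in> E))"

definition is_tree :: "'a set \<Rightarrow> 'a set set \<Rightarrow> bool" where
  "is_tree V E \<longleftrightarrow>
     finite V \<and> V \<noteq> {} \<and> (\<forall>e\<in>E. e \<subseteq> V \<and> card e = 2) \<and>
     graph_connected V E \<and> graph_acyclic E"

definition weighted_tree ::
    "'a set \<Rightarrow> 'a set set \<Rightarrow> ('a \<Rightarrow> rat) \<Rightarrow> ('a set \<Rightarrow> rat) \<Rightarrow> bool" where
  "weighted_tree V E \<omega> c \<longleftrightarrow> is_tree V E \<and> (\<forall>v\<in>V. 0 < \<omega> v) \<and> (\<forall>e\<in>E. 0 < c e)"

definition cut_weight :: "'a set set \<Rightarrow> ('a set \<Rightarrow> rat) \<Rightarrow> 'a set \<Rightarrow> rat" where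
  "cut_weight E c A = (\<Sum>e \<in> {e \<in> E. card (e \<inter> A) = 1}. c e)"

definition normalized_cut ::
    "'a set set \<Rightarrow> ('a \<Rightarrow> rat) \<Rightarrow> ('a set \<Rightarrow> rat) \<Rightarrow> 'a set \<Rightarrow> rat" where
  "normalized_cut E \<omega> c A = cut_weight E c A / (\<Sum>u\<in>A. \<omega> u)"

definition subpartitions :: "'a set \<Rightarrow> nat \<Rightarrow> 'a set set set" where
  "subpartitions V k = {F. finite F \<and> card F = k \<and> \<Union>F \<subseteq> V \<and> disjoint F \<and> {} \<notin> F}"

definition partitions :: "'a set \<Rightarrow> nat \<Rightarrow> 'a set set set" where
  "partitions V k = {F \<in> subpartitions V k. \<Union>F = V}"

text \<open>
  For a finite \<open>V\<close>, the minima below range over finite sets, which are nonempty exactly if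
  \<open>subpartitions V k\<close> (equivalently, for positive \<open>k\<close>, \<open>partitions V k\<close>) is nonempty, that is,
  if \<open>k \<le> card V\<close>. Otherwise the minima do not exist and the constants are unspecified.
\<close>

definition iso_mean ::
    "'a set \<Rightarrow> 'a set set \<Rightarrow> ('a \<Rightarrow> rat) \<Rightarrow> ('a set \<Rightarrow> rat) \<Rightarrow> nat \<Rightarrow> rat" where
  "iso_mean V E \<omega> c k =
     Min ((\<lambda>F. (1 / of_nat k) * (\<Sum>A\<in>F. normalized_cut E \<omega> c A)) ` subpartitions V k)"

definition iso_max ::
    "'a set \<Rightarrow> 'a set set \<Rightarrow> ('a \<Rightarrow> rat) \<Rightarrow> ('a set \<Rightarrow> rat) \<Rightarrow> nat \<Rightarrow> rat" where
  "iso_max V E \<omega> c k =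
     Min ((\<lambda>F. Max (normalized_cut E \<omega> c ` F)) ` subpartitions V k)"

definition iso_max_partition ::
    "'a set \<Rightarrow> 'a set set \<Rightarrow> ('a \<Rightarrow> rat) \<Rightarrow> ('a set \<Rightarrow> rat) \<Rightarrow> nat \<Rightarrow> rat" where
  "iso_max_partition V E \<omega> c k =
     Min ((\<lambda>F. Max (normalized_cut E \<omega> c ` F)) ` partitions V k)"


section \<open>A random access machine with rational arithmetic\<close>

text \<open>
  Running times are measured in the number of vertices alone, so the machine is a unit-cost RAM
  over the rationals: an array cell holds a natural number (usable as an index) or a rational
  number, and each elementary operation costs one step. A program mentions only finitely many
  arrays by name; a scalar variable is cell 0 of an array. Index arithmetic offers
  only addition and truncated subtraction. Rationals cannot be converted to indices, so
  they influence the control flow only through comparisons.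
\<close>

type_synonym name = string

datatype nexp =
    NConst nat
  | NRead name nexp
  | NPlus nexp nexp
  | NMinus nexp nexp

datatype qexp =
    QConst rat
  | QRead name nexp
  | QPlus qexp qexp
  | QMinus qexp qexp
  | QTimes qexp qexp
  | QDivide qexp qexp

datatype bexp =
    NLess nexp nexp
  | QLess qexp qexp
  | BNot bexp
  | BAnd bexp bexp

datatype com =
    Skip
  | NWrite name nexp nexp
  | QWrite name nexp qexp
  | Seq com com
  | Cond bexp com com
  | While bexp com

type_synonym state = "(name \<Rightarrow> nat \<Rightarrow> nat) \<times> (name \<Rightarrow> nat \<Rightarrow> rat)"

fun nval :: "nexp \<Rightarrow> state \<Rightarrow> nat" where
  "nval (NConst m) s = m"
| "nval (NRead x e) s = fst s x (nval e s)"
| "nval (NPlus e1 e2) s = nval e1 s + nval e2 s"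
| "nval (NMinus e1 e2) s = nval e1 s - nval e2 s"

fun qval :: "qexp \<Rightarrow> state \<Rightarrow> rat" where
  "qval (QConst q) s = q"
| "qval (QRead x e) s = snd s x (nval e s)"
| "qval (QPlus e1 e2) s = qval e1 s + qval e2 s"
| "qval (QMinus e1 e2) s = qval e1 s - qval e2 s"
| "qval (QTimes e1 e2) s = qval e1 s * qval e2 s"
| "qval (QDivide e1 e2) s = qval e1 s / qval e2 s"

fun bval :: "bexp \<Rightarrow> state \<Rightarrow> bool" where
  "bval (NLess e1 e2) s = (nval e1 s < nval e2 s)"
| "bval (QLess e1 e2) s = (qval e1 s < qval e2 s)"
| "bval (BNot b) s = (\<not> bval b s)"
| "bval (BAnd b1 b2) s = (bval b1 s \<and> bval b2 s)"

fun ncost :: "nexp \<Rightarrow> nat" where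
  "ncost (NConst m) = 1"
| "ncost (NRead x e) = 1 + ncost e"
| "ncost (NPlus e1 e2) = 1 + ncost e1 + ncost e2"
| "ncost (NMinus e1 e2) = 1 + ncost e1 + ncost e2"

fun qcost :: "qexp \<Rightarrow> nat" where
  "qcost (QConst q) = 1"
| "qcost (QRead x e) = 1 + ncost e"
| "qcost (QPlus e1 e2) = 1 + qcost e1 + qcost e2"
| "qcost (QMinus e1 e2) = 1 + qcost e1 + qcost e2"
| "qcost (QTimes e1 e2) = 1 + qcost e1 + qcost e2"
| "qcost (QDivide e1 e2) = 1 + qcost e1 + qcost e2"

fun bcost :: "bexp \<Rightarrow> nat" where
  "bcost (NLess e1 e2) = 1 + ncost e1 + ncost e2"
| "bcost (QLess e1 e2) = 1 + qcost e1 + qcost e2"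
| "bcost (BNot b) = 1 + bcost b"
| "bcost (BAnd b1 b2) = 1 + bcost b1 + bcost b2"

fun nwrite :: "name \<Rightarrow> nat \<Rightarrow> nat \<Rightarrow> state \<Rightarrow> state" where
  "nwrite x i m (N, Q) = (N(x := (N x)(i := m)), Q)"

fun qwrite :: "name \<Rightarrow> nat \<Rightarrow> rat \<Rightarrow> state \<Rightarrow> state" where
  "qwrite x i q (N, Q) = (N, Q(x := (Q x)(i := q)))"

text \<open>
  \<open>exec p s t s'\<close>: started in state \<open>s\<close>, the program \<open>p\<close> halts in state \<open>s'\<close> after exactly
  \<open>t\<close> steps. The rules are deterministic.
\<close>

inductive exec :: "com \<Rightarrow> state \<Rightarrow> nat \<Rightarrow> state \<Rightarrow> bool" where
  exec_Skip: "exec Skip s 1 s"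
| exec_NWrite:
    "exec (NWrite x i e) s (1 + ncost i + ncost e) (nwrite x (nval i s) (nval e s) s)"
| exec_QWrite:
    "exec (QWrite x i e) s (1 + ncost i + qcost e) (qwrite x (nval i s) (qval e s) s)"
| exec_Seq:
    "exec p1 s1 t1 s2 \<Longrightarrow> exec p2 s2 t2 s3 \<Longrightarrow> exec (Seq p1 p2) s1 (t1 + t2) s3"
| exec_Cond_True:
    "bval b s \<Longrightarrow> exec p1 s t s' \<Longrightarrow> exec (Cond b p1 p2) s (1 + bcost b + t) s'"
| exec_Cond_False:
    "\<not> bval b s \<Longrightarrow> exec p2 s t s' \<Longrightarrow> exec (Cond b p1 p2) s (1 + bcost b + t) s'"
| exec_While_False:
    "\<not> bval b s \<Longrightarrow> exec (While b p) s (1 + bcost b) s"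
| exec_While_True:
    "bval b s1 \<Longrightarrow> exec p s1 t1 s2 \<Longrightarrow> exec (While b p) s2 t2 s3 \<Longrightarrow>
     exec (While b p) s1 (1 + bcost b + t1 + t2) s3"


section \<open>Computing rational parameters of weighted trees\<close>

text \<open>
  A presentation of a graph numbers its vertices by \<open>0, \<dots>, n - 1\<close> (\<open>vs\<close>) and lists its edges,
  in any order and orientation, as pairs of vertex numbers (\<open>es\<close>). An algorithm has to work for
  every presentation and sees only the numbers, never the vertices themselves. Therefore trees
  whose vertices are natural numbers represent all finite trees.
\<close>

definition edge_of :: "'a list \<Rightarrow> nat \<times> nat \<Rightarrow> 'a set" where
  "edge_of vs e = {vs ! fst e, vs ! snd e}"

definition presents :: "'a list \<Rightarrow> (nat \<times> nat) list \<Rightarrow> 'a set \<Rightarrow> 'a set set \<Rightarrow> bool" where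
  "presents vs es V E \<longleftrightarrow>
     distinct vs \<and> set vs = V \<and>
     (\<forall>(i, j) \<in> set es. i < length vs \<and> j < length vs) \<and>
     distinct (map (edge_of vs) es) \<and> set (map (edge_of vs) es) = E"

text \<open>Everything that is not part of the input is initialised with 0.\<close>

definition array_of :: "'b::zero list \<Rightarrow> nat \<Rightarrow> 'b" where
  "array_of xs i = (if i < length xs then xs ! i else 0)"

definition input_state ::
    "'a list \<Rightarrow> (nat \<times> nat) list \<Rightarrow> ('a \<Rightarrow> rat) \<Rightarrow> ('a set \<Rightarrow> rat) \<Rightarrow> state" where
  "input_state vs es \<omega> c =
     ((\<lambda>x i. 0)
        (''n'' := array_of [length vs],
         ''fst'' := array_of (map fst es),
         ''snd'' := array_of (map snd es)),
      (\<lambda>x i. 0)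
        (''w'' := array_of (map \<omega> vs),
         ''c'' := array_of (map (\<lambda>e. c (edge_of vs e)) es)))"

text \<open>
  \<open>computes_within p k f \<tau>\<close>: on every weighted tree with \<open>n \<ge> k\<close> vertices, \<open>p\<close> halts after at
  most \<open>\<tau> n\<close> steps with the list of values \<open>f V E \<omega> c\<close> in the array \<open>out\<close>.
\<close>

definition computes_within ::
    "com \<Rightarrow> nat \<Rightarrow>
     (nat set \<Rightarrow> nat set set \<Rightarrow> (nat \<Rightarrow> rat) \<Rightarrow> (nat set \<Rightarrow> rat) \<Rightarrow> rat list) \<Rightarrow>
     (nat \<Rightarrow> nat) \<Rightarrow> bool" where
  "computes_within p k f \<tau> \<longleftrightarrow>
     (\<forall>V E \<omega> c vs es.
        weighted_tree V E \<omega> c \<longrightarrow> k \<le> card V \<longrightarrow> presents vs es V E \<longrightarrow>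
        (\<exists>t s. exec p (input_state vs es \<omega> c) t s \<and> t \<le> \<tau> (card V) \<and>
               (\<forall>i < length (f V E \<omega> c). snd s ''out'' i = f V E \<omega> c ! i)))"

end

theory Submission
  imports Defs
begin

text \<open>
  Both bounds rest on the existence of optimal families whose parts are cut out by few edges.

  In a subpartition every part may be replaced by its best component, and a component outside all
  parts that has at most two cut edges may be absorbed by the part behind the heavier one. What
  remains are \<open>k\<close> connected parts and unassigned components of degree at least three that are
  pairwise not adjacent; counting the edges of the contracted tree leaves at most \<open>3 (k - 1) / 2\<close>
  cut edges.

  In a partition with optimal value \<open>b\<close> and fewest cut edges, consider the excess \<open>c(X) - b \<omega>(X)\<close> of
  the components \<open>X\<close> of a part \<open>A\<close>. A component of degree at most two can be absorbed by a neighbour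
  unless removing it makes the excess of \<open>A\<close> positive. If this happens for \<open>p \<ge> 2\<close> components of
  \<open>A\<close> with \<open>2 p \<ge> k - 1\<close>, then the other components of \<open>A\<close> have so much cut weight that one of the
  other \<open>k - 1\<close> parts can take over all of \<open>A\<close> but one component. Hence a part has at most \<open>k - 3\<close>
  components of degree at most two (for \<open>k \<ge> 4\<close>), and summing degrees over the contracted tree gives
  at most \<open>2 k (k - 3) - 3\<close> cut edges.

  The algorithm roots the tree and tries all tuples of \<open>m\<close> edges together with all labels of the
  root and of the lower ends of these edges. Each choice is evaluated top-down in linear time. Parts
  are labels below \<open>k\<close>; the label \<open>k\<close> is admitted for unassigned vertices of subpartitions.
\<close>

section \<open>Labelled rooted trees\<close>

text \<open>The obstacle for partitions is that nothing can be left unassigned: what a part gives up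
  must fit elsewhere. Ratios do not add over components, whereas the excess does. Let
  \<open>p\<close> components of a part \<open>A\<close> have degree at most two, let
  \<open>r\<close> be the one of largest excess among them, and let \<open>d > 0\<close> be the
  excess of \<open>A\<close> without \<open>r\<close>. Cut weight dominates excess, so the cut
  weight of \<open>A\<close> without \<open>r\<close> is at least the excess of \<open>A\<close>
  minus \<open>p\<close> times that of \<open>r\<close>. Since \<open>A\<close> has excess at most
  0, this is at least \<open>p * d\<close>. One of the \<open>k - 1\<close> other labels meets at
  least the \<open>(k - 1)\<close>-th part of this cut weight, hence at least \<open>d / 2\<close>
  if \<open>2 * p >= k - 1\<close>. Merging removes twice the weight of the common edges, so that
  label can afford the excess \<open>d\<close>. With \<open>m\<close> cut edges,
  \<open>n ^ m\<close> tuples and linear evaluation give the exponent \<open>m + 1\<close>. For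
  fixed \<open>k\<close> the choices of labels, the factorials and the Stirling number are
  constants.\<close>

locale rooted_tree =
  fixes n :: nat and par :: "nat \<Rightarrow> nat" and w c :: "nat \<Rightarrow> rat"
  assumes n_pos: "0 < n"
    and par_less: "0 < t \<Longrightarrow> t < n \<Longrightarrow> par t < t"
    and w_pos: "t < n \<Longrightarrow> 0 < w t"
    and c_pos: "0 < t \<Longrightarrow> t < n \<Longrightarrow> 0 < c t"
begin

text \<open>An edge is named by its lower end: \<open>t\<close> in \<open>{1..<n}\<close> stands for
  the edge from \<open>t\<close> to \<open>par t\<close>, so sums over edges are sums over an
  interval.\<close>

definition cross :: "nat set \<Rightarrow> nat \<Rightarrow> bool" where
  "cross A t \<longleftrightarrow> (t \<in> A) \<noteq> (par t \<in> A)"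

definition bd :: "nat set \<Rightarrow> rat" where
  "bd A = (\<Sum>t\<in>{1..<n}. if cross A t then c t else 0)"

definition joins :: "nat set \<Rightarrow> nat set \<Rightarrow> nat \<Rightarrow> bool" where
  "joins A B t \<longleftrightarrow> t \<in> A \<and> par t \<in> B \<or> t \<in> B \<and> par t \<in> A"

definition link :: "nat set \<Rightarrow> nat set \<Rightarrow> rat" where
  "link A B = (\<Sum>t\<in>{1..<n}. if joins A B t then c t else 0)"

definition wt :: "nat set \<Rightarrow> rat" where
  "wt A = (\<Sum>t\<in>A. w t)"

definition cls :: "(nat \<Rightarrow> nat) \<Rightarrow> nat \<Rightarrow> nat set" where
  "cls g i = {t. t < n \<and> g t = i}"

definition cuts :: "(nat \<Rightarrow> nat) \<Rightarrow> nat set" where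
  "cuts g = {t \<in> {1..<n}. g t \<noteq> g (par t)}"

definition ratio :: "(nat \<Rightarrow> nat) \<Rightarrow> nat \<Rightarrow> rat" where
  "ratio g i = bd (cls g i) / wt (cls g i)"

text \<open>A local way to say that \<open>Z\<close> is a union of monochromatic components: no
  uncut edge leaves \<open>Z\<close>.\<close>

definition closed_for :: "(nat \<Rightarrow> nat) \<Rightarrow> nat set \<Rightarrow> bool" where
  "closed_for g Z \<longleftrightarrow> (\<forall>t\<in>{1..<n} - cuts g. t \<in> Z \<longleftrightarrow> par t \<in> Z)"

definition relabel :: "(nat \<Rightarrow> nat) \<Rightarrow> nat set \<Rightarrow> nat \<Rightarrow> nat \<Rightarrow> nat" where
  "relabel g Z j t = (if t \<in> Z then j else g t)"

section \<open>Cut weights of vertex sets and their change under relabelling\<close>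

lemma par_lt_n: "t \<in> {1..<n} \<Longrightarrow> par t < n"
  using par_less[of t] by auto

lemma finite_cls [simp]: "finite (cls g i)"
  by (simp add: cls_def)

lemma finite_cuts [simp]: "finite (cuts g)"
  by (simp add: cuts_def)

lemma bd_nonneg: "0 \<le> bd A"
  unfolding bd_def by (intro sum_nonneg) (use c_pos in \<open>auto simp: less_imp_le\<close>)

lemma wt_nonneg: "A \<subseteq> {..<n} \<Longrightarrow> 0 \<le> wt A"
  unfolding wt_def by (intro sum_nonneg) (use w_pos in \<open>auto simp: less_imp_le subset_iff\<close>)

lemma wt_pos: "A \<subseteq> {..<n} \<Longrightarrow> A \<noteq> {} \<Longrightarrow> 0 < wt A"
  unfolding wt_def by (intro sum_pos) (use w_pos finite_subset in auto)

lemma cls_subset: "cls g i \<subseteq> {..<n}"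
  by (auto simp: cls_def)

lemma wt_cls_pos: "cls g i \<noteq> {} \<Longrightarrow> 0 < wt (cls g i)"
  by (intro wt_pos cls_subset)

lemma ratio_nonneg: "0 \<le> ratio g i"
  unfolding ratio_def by (intro divide_nonneg_nonneg bd_nonneg wt_nonneg cls_subset)

lemma wt_Un: "finite A \<Longrightarrow> finite B \<Longrightarrow> A \<inter> B = {} \<Longrightarrow> wt (A \<union> B) = wt A + wt B"
  unfolding wt_def by (rule sum.union_disjoint)

lemma wt_Diff: "finite A \<Longrightarrow> Z \<subseteq> A \<Longrightarrow> wt (A - Z) = wt A - wt Z"
  unfolding wt_def by (rule sum_diff)

text \<open>An edge between \<open>A\<close> and \<open>B\<close> is counted by \<open>bd A\<close>
  and by \<open>bd B\<close> but not by the union. This gain of twice the link weight drives every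
  merging step below.\<close>

lemma bd_Un:
  assumes "A \<inter> B = {}"
  shows "bd (A \<union> B) = bd A + bd B - 2 * link A B"
proof -
  have "bd (A \<union> B) + 2 * link A B = bd A + bd B"
    unfolding bd_def link_def sum_distrib_left sum.distrib[symmetric]
    by (intro sum.cong refl) (use assms in \<open>auto simp: cross_def joins_def\<close>)
  then show ?thesis by simp
qed

lemma link_pos_iff: "0 < link A B \<longleftrightarrow> (\<exists>t\<in>{1..<n}. joins A B t)"
proof
  assume "0 < link A B"
  then show "\<exists>t\<in>{1..<n}. joins A B t"
    by (rule contrapos_pp) (simp add: link_def)
next
  assume "\<exists>t\<in>{1..<n}. joins A B t"
  then obtain t where t: "t \<in> {1..<n}" "joins A B t" by blast
  show "0 < link A B"
    unfolding link_def
    by (rule sum_pos2[of _ t]) (use t c_pos in \<open>auto simp: less_imp_le\<close>)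
qed

text \<open>An edge inside one class is uncut, so it cannot separate the closed set \<open>Z\<close>
  from the rest of the class.\<close>

lemma link_Diff_zero:
  assumes "Z \<subseteq> cls g i" "closed_for g Z"
  shows "link Z (cls g i - Z) = 0"
proof -
  have "\<not> joins Z (cls g i - Z) t" if t: "t \<in> {1..<n}" for t
  proof
    assume j: "joins Z (cls g i - Z) t"
    then have "g t = g (par t)"
      using assms(1) by (auto simp: joins_def cls_def)
    then have "t \<in> Z \<longleftrightarrow> par t \<in> Z"
      using assms(2) t by (auto simp: closed_for_def cuts_def)
    with j show False by (auto simp: joins_def)
  qed
  then show ?thesis by (simp add: link_def)
qed

lemma bd_Diff:
  assumes "Z \<subseteq> cls g i" "closed_for g Z"
  shows "bd (cls g i - Z) = bd (cls g i) - bd Z"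
proof -
  have "bd (Z \<union> (cls g i - Z)) = bd Z + bd (cls g i - Z) - 2 * link Z (cls g i - Z)"
    by (rule bd_Un) auto
  moreover have "Z \<union> (cls g i - Z) = cls g i"
    using assms(1) by auto
  ultimately show ?thesis
    using link_Diff_zero[OF assms] by simp
qed

lemma closed_for_Diff: "closed_for g Z \<Longrightarrow> closed_for g (cls g i - Z)"
  unfolding closed_for_def using par_lt_n by (auto simp: cls_def cuts_def)

lemma cls_relabel:
  assumes "Z \<subseteq> cls g i" "j \<noteq> i"
  shows "cls (relabel g Z j) l =
    (if l = i then cls g i - Z else if l = j then cls g j \<union> Z else cls g l)"
  using assms by (auto simp: cls_def relabel_def)

lemma cuts_relabel:
  assumes "Z \<subseteq> cls g i" "closed_for g Z"
  shows "cuts (relabel g Z j) \<subseteq> cuts g"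
proof
  fix t assume t: "t \<in> cuts (relabel g Z j)"
  show "t \<in> cuts g"
  proof (rule ccontr)
    assume "t \<notin> cuts g"
    moreover have "t \<in> {1..<n}" using t by (simp add: cuts_def)
    ultimately have "t \<in> Z \<longleftrightarrow> par t \<in> Z" "g t = g (par t)"
      using assms(2) by (auto simp: closed_for_def cuts_def)
    then show False using t by (auto simp: cuts_def relabel_def)
  qed
qed

lemma card_cuts_relabel_le:
  "Z \<subseteq> cls g i \<Longrightarrow> closed_for g Z \<Longrightarrow> card (cuts (relabel g Z j)) \<le> card (cuts g)"
  by (intro card_mono cuts_relabel) auto

text \<open>Positive link weight yields an edge between \<open>Z\<close> and the target class, which
  ceases to be cut; closedness prevents new cuts.\<close>

lemma card_cuts_relabel_less:
  assumes Z: "Z \<subseteq> cls g i" "closed_for g Z" and "j \<noteq> i" and pos: "0 < link Z (cls g j)"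
  shows "card (cuts (relabel g Z j)) < card (cuts g)"
proof -
  obtain t where t: "t \<in> {1..<n}" "joins Z (cls g j) t"
    using pos by (auto simp: link_pos_iff)
  have "t \<in> cuts g"
    using t Z \<open>j \<noteq> i\<close> by (auto simp: joins_def cuts_def cls_def)
  moreover have "t \<notin> cuts (relabel g Z j)"
    using t Z \<open>j \<noteq> i\<close> by (auto simp: joins_def cuts_def cls_def relabel_def)
  ultimately have "cuts (relabel g Z j) \<subset> cuts g"
    using cuts_relabel[OF Z] by blast
  then show ?thesis by (intro psubset_card_mono) auto
qed

lemma relabel_gain:
  assumes "Z \<subseteq> cls g i" "j \<noteq> i"
  shows "bd (cls (relabel g Z j) j) = bd (cls g j) + bd Z - 2 * link Z (cls g j)"
    and "wt (cls (relabel g Z j) j) = wt (cls g j) + wt Z"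
proof -
  have disj: "Z \<inter> cls g j = {}" using assms by (auto simp: cls_def)
  have fin: "finite Z" using assms(1) finite_cls finite_subset by blast
  have eq: "cls (relabel g Z j) j = Z \<union> cls g j"
    using cls_relabel[OF assms, of j] \<open>j \<noteq> i\<close> by auto
  show "bd (cls (relabel g Z j) j) = bd (cls g j) + bd Z - 2 * link Z (cls g j)"
    unfolding eq using bd_Un[OF disj] by simp
  show "wt (cls (relabel g Z j) j) = wt (cls g j) + wt Z"
    unfolding eq using wt_Un[OF fin finite_cls disj] by simp
qed

lemma relabel_loss:
  assumes "Z \<subseteq> cls g i" "closed_for g Z" "j \<noteq> i"
  shows "bd (cls (relabel g Z j) i) = bd (cls g i) - bd Z"
    and "wt (cls (relabel g Z j) i) = wt (cls g i) - wt Z"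
  using cls_relabel[OF assms(1,3), of i] bd_Diff[OF assms(1,2)] wt_Diff[OF finite_cls assms(1)]
  by auto

text \<open>Each edge leaving \<open>Z\<close> ends in exactly one class other than
  \<open>i\<close>, because closedness excludes the rest of class \<open>i\<close>. The pigeonhole
  argument over the other labels rests on this.\<close>

lemma sum_link:
  assumes Z: "Z \<subseteq> cls g i" "closed_for g Z" and g: "\<And>t. t < n \<Longrightarrow> g t < k"
  shows "(\<Sum>j\<in>{..<k} - {i}. link Z (cls g j)) = bd Z"
proof -
  have "(\<Sum>j\<in>{..<k} - {i}. if joins Z (cls g j) t then c t else 0)
      = (if cross Z t then c t else 0)" if t: "t \<in> {1..<n}" for t
  proof (cases "cross Z t")
    case True
    have "t \<in> cuts g" using True Z(2) t unfolding cross_def closed_for_def by blast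
    then have cut: "g t \<noteq> g (par t)" by (simp add: cuts_def)
    have lt: "t < n" "par t < n" using t par_lt_n[OF t] by auto
    have Zi: "g x = i" if "x \<in> Z" for x using Z(1) that unfolding cls_def by blast
    \<comment> \<open>\<open>v\<close> is the end of the edge outside \<open>Z\<close>; its class is
      the only one other than \<open>i\<close> that the edge joins to \<open>Z\<close>.\<close>
    obtain v where v: "v < n" "g v \<noteq> i"
      "\<And>j. j \<noteq> i \<Longrightarrow> joins Z (cls g j) t \<longleftrightarrow> j = g v"
    proof (cases "t \<in> Z")
      case tZ: True
      then have "par t \<notin> Z" using True by (simp add: cross_def)
      then have "joins Z (cls g j) t \<longleftrightarrow> j = g (par t)" if "j \<noteq> i" for j
        using tZ Zi[OF tZ] lt that unfolding joins_def cls_def by blast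
      then show ?thesis using that[of "par t"] lt cut Zi[OF tZ] by metis
    next
      case tZ: False
      then have pZ: "par t \<in> Z" using True by (simp add: cross_def)
      then have "joins Z (cls g j) t \<longleftrightarrow> j = g t" if "j \<noteq> i" for j
        using tZ Zi[OF pZ] lt that unfolding joins_def cls_def by blast
      then show ?thesis using that[of t] lt cut Zi[OF pZ] by metis
    qed
    then have "(\<Sum>j\<in>{..<k} - {i}. if joins Z (cls g j) t then c t else 0)
        = (\<Sum>j\<in>{..<k} - {i}. if j = g v then c t else 0)"
      by (intro sum.cong) auto
    also have "\<dots> = c t"
      using v g by (simp add: sum.delta)
    finally show ?thesis using True by simp
  next
    case False
    have "\<not> joins Z (cls g j) t" if "j \<noteq> i" for j
      using False Z(1) that by (auto simp: cross_def joins_def cls_def)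
    then have "(\<Sum>j\<in>{..<k} - {i}. if joins Z (cls g j) t then c t else 0) = 0"
      by (intro sum.neutral) auto
    then show ?thesis using False by simp
  qed
  then have "(\<Sum>t\<in>{1..<n}. \<Sum>j\<in>{..<k} - {i}. if joins Z (cls g j) t then c t else 0) = bd Z"
    unfolding bd_def by (rule sum.cong[OF refl])
  then show ?thesis
    unfolding link_def by (subst sum.swap)
qed

subsection \<open>Monochromatic components\<close>

text \<open>The topmost vertex of the monochromatic component of \<open>t\<close>, used as the name
  of that component.\<close>

function top :: "(nat \<Rightarrow> nat) \<Rightarrow> nat \<Rightarrow> nat" where
  "top g t = (if 0 < t \<and> t < n \<and> g t = g (par t) then top g (par t) else t)"
  by auto
termination
  by (relation "measure snd") (auto simp: par_less)

declare top.simps [simp del]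

definition roots :: "(nat \<Rightarrow> nat) \<Rightarrow> nat set" where
  "roots g = insert 0 (cuts g)"

definition comp :: "(nat \<Rightarrow> nat) \<Rightarrow> nat \<Rightarrow> nat set" where
  "comp g r = {t. t < n \<and> top g t = r}"

text \<open>The cut edges at the component named \<open>r\<close>: the one above \<open>r\<close>
  and those hanging below the component. Their number is its degree in the contracted tree.\<close>

definition inc :: "(nat \<Rightarrow> nat) \<Rightarrow> nat \<Rightarrow> nat set" where
  "inc g r = {t \<in> cuts g. t = r \<or> top g (par t) = r}"

lemma finite_roots [simp]: "finite (roots g)"
  by (simp add: roots_def)

lemma card_roots: "card (roots g) = card (cuts g) + 1"
  by (simp add: roots_def cuts_def)

lemma roots_less: "r \<in> roots g \<Longrightarrow> r < n"
  using n_pos by (auto simp: roots_def cuts_def)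

lemma top_root: "r \<in> roots g \<Longrightarrow> top g r = r"
  by (subst top.simps) (auto simp: roots_def cuts_def)

lemma top_par: "t \<in> {1..<n} \<Longrightarrow> t \<notin> cuts g \<Longrightarrow> top g t = top g (par t)"
  by (subst top.simps) (auto simp: cuts_def)

lemma top_props: "t < n \<Longrightarrow> top g t \<in> roots g \<and> g (top g t) = g t \<and> top g t \<le> t"
proof (induction t rule: less_induct)
  case (less t)
  show ?case
  proof (cases "t \<in> roots g")
    case True
    then show ?thesis by (simp add: top_root)
  next
    case False
    then have t: "t \<in> {1..<n}" "t \<notin> cuts g" "g t = g (par t)"
      using less.prems by (auto simp: roots_def cuts_def)
    then have "par t < t" using par_less by auto
    then show ?thesis
      using less.IH[of "par t"] less.prems t top_par[OF t(1,2)] by auto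
  qed
qed

lemma comp_subset_cls: "comp g r \<subseteq> cls g (g r)"
proof
  fix t assume "t \<in> comp g r"
  then show "t \<in> cls g (g r)"
    using top_props[of t g] by (auto simp: comp_def cls_def)
qed

lemma comp_subset: "comp g r \<subseteq> {..<n}"
  by (auto simp: comp_def)

lemma root_in_comp: "r \<in> roots g \<Longrightarrow> r \<in> comp g r"
  by (simp add: comp_def top_root roots_less)

lemma closed_for_comp: "closed_for g (comp g r)"
  using par_lt_n by (auto simp: closed_for_def comp_def top_par)

lemma top_par_less: "t \<in> {1..<n} \<Longrightarrow> top g (par t) < t"
  using top_props[of "par t" g] par_less[of t] by fastforce

lemma cross_comp:
  assumes "t \<in> {1..<n}"
  shows "cross (comp g r) t \<longleftrightarrow> t \<in> inc g r"
proof (cases "t \<in> cuts g")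
  case True
  then have "top g t = t" by (intro top_root) (simp add: roots_def)
  then show ?thesis
    using True assms par_lt_n[OF assms] top_par_less[OF assms, of g]
    by (auto simp: cross_def comp_def inc_def)
next
  case False
  then show ?thesis
    using closed_for_comp[of g r] assms by (auto simp: closed_for_def cross_def inc_def)
qed

lemma finite_inc [simp]: "finite (inc g r)"
  by (simp add: inc_def)

lemma inc_subset: "inc g r \<subseteq> {1..<n}"
  by (auto simp: inc_def cuts_def)

lemma bd_comp: "bd (comp g r) = (\<Sum>t\<in>inc g r. c t)"
proof -
  have "bd (comp g r) = (\<Sum>t\<in>{1..<n}. if t \<in> inc g r then c t else 0)"
    unfolding bd_def by (intro sum.cong) (auto simp: cross_comp)
  also have "\<dots> = (\<Sum>t\<in>{1..<n} \<inter> inc g r. c t)"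
    by (simp add: sum.inter_restrict)
  also have "{1..<n} \<inter> inc g r = inc g r"
    using inc_subset by auto
  finally show ?thesis .
qed

text \<open>The lower end of a cut edge is itself a top, and the upper end has a smaller one, so the
  edge meets just these two components. Degree counts in the contracted tree rest on this.\<close>

lemma inc_alt:
  assumes "t \<in> cuts g"
  shows "{r \<in> roots g. t \<in> inc g r} = {t, top g (par t)}" "t \<noteq> top g (par t)"
    "g t \<noteq> g (top g (par t))"
proof -
  have t: "t \<in> {1..<n}" "t \<in> roots g"
    using assms by (auto simp: cuts_def roots_def)
  note p = top_props[OF par_lt_n[OF t(1)], of g]
  show "t \<noteq> top g (par t)" using top_par_less[OF t(1), of g] by simp
  show "{r \<in> roots g. t \<in> inc g r} = {t, top g (par t)}"
    using assms t p by (auto simp: inc_def)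
  show "g t \<noteq> g (top g (par t))"
    using p assms by (auto simp: cuts_def)
qed

text \<open>The handshake count in the contracted tree, by exchanging the order of
  summation.\<close>

lemma sum_card_inc: "(\<Sum>r\<in>roots g. card (inc g r)) = 2 * card (cuts g)"
proof -
  have "(\<Sum>r\<in>roots g. card (inc g r)) = (\<Sum>r\<in>roots g. \<Sum>t\<in>cuts g. if t \<in> inc g r then 1 else 0)"
  proof (intro sum.cong refl)
    fix r
    have "cuts g \<inter> inc g r = inc g r" by (auto simp: inc_def)
    then show "card (inc g r) = (\<Sum>t\<in>cuts g. if t \<in> inc g r then 1 else 0)"
      by (simp add: sum.If_cases)
  qed
  also have "\<dots> = (\<Sum>t\<in>cuts g. \<Sum>r\<in>roots g. if t \<in> inc g r then 1 else 0)"
    by (rule sum.swap)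
  also have "\<dots> = (\<Sum>t\<in>cuts g. 2)"
  proof (intro sum.cong refl)
    fix t assume t: "t \<in> cuts g"
    have "(\<Sum>r\<in>roots g. if t \<in> inc g r then 1 else 0) = card {r \<in> roots g. t \<in> inc g r}"
      by (simp add: sum.If_cases Int_def)
    then show "(\<Sum>r\<in>roots g. if t \<in> inc g r then 1 else 0) = (2::nat)"
      using inc_alt[OF t] by simp
  qed
  finally show ?thesis by simp
qed

lemma inc_nonempty:
  assumes "cuts g \<noteq> {}" "r \<in> roots g"
  shows "inc g r \<noteq> {}"
proof (cases "r = 0")
  case False
  then have "r \<in> inc g r" using assms(2) by (auto simp: roots_def inc_def)
  then show ?thesis by blast
next
  case True
  \<comment> \<open>Every root other than 0 is a cut vertex, so the component above the least cut
    vertex can only be that of vertex 0.\<close>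
  define t where "t = Min (cuts g)"
  have t: "t \<in> cuts g" "\<And>u. u \<in> cuts g \<Longrightarrow> t \<le> u"
    using assms(1) by (auto simp: t_def)
  then have t1: "t \<in> {1..<n}" by (simp add: cuts_def)
  have "top g (par t) \<in> roots g" "top g (par t) < t"
    using top_props[OF par_lt_n[OF t1]] top_par_less[OF t1] by auto
  then have "top g (par t) = 0"
    using t(2) by (fastforce simp: roots_def)
  then show ?thesis using t True by (auto simp: inc_def)
qed

lemma cls_eq_UN_comp: "cls g i = (\<Union>r\<in>{r \<in> roots g. g r = i}. comp g r)"
proof -
  have "t \<in> cls g i \<longleftrightarrow> t \<in> (\<Union>r\<in>{r \<in> roots g. g r = i}. comp g r)" for t
    using top_props[of t g] by (auto simp: comp_def cls_def)
  then show ?thesis by blast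
qed

lemma wt_cls: "wt (cls g i) = (\<Sum>r\<in>{r \<in> roots g. g r = i}. wt (comp g r))"
  unfolding cls_eq_UN_comp wt_def
  by (rule sum.UNION_disjoint) (auto simp: comp_def)

text \<open>The two components at a cut edge carry different labels, so within one class no edge is
  counted twice.\<close>

lemma bd_cls: "bd (cls g i) = (\<Sum>r\<in>{r \<in> roots g. g r = i}. bd (comp g r))"
proof -
  have "(\<Sum>r\<in>{r \<in> roots g. g r = i}. if cross (comp g r) t then c t else 0)
      = (if cross (cls g i) t then c t else 0)" if t: "t \<in> {1..<n}" for t
  proof (cases "t \<in> cuts g")
    case True
    note alt = inc_alt[OF True]
    have gp: "g (top g (par t)) = g (par t)"
      using top_props[OF par_lt_n[OF t]] by blast
    have "(\<Sum>r\<in>{r \<in> roots g. g r = i}. if cross (comp g r) t then c t else 0)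
        = (\<Sum>r\<in>{r \<in> roots g. t \<in> inc g r}. if g r = i then c t else 0)"
      using cross_comp[OF t] by (intro sum.mono_neutral_cong) auto
    also have "\<dots> = (if g t = i then c t else 0) + (if g (par t) = i then c t else 0)"
      using alt gp by simp
    also have "\<dots> = (if cross (cls g i) t then c t else 0)"
      using True t par_lt_n[OF t] by (auto simp: cross_def cls_def cuts_def)
    finally show ?thesis .
  next
    case False
    then have "\<not> cross (cls g i) t"
      using t par_lt_n[OF t] by (auto simp: cross_def cls_def cuts_def)
    moreover have "\<not> cross (comp g r) t" for r
      using False t by (simp add: cross_comp inc_def)
    ultimately show ?thesis by simp
  qed
  then show ?thesis
    unfolding bd_def by (subst sum.swap) (intro sum.cong, auto)
qed

text \<open>With at most two outgoing edges, the heavier one accounts for at least half of the cut.\<close>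

lemma absorb:
  assumes r: "r \<in> roots g" and ne: "cuts g \<noteq> {}" and le2: "card (inc g r) \<le> 2"
  obtains j where "j \<in> g ` {..<n}" "j \<noteq> g r" "0 < link (comp g r) (cls g j)"
    "bd (comp g r) \<le> 2 * link (comp g r) (cls g j)"
proof -
  have ine: "inc g r \<noteq> {}" by (rule inc_nonempty[OF ne r])
  then obtain t where t: "t \<in> inc g r" "\<And>u. u \<in> inc g r \<Longrightarrow> c u \<le> c t"
    using Max_in[of "c ` inc g r"] Max_ge[of "c ` inc g r"] by fastforce
  have t1: "t \<in> {1..<n}" using t inc_subset by blast
  have cr: "cross (comp g r) t" using t(1) cross_comp[OF t1] by blast
  \<comment> \<open>The end of the heaviest cut edge that lies outside the component; its label is
    the one that can absorb the component.\<close>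
  define v where "v = (if t \<in> comp g r then par t else t)"
  have v: "v < n" using par_lt_n[OF t1] t1 by (auto simp: v_def)
  have "t \<in> cuts g" using t by (simp add: inc_def)
  then have gv: "g v \<noteq> g r"
    using cr comp_subset_cls[of g r] by (auto simp: v_def cross_def cuts_def cls_def)
  have jt: "joins (comp g r) (cls g (g v)) t"
    using cr par_lt_n[OF t1] t1 by (auto simp: v_def cross_def joins_def cls_def)
  have pos: "0 < link (comp g r) (cls g (g v))"
    using jt t1 by (auto simp: link_pos_iff)
  have ct: "0 \<le> c t" using c_pos t1 by (simp add: less_imp_le)
  have "rat_of_nat (card (inc g r)) \<le> 2"
    using le2 of_nat_mono[OF le2, where 'a=rat] by simp
  then have "of_nat (card (inc g r)) * c t \<le> 2 * c t"
    using ct by (rule mult_right_mono)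
  moreover have "bd (comp g r) \<le> of_nat (card (inc g r)) * c t"
    unfolding bd_comp using t(2) by (intro sum_bounded_above) auto
  moreover have "c t \<le> link (comp g r) (cls g (g v))"
    unfolding link_def
    using member_le_sum[of t "{1..<n}" "\<lambda>t. if joins (comp g r) (cls g (g v)) t then c t else 0"]
      jt t1 c_pos by (auto simp: less_imp_le)
  ultimately have "bd (comp g r) \<le> 2 * link (comp g r) (cls g (g v))" by linarith
  then show ?thesis using that[of "g v"] v gv pos by blast
qed

subsection \<open>Subpartitions\<close>

lemma ratio_mono:
  assumes "bd (cls h i) \<le> bd (cls g i)" "wt (cls g i) \<le> wt (cls h i)" "cls g i \<noteq> {}"
  shows "ratio h i \<le> ratio g i"
  unfolding ratio_def using assms wt_cls_pos bd_nonneg by (intro frac_le) auto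

text \<open>The ratios are compared label by label, so one dominating labelling serves the maximum
  and the mean at once. The label \<open>k\<close> stands for unassigned, and its class may be
  empty.\<close>

definition dominates :: "nat \<Rightarrow> (nat \<Rightarrow> nat) \<Rightarrow> (nat \<Rightarrow> nat) \<Rightarrow> bool" where
  "dominates k h g \<longleftrightarrow> (\<forall>t<n. h t \<le> k) \<and> (\<forall>i<k. cls h i \<noteq> {} \<and> ratio h i \<le> ratio g i)"

lemma dominates_trans: "dominates k h g \<Longrightarrow> dominates k g f \<Longrightarrow> dominates k h f"
  unfolding dominates_def by (meson order_trans)

text \<open>Both inequalities compare the same cross products, in opposite directions.\<close>

lemma mediant_le:
  fixes a b x y :: rat
  assumes "0 < x" "0 < y"
  shows "a / x \<le> (a + b) / (x + y) \<or> b / y \<le> (a + b) / (x + y)"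
proof -
  have "a / x \<le> (a + b) / (x + y) \<longleftrightarrow> a * y \<le> b * x"
    using assms by (simp add: field_simps)
  moreover have "b / y \<le> (a + b) / (x + y) \<longleftrightarrow> b * x \<le> a * y"
    using assms by (simp add: field_simps)
  ultimately show ?thesis by linarith
qed

text \<open>By the mediant inequality one of the pieces \<open>Z\<close> and
  \<open>cls g i - Z\<close> has ratio at most that of the class; the other piece is the set
  \<open>Y\<close> that becomes unassigned.\<close>

lemma dominates_part:
  assumes g: "\<forall>t<n. g t \<le> k" "\<forall>i<k. cls g i \<noteq> {}" and i: "i < k"
    and Z: "Z \<subset> cls g i" "Z \<noteq> {}" "closed_for g Z"
  shows "\<exists>Y. Y \<noteq> {} \<and> Y \<subseteq> cls g i \<and> closed_for g Y \<and> dominates k (relabel g Y k) g"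
proof -
  let ?D = "cls g i - Z"
  have ZD: "Z \<subseteq> cls g i" "?D \<subseteq> cls g i" "closed_for g ?D" "cls g i - ?D = Z" "?D \<noteq> {}"
    using Z closed_for_Diff by auto
  have fin: "finite Z" using finite_subset[OF ZD(1)] by simp
  have pos: "0 < wt Z" "0 < wt ?D"
    using wt_pos[OF order_trans[OF ZD(1) cls_subset] Z(2)]
      wt_pos[OF order_trans[OF ZD(2) cls_subset] ZD(5)] by blast+
  have eq: "bd (cls g i) = bd Z + bd ?D" "wt (cls g i) = wt Z + wt ?D"
    using bd_Diff[OF ZD(1) Z(3)] wt_Diff[OF finite_cls ZD(1)] by auto
  have dom: "dominates k (relabel g Y k) g"
    if Y: "Y \<subset> cls g i" "closed_for g Y" and le: "bd (cls g i - Y) / wt (cls g i - Y) \<le> ratio g i" for Y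
  proof -
    have "Y \<subseteq> cls g i" "k \<noteq> i" using Y i by auto
    note c = cls_relabel[OF this]
    show ?thesis
      unfolding dominates_def
    proof (intro conjI allI impI)
      fix t assume "t < n" then show "relabel g Y k t \<le> k" using g by (simp add: relabel_def)
    next
      fix l assume l: "l < k"
      show "cls (relabel g Y k) l \<noteq> {}" using c[of l] l g(2) Y(1) by auto
      show "ratio (relabel g Y k) l \<le> ratio g l"
        using c[of l] l le unfolding ratio_def by auto
    qed
  qed
  from mediant_le[OF pos, of "bd Z" "bd ?D"]
  show ?thesis
  proof
    assume "bd Z / wt Z \<le> (bd Z + bd ?D) / (wt Z + wt ?D)"
    then have "dominates k (relabel g ?D k) g"
      using Z(2) ZD eq by (intro dom) (auto simp: ratio_def)
    then show ?thesis using ZD(2,3,5) by (intro exI[of _ ?D]) simp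
  next
    assume "bd ?D / wt ?D \<le> (bd Z + bd ?D) / (wt Z + wt ?D)"
    then have "dominates k (relabel g Z k) g"
      using Z(1,3) eq by (intro dom) (auto simp: ratio_def)
    then show ?thesis using ZD(1) Z(2,3) by (intro exI[of _ Z]) simp
  qed
qed

text \<open>A minimal labelling has at most \<open>k\<close> assigned components, and three times
  the number of unassigned ones is at most the number of cut edges. As there is one component more
  than there are cut edges, eliminating the unassigned ones gives the bound.\<close>

theorem few_cuts_subpartition:
  assumes k: "2 \<le> k" and g: "\<forall>t<n. g t \<le> k" "\<forall>i<k. cls g i \<noteq> {}"
  shows "\<exists>h. dominates k h g \<and> 2 * card (cuts h) + 3 \<le> 3 * k"
proof -
  define A where "A h = {t. t < n \<and> h t < k}" for h
  \<comment> \<open>A lexicographic measure: cut edges first, then assigned vertices, of which there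
    are at most \<open>n\<close>. Unassigning a piece lowers the second entry without raising the
    first; absorbing a component lowers the first.\<close>
  define M where "M h = card (cuts h) * (n + 1) + card (A h)" for h
  have cardA: "card (A h) \<le> n" for h
    using card_mono[of "{..<n}" "A h"] by (auto simp: A_def)
  have "dominates k g g" using g by (simp add: dominates_def)
  then obtain h where h: "dominates k h g" and min: "\<And>h'. dominates k h' g \<Longrightarrow> M h \<le> M h'"
    using ex_has_least_nat[of "\<lambda>h. dominates k h g" g M] by blast
  have hk: "\<forall>t<n. h t \<le> k" and hne: "\<forall>i<k. cls h i \<noteq> {}"
    using h by (auto simp: dominates_def)
  have no_dom: "M h \<le> M h'" if "dominates k h' h" for h'
    using dominates_trans[OF that h] min by blast
  have cne: "cuts h \<noteq> {}"
  proof
    assume e: "cuts h = {}"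
    have const: "h t = h 0" if "t < n" for t
      using top_props[OF that, of h] by (auto simp: roots_def e)
    have "cls h 0 \<noteq> {}" "cls h 1 \<noteq> {}" using hne k by auto
    then obtain t u where "t < n" "h t = 0" "u < n" "h u = 1"
      unfolding cls_def by blast
    then show False using const[of t] const[of u] by simp
  qed
  have uniq: "r = r'" if r: "r \<in> roots h" "r' \<in> roots h" "h r = h r'" "h r < k" for r r'
  proof (rule ccontr)
    assume "r \<noteq> r'"
    have "comp h r \<subseteq> cls h (h r)" "r' \<in> cls h (h r)" "r' \<notin> comp h r"
      using comp_subset_cls[of h r] r \<open>r \<noteq> r'\<close> roots_less[OF r(2)] top_root[OF r(2)]
      by (auto simp: cls_def comp_def)
    then have psub: "comp h r \<subset> cls h (h r)" by blast
    have ne: "comp h r \<noteq> {}" using root_in_comp[OF r(1)] by blast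
    obtain Y where Y: "Y \<noteq> {}" "Y \<subseteq> cls h (h r)" "closed_for h Y"
        "dominates k (relabel h Y k) h"
      using dominates_part[OF hk hne r(4) psub ne closed_for_comp] by blast
    obtain y where "y \<in> Y" using Y(1) by blast
    then have "y \<in> A h" "y \<notin> A (relabel h Y k)"
      using Y(2) r(4) by (auto simp: A_def relabel_def cls_def)
    moreover have "A (relabel h Y k) \<subseteq> A h"
      by (auto simp: A_def relabel_def split: if_splits)
    ultimately have "A (relabel h Y k) \<subset> A h" by blast
    then have "card (A (relabel h Y k)) < card (A h)"
      by (intro psubset_card_mono) (auto simp: A_def)
    moreover have "card (cuts (relabel h Y k)) \<le> card (cuts h)"
      by (rule card_cuts_relabel_le[OF Y(2,3)])
    ultimately have "M (relabel h Y k) < M h"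
      unfolding M_def by (intro add_le_less_mono mult_right_mono) auto
    then show False using no_dom[OF Y(4)] by simp
  qed
  have deg: "3 \<le> card (inc h r)" if r: "r \<in> roots h" "h r = k" for r
  proof (rule ccontr)
    assume "\<not> 3 \<le> card (inc h r)"
    then have le2: "card (inc h r) \<le> 2" by simp
    obtain j where j: "j \<in> h ` {..<n}" "j \<noteq> h r" "0 < link (comp h r) (cls h j)"
        "bd (comp h r) \<le> 2 * link (comp h r) (cls h j)"
      by (rule absorb[OF r(1) cne le2])
    let ?h = "relabel h (comp h r) j"
    have jk: "j < k" "j \<noteq> k" using j hk r(2) by (auto simp: le_less)
    have sub: "comp h r \<subseteq> cls h k" using comp_subset_cls[of h r] r(2) by simp
    note cl = cls_relabel[OF sub jk(2)]
    have "dominates k ?h h"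
      unfolding dominates_def
    proof (intro conjI allI impI)
      fix t assume "t < n" then show "?h t \<le> k" using hk jk by (simp add: relabel_def)
    next
      fix l assume l: "l < k"
      show "cls ?h l \<noteq> {}" using cl[of l] hne l by auto
      show "ratio ?h l \<le> ratio h l"
      proof (cases "l = j")
        case True
        show ?thesis unfolding True
          by (rule ratio_mono)
            (use relabel_gain[OF sub jk(2)] j(4) wt_nonneg[OF comp_subset] hne jk in auto)
      next
        case False
        then show ?thesis using cl[of l] l by (simp add: ratio_def)
      qed
    qed
    moreover have "card (cuts ?h) + 1 \<le> card (cuts h)"
      using card_cuts_relabel_less[OF sub closed_for_comp jk(2) j(3)] by simp
    then have "(card (cuts ?h) + 1) * (n + 1) \<le> card (cuts h) * (n + 1)"
      by (rule mult_right_mono) simp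
    then have "M ?h < M h" using cardA[of ?h] by (simp add: M_def)
    ultimately show False using no_dom by force
  qed
  define B where "B = {r \<in> roots h. h r = k}"
  define U where "U = {r \<in> roots h. h r < k}"
  have fin: "finite B" "finite U" by (auto simp: B_def U_def)
  have "roots h = B \<union> U" using hk roots_less by (force simp: B_def U_def)
  moreover have "B \<inter> U = {}" by (auto simp: B_def U_def)
  ultimately have 1: "card (cuts h) + 1 = card B + card U"
    using fin card_roots[of h] by (simp add: card_Un_disjoint)
  have "card U \<le> card {..<k}"
    by (rule card_inj_on_le[of h]) (use uniq in \<open>auto simp: inj_on_def U_def\<close>)
  then have 2: "card U \<le> k" by simp
  have "3 * card B \<le> (\<Sum>r\<in>B. card (inc h r))"
    using sum_mono[of B "\<lambda>_. 3" "\<lambda>r. card (inc h r)"] deg by (simp add: B_def)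
  \<comment> \<open>Unassigned components share no cut edge, since the two components at a cut edge
    differ in label.\<close>
  also have "\<dots> = card (\<Union>r\<in>B. inc h r)"
  proof (intro card_UN_disjoint[symmetric] fin ballI impI)
    fix r r' assume r: "r \<in> B" "r' \<in> B" "r \<noteq> r'"
    show "inc h r \<inter> inc h r' = {}"
    proof (rule ccontr)
      assume "inc h r \<inter> inc h r' \<noteq> {}"
      then obtain t where t: "t \<in> inc h r" "t \<in> inc h r'" by blast
      then have tc: "t \<in> cuts h" by (simp add: inc_def)
      have "r \<in> {t, top h (par t)}" "r' \<in> {t, top h (par t)}"
        using t r inc_alt(1)[OF tc] by (auto simp: B_def)
      then show False using r inc_alt(3)[OF tc] by (auto simp: B_def)
    qed
  qed auto
  also have "\<dots> \<le> card (cuts h)"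
    by (intro card_mono) (auto simp: inc_def)
  finally have 3: "3 * card B \<le> card (cuts h)" .
  show ?thesis using h 1 2 3 by (intro exI[of _ h]) linarith
qed

subsection \<open>Partitions\<close>

text \<open>For a nonempty class, ratio at most \<open>b\<close> means excess at most 0. Unlike the
  ratio, the excess is additive over components.\<close>

definition excess :: "rat \<Rightarrow> nat set \<Rightarrow> rat" where
  "excess b Z = bd Z - b * wt Z"

definition admissible :: "nat \<Rightarrow> rat \<Rightarrow> (nat \<Rightarrow> nat) \<Rightarrow> bool" where
  "admissible k b h \<longleftrightarrow> (\<forall>t<n. h t < k) \<and> (\<forall>i<k. cls h i \<noteq> {} \<and> excess b (cls h i) \<le> 0)"

lemma excess_cls: "excess b (cls g i) = (\<Sum>r\<in>{r \<in> roots g. g r = i}. excess b (comp g r))"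
  by (simp add: excess_def bd_cls wt_cls sum_subtractf sum_distrib_left)

text \<open>Class \<open>i\<close> loses the excess of \<open>Z\<close>, which leaves at most 0; the
  excess of class \<open>j\<close> changes by that of \<open>Z\<close> minus twice the link weight,
  which is at most 0.\<close>

lemma admissible_relabel:
  assumes h: "admissible k b h" and Z: "Z \<subset> cls h i" "closed_for h Z"
    and ij: "j \<noteq> i" "j < k"
    and ex: "excess b (cls h i) \<le> excess b Z" "excess b Z \<le> 2 * link Z (cls h j)"
  shows "admissible k b (relabel h Z j)"
proof -
  have Z': "Z \<subseteq> cls h i" using Z(1) by blast
  note cl = cls_relabel[OF Z' ij(1)]
  show ?thesis
    unfolding admissible_def
  proof (intro conjI allI impI)
    fix t assume "t < n" then show "relabel h Z j t < k"
      using h ij by (simp add: admissible_def relabel_def)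
  next
    fix l assume l: "l < k"
    have hl: "cls h l \<noteq> {}" "excess b (cls h l) \<le> 0"
      using h l by (auto simp: admissible_def)
    show "cls (relabel h Z j) l \<noteq> {}"
      using cl[of l] hl Z(1) by auto
    consider "l = i" | "l = j" | "l \<noteq> i" "l \<noteq> j" by blast
    then show "excess b (cls (relabel h Z j) l) \<le> 0"
    proof cases
      case 1
      show ?thesis
        unfolding 1 excess_def relabel_loss[OF Z' Z(2) ij(1)]
        using ex(1) by (simp add: excess_def algebra_simps)
    next
      case 2
      show ?thesis
        unfolding 2 excess_def relabel_gain[OF Z' ij(1)]
        using ex(2) hl(2) 2 by (simp add: excess_def algebra_simps)
    next
      case 3
      then show ?thesis using cl[of l] hl by simp
    qed
  qed
qed

text \<open>In an optimal partition with fewest cut edges, a label with several components of degree at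
  most two needs all of them to stay below the bound. Keeping only the least negative one and giving
  everything else of that label to the best connected other label would then save cut edges.\<close>

lemma card_small_components:
  assumes k: "4 \<le> k" and b: "0 \<le> b" and h: "admissible k b h"
    and min: "\<And>h'. admissible k b h' \<Longrightarrow> card (cuts h) \<le> card (cuts h')"
    and ne: "cuts h \<noteq> {}" and i: "i < k"
  shows "card {r \<in> roots h. h r = i \<and> card (inc h r) \<le> 2} \<le> k - 3"
proof (rule ccontr)
  define X where "X = {r \<in> roots h. h r = i \<and> card (inc h r) \<le> 2}"
  define R where "R = {r \<in> roots h. h r = i}"
  let ?e = "\<lambda>r. excess b (comp h r)"
  assume "\<not> ?thesis"
  then have p: "k - 2 \<le> card X" by (simp add: X_def)
  have fin: "finite X" "finite R" and XR: "X \<subseteq> R" by (auto simp: X_def R_def)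
  have "X \<noteq> {}" using p k by auto
  \<comment> \<open>The largest excess: \<open>card X\<close> times it bounds the sum over
    \<open>X\<close> from above. This is the component that the class will keep.\<close>
  then obtain r where r: "r \<in> X" "\<And>r'. r' \<in> X \<Longrightarrow> ?e r' \<le> ?e r"
    using fin Max_in[of "?e ` X"] Max_ge[of "?e ` X"] by fastforce
  have rr: "r \<in> roots h" "h r = i" "card (inc h r) \<le> 2" using r(1) by (auto simp: X_def)
  have "card (X - {r}) \<noteq> 0" using p k r fin by simp
  then have "X - {r} \<noteq> {}" by (metis card.empty)
  then obtain r' where r': "r' \<in> X" "r' \<noteq> r" by blast
  have "r' \<in> roots h" "h r' = i" using r' by (auto simp: X_def)
  then have "r' \<in> cls h i" "r' \<notin> comp h r"
    using r' top_root roots_less by (auto simp: cls_def comp_def)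
  then have psub: "comp h r \<subset> cls h i" using comp_subset_cls[of h r] rr by blast
  have clos: "closed_for h (comp h r)" by (rule closed_for_comp)
  have le0: "excess b (cls h i) \<le> 0" using h i by (simp add: admissible_def)

  define d where "d = excess b (cls h i) - ?e r"
  \<comment> \<open>Otherwise class \<open>i\<close> could spare \<open>r\<close>, and the class
    behind its heaviest cut edge could absorb it, which saves cut edges.\<close>
  have d: "0 < d"
  proof (rule ccontr)
    assume "\<not> 0 < d"
    then have ex1: "excess b (cls h i) \<le> ?e r" by (simp add: d_def)
    obtain j where j: "j \<in> h ` {..<n}" "j \<noteq> h r" "0 < link (comp h r) (cls h j)"
        "bd (comp h r) \<le> 2 * link (comp h r) (cls h j)"
      by (rule absorb[OF rr(1) ne rr(3)])
    have ji: "j \<noteq> i" "j < k" using j(1,2) rr h by (auto simp: admissible_def)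
    have "0 \<le> b * wt (comp h r)" using b wt_nonneg[OF comp_subset] by simp
    then have "?e r \<le> 2 * link (comp h r) (cls h j)" using j(4) by (simp add: excess_def)
    then have "admissible k b (relabel h (comp h r) j)"
      by (rule admissible_relabel[OF h psub clos ji ex1])
    moreover have "card (cuts (relabel h (comp h r) j)) < card (cuts h)"
      using psub by (intro card_cuts_relabel_less[OF _ clos ji(1) j(3)]) blast
    ultimately show False using min by fastforce
  qed

  define Z where "Z = cls h i - comp h r"
  have closZ: "closed_for h Z" unfolding Z_def by (rule closed_for_Diff[OF clos])
  have Zc: "Z \<subset> cls h i"
    using root_in_comp[OF rr(1)] psub by (auto simp: Z_def)
  have Zs: "Z \<subseteq> cls h i" using Zc by blast
  have cs: "comp h r \<subseteq> cls h i" using psub by blast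
  have bdZ: "bd Z = bd (cls h i) - bd (comp h r)"
    unfolding Z_def by (rule bd_Diff[OF cs clos])
  have wtZ: "wt Z = wt (cls h i) - wt (comp h r)"
    unfolding Z_def by (rule wt_Diff[OF finite_cls cs])
  have exZ: "excess b Z = d"
    unfolding excess_def d_def bdZ wtZ by (simp add: algebra_simps)
  have "(\<Sum>r\<in>X. ?e r) \<le> of_nat (card X) * ?e r"
    using r(2) by (rule sum_bounded_above)
  moreover have "excess b (cls h i) = (\<Sum>r\<in>X. ?e r) + (\<Sum>r\<in>R - X. ?e r)"
    unfolding excess_cls R_def[symmetric] using sum.subset_diff[OF XR fin(2), of ?e] by simp
  moreover have "(\<Sum>r\<in>R - X. ?e r) \<le> (\<Sum>r\<in>R - X. bd (comp h r))"
    using b wt_nonneg[OF comp_subset] by (intro sum_mono) (simp add: excess_def)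
  moreover have "(\<Sum>r\<in>R - X. bd (comp h r)) \<le> (\<Sum>r\<in>R - {r}. bd (comp h r))"
    using r(1) fin by (intro sum_mono2) (auto simp: bd_nonneg)
  moreover have "bd (cls h i) = bd (comp h r) + (\<Sum>r\<in>R - {r}. bd (comp h r))"
    unfolding bd_cls R_def[symmetric] using sum.remove[of R r] fin r XR by auto
  \<comment> \<open>The excess of the class is at most 0, so the factor \<open>card X\<close> can
    only lower it. This turns the sum estimate into a multiple of \<open>d\<close>.\<close>
  moreover have "of_nat (card X) * excess b (cls h i) \<le> 1 * excess b (cls h i)"
    using le0 p k by (intro mult_right_mono_neg) auto
  ultimately have bd_ge: "of_nat (card X) * d \<le> bd Z"
    unfolding d_def bdZ by (simp add: algebra_simps)

  define J where "J = {..<k} - {i}"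
  have J: "finite J" "card J = k - 1"
    using i by (auto simp: J_def)
  then have "J \<noteq> {}" using k by auto
  obtain j where j: "j \<in> J" "\<And>l. l \<in> J \<Longrightarrow> link Z (cls h l) \<le> link Z (cls h j)"
    using J(1) \<open>J \<noteq> {}\<close> Max_in[of "(\<lambda>l. link Z (cls h l)) ` J"] Max_ge[of "(\<lambda>l. link Z (cls h l)) ` J"]
    by fastforce
  have ji: "j \<noteq> i" "j < k" using j by (auto simp: J_def)
  have "bd Z = (\<Sum>l\<in>J. link Z (cls h l))"
    unfolding J_def by (rule sum_link[OF Zs closZ, symmetric]) (use h in \<open>simp add: admissible_def\<close>)
  also have "\<dots> \<le> of_nat (card J) * link Z (cls h j)"
    using j(2) by (rule sum_bounded_above)
  finally have le: "of_nat (card X) * d \<le> of_nat (card J) * link Z (cls h j)"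
    using bd_ge by simp
  \<comment> \<open>Follows from \<open>card X >= k - 2\<close> and \<open>k >= 4\<close>. The
    largest link weight is at least \<open>card X / card J\<close> times \<open>d\<close>, hence at
    least half of \<open>d\<close>.\<close>
  have "card J \<le> 2 * card X" using J p k by simp
  then have "of_nat (card J) \<le> rat_of_nat (2 * card X)" by (simp only: of_nat_le_iff)
  then have "of_nat (card J) * d \<le> of_nat (2 * card X) * d"
    using d by (intro mult_right_mono) auto
  also have "\<dots> \<le> of_nat (card J) * (2 * link Z (cls h j))"
    using le by simp
  finally have dl: "d \<le> 2 * link Z (cls h j)"
    using J k by simp
  have "admissible k b (relabel h Z j)"
  proof (rule admissible_relabel[OF h Zc closZ ji])
    show "excess b Z \<le> 2 * link Z (cls h j)" using dl exZ by simp
    show "excess b (cls h i) \<le> excess b Z" using exZ le0 d by simp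
  qed
  moreover have "card (cuts (relabel h Z j)) < card (cuts h)"
    using dl d by (intro card_cuts_relabel_less[OF Zs closZ ji(1)]) simp
  ultimately show False using min by fastforce
qed

text \<open>The bound on small components limits the whole contracted tree: a small component has
  degree at least 1, any other at least 3, and the degrees sum to twice the number of cut
  edges.\<close>

theorem few_cuts_partition:
  assumes k: "4 \<le> k" and b: "0 \<le> b" and g: "admissible k b g"
  shows "\<exists>h. admissible k b h \<and> card (cuts h) + 3 \<le> 2 * (k * (k - 3))"
proof -
  obtain h where h: "admissible k b h"
    and min: "\<And>h'. admissible k b h' \<Longrightarrow> card (cuts h) \<le> card (cuts h')"
    using ex_has_least_nat[of "admissible k b" g "\<lambda>h. card (cuts h)"] g by blast
  have "card (cuts h) + 3 \<le> 2 * (k * (k - 3))"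
  proof (cases "cuts h = {}")
    case True
    \<comment> \<open>Degrees are known to be positive only if there are cut edges; without them the
      right-hand side is large enough.\<close>
    have "4 * 1 \<le> k * (k - 3)" using k by (intro mult_le_mono) auto
    then show ?thesis using True by simp
  next
    case False
    define X where "X i = {r \<in> roots h. h r = i \<and> card (inc h r) \<le> 2}" for i
    define Y where "Y = {r \<in> roots h. card (inc h r) \<le> 2}"
    have "Y = (\<Union>i<k. X i)"
      using h roots_less by (auto simp: X_def Y_def admissible_def)
    then have "card Y \<le> (\<Sum>i<k. card (X i))" by (simp add: card_UN_le)
    also have "\<dots> \<le> (\<Sum>i<k. k - 3)"
      unfolding X_def by (intro sum_mono card_small_components[OF k b h min False]) auto
    finally have Y: "card Y \<le> k * (k - 3)" by simp
    have Yr: "Y \<subseteq> roots h" by (auto simp: Y_def)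
    have "3 * card (roots h) = 3 * card Y + 3 * card (roots h - Y)"
      using card_Diff_subset[OF finite_subset[OF Yr] Yr] card_mono[OF _ Yr] by simp
    \<comment> \<open>The weight 3 of a small component is split into 2 and 1, since its degree is
      only known to be at least 1.\<close>
    also have "\<dots> = 2 * card Y + ((\<Sum>r\<in>Y. 1) + (\<Sum>r\<in>roots h - Y. 3))"
      by simp
    also have "(\<Sum>r\<in>Y. 1) \<le> (\<Sum>r\<in>Y. card (inc h r))"
    proof (rule sum_mono)
      fix r assume "r \<in> Y"
      then have "inc h r \<noteq> {}" using inc_nonempty[OF False] by (auto simp: Y_def)
      then show "1 \<le> card (inc h r)" by (simp add: Suc_le_eq card_gt_0_iff)
    qed
    also have "(\<Sum>r\<in>roots h - Y. 3) \<le> (\<Sum>r\<in>roots h - Y. card (inc h r))"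
      by (rule sum_mono) (auto simp: Y_def)
    also have "(\<Sum>r\<in>Y. card (inc h r)) + (\<Sum>r\<in>roots h - Y. card (inc h r)) = 2 * card (cuts h)"
      using sum.subset_diff[OF Yr, of "\<lambda>r. card (inc h r)"] sum_card_inc[of h] by simp
    finally show ?thesis using Y card_roots[of h] by simp
  qed
  then show ?thesis using h by blast
qed

end

section \<open>Growing a tree vertex by vertex\<close>

text \<open>\<open>par\<close> maps positions to earlier positions, not vertices to vertices; this
  is the form that \<open>rooted_tree\<close> expects.\<close>

definition grows :: "'a set set \<Rightarrow> 'a list \<Rightarrow> (nat \<Rightarrow> nat) \<Rightarrow> bool" where
  "grows E xs par \<longleftrightarrow> distinct xs \<and>
     (\<forall>t. 0 < t \<and> t < length xs \<longrightarrow> par t < t \<and> {xs ! t, xs ! par t} \<in> E)"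

definition par_edge :: "'a list \<Rightarrow> (nat \<Rightarrow> nat) \<Rightarrow> nat \<Rightarrow> 'a set" where
  "par_edge xs par t = {xs ! t, xs ! par t}"

lemma grows_cong:
  assumes "grows E xs par" "\<And>t. t < length xs \<Longrightarrow> par' t = par t"
  shows "grows E xs par'"
  using assms by (auto simp: grows_def)

lemma grows_snoc:
  "grows E (xs @ [x]) par \<longleftrightarrow> grows E xs par \<and> x \<notin> set xs \<and>
     (xs \<noteq> [] \<longrightarrow> par (length xs) < length xs \<and> {x, xs ! par (length xs)} \<in> E)"
proof -
  define Q where "Q ys t \<longleftrightarrow> par t < t \<and> {ys ! t, ys ! par t} \<in> E" for ys t
  have old: "Q (xs @ [x]) t \<longleftrightarrow> Q xs t" if "t < length xs" for t
    using that by (auto simp: Q_def nth_append)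
  have new: "Q (xs @ [x]) (length xs) \<longleftrightarrow>
      par (length xs) < length xs \<and> {x, xs ! par (length xs)} \<in> E"
    by (auto simp: Q_def nth_append)
  have "(\<forall>t. 0 < t \<and> t < Suc (length xs) \<longrightarrow> Q (xs @ [x]) t) \<longleftrightarrow>
      (\<forall>t. 0 < t \<and> t < length xs \<longrightarrow> Q (xs @ [x]) t) \<and> (xs \<noteq> [] \<longrightarrow> Q (xs @ [x]) (length xs))"
    by (simp only: less_Suc_eq length_greater_0_conv[symmetric]) blast
  also have "(\<forall>t. 0 < t \<and> t < length xs \<longrightarrow> Q (xs @ [x]) t) \<longleftrightarrow>
      (\<forall>t. 0 < t \<and> t < length xs \<longrightarrow> Q xs t)"
    using old by blast
  finally show ?thesis
    unfolding grows_def Q_def[symmetric] new by auto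
qed

lemma par_edge_snoc:
  assumes "grows E (xs @ [x]) par" "t < length xs" "0 < t"
  shows "par_edge (xs @ [x]) par t = par_edge xs par t"
proof -
  have "par t < t" using assms by (auto simp: grows_def)
  then show ?thesis using assms by (simp add: par_edge_def nth_append)
qed

text \<open>From the newest vertex go to its parent and continue in the shorter list. The path stays
  simple because the newest vertex does not occur there.\<close>

lemma grows_path:
  assumes "grows E xs par" "u \<in> set xs" "v \<in> set xs"
  shows "\<exists>ps. ps \<noteq> [] \<and> hd ps = u \<and> last ps = v \<and> distinct ps \<and> set ps \<subseteq> set xs \<and>
    successively (\<lambda>a b. {a, b} \<in> par_edge xs par ` {1..<length xs}) ps"
  using assms
proof (induction xs arbitrary: u v rule: rev_induct)
  case Nil
  then show ?case by simp
next
  case (snoc x xs)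
  let ?P = "\<lambda>xs a b. {a, b} \<in> par_edge xs par ` {1..<length xs}"
  have g: "grows E xs par" "x \<notin> set xs" using snoc.prems(1) by (auto simp: grows_snoc)
  have mono: "?P (xs @ [x]) a b" if "?P xs a b" for a b
    using that par_edge_snoc[OF snoc.prems(1)] by fastforce
  have old: "\<exists>ps. ps \<noteq> [] \<and> hd ps = a \<and> last ps = b \<and> distinct ps \<and> set ps \<subseteq> set xs \<and>
      successively (?P (xs @ [x])) ps" if "a \<in> set xs" "b \<in> set xs" for a b
    using snoc.IH[OF g(1) that] mono by (metis (mono_tags, lifting) successively_mono)
  have new: "?P (xs @ [x]) x (xs ! par (length xs))" "?P (xs @ [x]) (xs ! par (length xs)) x"
    "xs ! par (length xs) \<in> set xs" if "xs \<noteq> []"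
  proof -
    have p: "par (length xs) < length xs" using snoc.prems(1) that by (auto simp: grows_snoc)
    then have "{x, xs ! par (length xs)} = par_edge (xs @ [x]) par (length xs)"
      by (simp add: par_edge_def nth_append)
    then show "?P (xs @ [x]) x (xs ! par (length xs))"
      using that by (auto simp: Suc_le_eq)
    then show "?P (xs @ [x]) (xs ! par (length xs)) x" by (simp add: insert_commute)
    show "xs ! par (length xs) \<in> set xs" using p by simp
  qed
  consider "u \<in> set xs" "v \<in> set xs" | "u = x" "v = x" | "u = x" "v \<in> set xs" | "u \<in> set xs" "v = x"
    using snoc.prems by auto
  then show ?case
  proof cases
    case 1
    then show ?thesis using old[of u v] by fastforce
  next
    case 2
    then show ?thesis by (intro exI[of _ "[x]"]) simp
  next
    case 3
    then have ne: "xs \<noteq> []" by auto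
    obtain ps where ps: "ps \<noteq> []" "hd ps = xs ! par (length xs)" "last ps = v" "distinct ps"
        "set ps \<subseteq> set xs" "successively (?P (xs @ [x])) ps"
      using old[OF new(3)[OF ne] 3(2)] by blast
    show ?thesis
      by (intro exI[of _ "x # ps"]) (use ps 3 g new(1)[OF ne] in \<open>auto simp: successively_Cons\<close>)
  next
    case 4
    then have ne: "xs \<noteq> []" by auto
    obtain ps where ps: "ps \<noteq> []" "hd ps = u" "last ps = xs ! par (length xs)" "distinct ps"
        "set ps \<subseteq> set xs" "successively (?P (xs @ [x])) ps"
      using old[OF 4(1) new(3)[OF ne]] by blast
    show ?thesis
      by (intro exI[of _ "ps @ [x]"])
        (use ps 4 g new(2)[OF ne] in \<open>auto simp: successively_append_iff\<close>)
  qed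
qed

text \<open>Any further edge would close a cycle with the simple path between its ends.\<close>

lemma grows_edges:
  assumes g: "grows E xs par" and acyc: "graph_acyclic E"
    and E: "\<forall>e\<in>E. e \<subseteq> set xs \<and> card e = 2"
  shows "E = par_edge xs par ` {1..<length xs}"
proof
  show "par_edge xs par ` {1..<length xs} \<subseteq> E"
    using g by (auto simp: grows_def par_edge_def)
  show "E \<subseteq> par_edge xs par ` {1..<length xs}"
  proof (rule ccontr)
    assume "\<not> E \<subseteq> par_edge xs par ` {1..<length xs}"
    then obtain e where e: "e \<in> E" "e \<notin> par_edge xs par ` {1..<length xs}" by blast
    obtain u v where uv: "e = {u, v}" "u \<noteq> v"
      using E e by (metis card_2_iff)
    have uvs: "u \<in> set xs" "v \<in> set xs" using E e uv by auto
    obtain ps where ps: "ps \<noteq> []" "hd ps = u" "last ps = v" "distinct ps" "set ps \<subseteq> set xs"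
        "successively (\<lambda>a b. {a, b} \<in> par_edge xs par ` {1..<length xs}) ps"
      using grows_path[OF g uvs] by blast
    have step: "{ps ! i, ps ! Suc i} \<in> par_edge xs par ` {1..<length xs}"
      if "Suc i < length ps" for i
      using ps(6) that by (auto simp: successively_conv_nth)
    have first: "ps ! 0 = u" and final: "ps ! (length ps - 1) = v"
      using ps(1-3) by (auto simp: hd_conv_nth last_conv_nth)
    \<comment> \<open>\<open>graph_acyclic\<close> speaks of cycles with at least three vertices. A
      path of two vertices would make \<open>e\<close> itself a parent edge.\<close>
    have "length ps \<noteq> 1" using first final uv by auto
    moreover have "length ps \<noteq> 2" using first final uv step[of 0] e by auto
    ultimately have "3 \<le> length ps" using ps(1) by (cases "length ps" rule: nat.exhaust) auto
    moreover have "{ps ! i, ps ! (Suc i mod length ps)} \<in> E" if "i < length ps" for i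
    proof (cases "Suc i < length ps")
      case True
      then show ?thesis
        using step[OF True] \<open>par_edge xs par ` {1..<length xs} \<subseteq> E\<close> by auto
    next
      case False
      then have "Suc i = length ps" using that by simp
      then have "i = length ps - 1" "Suc i mod length ps = 0" by simp_all
      then show ?thesis using first final e uv by (simp add: insert_commute)
    qed
    ultimately show False using acyc ps(4) unfolding graph_acyclic_def by blast
  qed
qed

text \<open>Some step of a walk from \<open>a\<close> to \<open>b\<close> has to leave
  \<open>S\<close>.\<close>

lemma connected_frontier:
  assumes "graph_connected V E" "a \<in> V" "a \<in> S" "b \<in> V" "b \<notin> S"
  shows "\<exists>u v. u \<in> S \<and> v \<notin> S \<and> {u, v} \<in> E"
proof (rule ccontr)
  assume no: "\<not> ?thesis"
  have "(a, b) \<in> {(x, y). {x, y} \<in> E}\<^sup>*" using assms by (auto simp: graph_connected_def)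
  then have "b \<in> S"
    by (induction rule: rtrancl_induct) (use no \<open>a \<in> S\<close> in auto)
  then show False using assms by simp
qed

text \<open>As long as a vertex is missing, connectivity yields an edge leaving the list, and its
  outer end can be appended.\<close>

lemma ex_grows:
  assumes tree: "is_tree V E" and m: "1 \<le> m" "m \<le> card V"
  shows "\<exists>xs par. grows E xs par \<and> set xs \<subseteq> V \<and> length xs = m"
  using m
proof (induction m rule: nat_induct_at_least)
  case base
  obtain v where "v \<in> V" using tree by (auto simp: is_tree_def)
  then show ?case by (intro exI[of _ "[v]"]) (auto simp: grows_def)
next
  case (Suc m)
  then obtain xs par where xs: "grows E xs par" "set xs \<subseteq> V" "length xs = m" by auto
  have "card (set xs) < card V"
    using xs Suc by (auto simp: grows_def distinct_card)
  then obtain b where "b \<in> V" "b \<notin> set xs"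
    using xs by (metis less_irrefl subsetI subset_antisym)
  moreover have "hd xs \<in> set xs" "hd xs \<in> V" using xs Suc by (cases xs; auto)+
  ultimately obtain u v where uv: "u \<in> set xs" "v \<notin> set xs" "{u, v} \<in> E"
    using connected_frontier[of V E "hd xs" "set xs" b] tree by (auto simp: is_tree_def)
  obtain p where p: "p < length xs" "xs ! p = u"
    using uv by (auto simp: in_set_conv_nth)
  have "grows E (xs @ [v]) (par(length xs := p))"
    unfolding grows_snoc using uv p grows_cong[OF xs(1)] by (auto simp: insert_commute)
  moreover have "v \<in> V" using uv tree by (auto simp: is_tree_def)
  ultimately show ?case using xs by (intro exI[of _ "xs @ [v]"]) auto
qed

lemma tree_card_edges:
  assumes tree: "is_tree V E"
  shows "card E < card V"
proof -
  have V: "finite V" "V \<noteq> {}" using tree by (auto simp: is_tree_def)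
  then have "1 \<le> card V" by (simp add: Suc_le_eq card_gt_0_iff)
  then obtain xs par where xs: "grows E xs par" "set xs \<subseteq> V" "length xs = card V"
    using ex_grows[OF tree, of "card V"] by auto
  then have "set xs = V"
    using V by (intro card_subset_eq) (auto simp: grows_def distinct_card)
  then have "E = par_edge xs par ` {1..<length xs}"
    using tree xs by (intro grows_edges) (auto simp: is_tree_def)
  then have "card E \<le> card {1..<length xs}"
    using card_image_le[of "{1..<length xs}" "par_edge xs par"] by simp
  then show ?thesis using xs(3) \<open>1 \<le> card V\<close> by simp
qed

text \<open>Of the two positions on a parent edge, \<open>t\<close> is the larger one.\<close>

lemma inj_on_par_edge:
  assumes "grows E xs par"
  shows "inj_on (par_edge xs par) {1..<length xs}"
proof (rule inj_onI)
  fix t u assume tu: "t \<in> {1..<length xs}" "u \<in> {1..<length xs}" "par_edge xs par t = par_edge xs par u"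
  have d: "distinct xs" and p: "par t < t" "par u < u"
    using assms tu by (auto simp: grows_def)
  have "{t, par t} = {u, par u}"
    using tu(3) inj_on_image_eq_iff[OF inj_on_nth[OF d, of "{..<length xs}"], of "{t, par t}" "{u, par u}"]
      tu p by (auto simp: par_edge_def)
  then show "t = u" using p by (auto simp: doubleton_eq_iff)
qed

section \<open>Time-bounded execution\<close>

definition runs :: "com \<Rightarrow> state \<Rightarrow> nat \<Rightarrow> (state \<Rightarrow> bool) \<Rightarrow> bool" where
  "runs p s T P \<longleftrightarrow> (\<exists>t s'. exec p s t s' \<and> t \<le> T \<and> P s')"

lemma runs_weaken:
  "runs p s T P \<Longrightarrow> T \<le> T' \<Longrightarrow> (\<And>s'. P s' \<Longrightarrow> P' s') \<Longrightarrow> runs p s T' P'"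
  unfolding runs_def by (meson order_trans)

lemma runs_Seq:
  assumes "runs p s T1 P" "\<And>s'. P s' \<Longrightarrow> runs q s' T2 R"
  shows "runs (Seq p q) s (T1 + T2) R"
  using assms unfolding runs_def by (meson add_mono exec_Seq)

text \<open>Loop-free code can be run by rewriting: \<open>sem\<close> computes its final state, and
  \<open>ccost\<close> bounds its steps by adding up both branches of a conditional.\<close>

fun loop_free :: "com \<Rightarrow> bool" where
  "loop_free (Seq p q) \<longleftrightarrow> loop_free p \<and> loop_free q"
| "loop_free (Cond b p q) \<longleftrightarrow> loop_free p \<and> loop_free q"
| "loop_free (While b p) \<longleftrightarrow> False"
| "loop_free _ \<longleftrightarrow> True"

fun sem :: "com \<Rightarrow> state \<Rightarrow> state" where
  "sem Skip s = s"
| "sem (NWrite x i e) s = nwrite x (nval i s) (nval e s) s"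
| "sem (QWrite x i e) s = qwrite x (nval i s) (qval e s) s"
| "sem (Seq p q) s = sem q (sem p s)"
| "sem (Cond b p q) s = (if bval b s then sem p s else sem q s)"
| "sem (While b p) s = s"

fun ccost :: "com \<Rightarrow> nat" where
  "ccost Skip = 1"
| "ccost (NWrite x i e) = 1 + ncost i + ncost e"
| "ccost (QWrite x i e) = 1 + ncost i + qcost e"
| "ccost (Seq p q) = ccost p + ccost q"
| "ccost (Cond b p q) = 1 + bcost b + ccost p + ccost q"
| "ccost (While b p) = 0"

lemma loop_free_exec: "loop_free p \<Longrightarrow> \<exists>t \<le> ccost p. exec p s t (sem p s)"
proof (induction p arbitrary: s)
  case (Seq p q)
  then obtain t1 t2 where "t1 \<le> ccost p" "exec p s t1 (sem p s)"
      "t2 \<le> ccost q" "exec q (sem p s) t2 (sem q (sem p s))"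
    by (metis loop_free.simps(1))
  then show ?case by (intro exI[of _ "t1 + t2"]) (auto intro: exec_Seq)
next
  case (Cond b p q)
  then obtain t1 t2 where *: "t1 \<le> ccost p" "exec p s t1 (sem p s)"
      "t2 \<le> ccost q" "exec q s t2 (sem q s)"
    by (metis loop_free.simps(2))
  show ?case
  proof (cases "bval b s")
    case True
    then show ?thesis
      using * exec_Cond_True[OF True *(2)] by (intro exI[of _ "1 + bcost b + t1"]) simp
  next
    case False
    then show ?thesis
      using * exec_Cond_False[OF False *(4)] by (intro exI[of _ "1 + bcost b + t2"]) simp
  qed
next
  case Skip
  show ?case using exec_Skip[of s] by auto
next
  case (NWrite x i e)
  show ?case using exec_NWrite[of x i e s] by auto
next
  case (QWrite x i e)
  show ?case using exec_QWrite[of x i e s] by auto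
qed simp

lemma runs_sem: "loop_free p \<Longrightarrow> P (sem p s) \<Longrightarrow> ccost p \<le> T \<Longrightarrow> runs p s T P"
  unfolding runs_def using loop_free_exec[of p s] by (meson order_trans)

lemma nwrite_sel [simp]:
  "fst (nwrite x i m s) = (fst s)(x := (fst s x)(i := m))" "snd (nwrite x i m s) = snd s"
  by (cases s; simp)+

lemma qwrite_sel [simp]:
  "snd (qwrite x i q s) = (snd s)(x := (snd s x)(i := q))" "fst (qwrite x i q s) = fst s"
  by (cases s; simp)+

definition For :: "name \<Rightarrow> nat \<Rightarrow> nat \<Rightarrow> nexp \<Rightarrow> com \<Rightarrow> com" where
  "For x j lo hi p =
     Seq (NWrite x (NConst j) (NConst lo))
       (While (NLess (NRead x (NConst j)) hi)
          (Seq p (NWrite x (NConst j) (NPlus (NRead x (NConst j)) (NConst 1)))))"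

text \<open>\<open>I i\<close> describes the state at the test with loop variable \<open>i\<close>.
  A round costs \<open>4 + ncost hi\<close> for the test and 6 for the increment besides the body;
  the \<open>+ 1\<close> pays for the initial assignment and the last test. The limit
  \<open>hi\<close> is evaluated anew at every test, so \<open>I\<close> must fix its value.\<close>

lemma runs_For:
  assumes "lo \<le> h"
    and init: "I lo (nwrite x j lo s)"
    and hi: "\<And>i s. I i s \<Longrightarrow> nval hi s = h"
    and step: "\<And>i s. lo \<le> i \<Longrightarrow> i < h \<Longrightarrow> I i s \<Longrightarrow> fst s x j = i \<Longrightarrow>
      runs p s T (\<lambda>s'. fst s' x j = i \<and> I (Suc i) (nwrite x j (Suc i) s'))"
  shows "runs (For x j lo hi p) s ((h - lo + 1) * (T + 10 + ncost hi))
    (\<lambda>s'. I h s' \<and> fst s' x j = h)"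
proof -
  define U where "U = T + 10 + ncost hi"
  let ?W = "While (NLess (NRead x (NConst j)) hi)
      (Seq p (NWrite x (NConst j) (NPlus (NRead x (NConst j)) (NConst 1))))"
  have loop: "runs ?W s ((h - i) * U + (4 + ncost hi)) (\<lambda>s'. I h s' \<and> fst s' x j = h)"
    if "i \<le> h" "lo \<le> i" "I i s" "fst s x j = i" for i s
    using that
  proof (induction i arbitrary: s rule: inc_induct)
    case base
    then have "\<not> bval (NLess (NRead x (NConst j)) hi) s" by (simp add: hi)
    from exec_While_False[OF this] base show ?case
      unfolding runs_def by (intro exI conjI) auto
  next
    case (step i)
    then have b: "bval (NLess (NRead x (NConst j)) hi) s" using hi[OF step.prems(2)] by simp
    obtain t1 s1 where 1: "exec p s t1 s1" "t1 \<le> T" "fst s1 x j = i"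
        "I (Suc i) (nwrite x j (Suc i) s1)"
      using assms(4)[OF step.prems(1) step.hyps(2) step.prems(2,3)] unfolding runs_def by blast
    let ?s2 = "nwrite x j (Suc i) s1"
    have 2: "exec (NWrite x (NConst j) (NPlus (NRead x (NConst j)) (NConst 1))) s1 6 ?s2"
      using exec_NWrite[of x "NConst j" "NPlus (NRead x (NConst j)) (NConst 1)" s1] 1(3)
      by (simp add: numeral_eq_Suc)
    have "fst ?s2 x j = Suc i" by simp
    then obtain t3 s3 where 3: "exec ?W ?s2 t3 s3" "t3 \<le> (h - Suc i) * U + (4 + ncost hi)"
        "I h s3 \<and> fst s3 x j = h"
      using step.IH[of ?s2] 1(4) step.prems(1) unfolding runs_def by auto
    have "(h - i) * U = (h - Suc i) * U + U"
      using step.hyps by (metis Suc_diff_Suc add.commute mult_Suc)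
    then have le: "1 + bcost (NLess (NRead x (NConst j)) hi) + (t1 + 6) + t3
        \<le> (h - i) * U + (4 + ncost hi)"
      using 1(2) 3(2) by (simp add: U_def)
    show ?case
      unfolding runs_def using exec_While_True[OF b exec_Seq[OF 1(1) 2] 3(1)] le 3(3) by blast
  qed
  have W: "runs ?W (nwrite x j lo s) ((h - lo) * U + (4 + ncost hi)) (\<lambda>s'. I h s' \<and> fst s' x j = h)"
    by (rule loop) (use assms(1) init in auto)
  have "runs (NWrite x (NConst j) (NConst lo)) s 3 (\<lambda>s'. s' = nwrite x j lo s)"
    by (rule runs_sem) auto
  then have "runs (For x j lo hi p) s (3 + ((h - lo) * U + (4 + ncost hi)))
      (\<lambda>s'. I h s' \<and> fst s' x j = h)"
    unfolding For_def by (rule runs_Seq) (use W in simp)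
  then show ?thesis
    by (rule runs_weaken) (auto simp: U_def algebra_simps)
qed

text \<open>A frame condition: \<open>A\<close> names the natural-number arrays that may differ,
  \<open>B\<close> the rational ones.\<close>

definition changes_only :: "name set \<Rightarrow> name set \<Rightarrow> state \<Rightarrow> state \<Rightarrow> bool" where
  "changes_only A B s s' \<longleftrightarrow> (\<forall>x. x \<notin> A \<longrightarrow> fst s' x = fst s x) \<and> (\<forall>x. x \<notin> B \<longrightarrow> snd s' x = snd s x)"

lemma changes_only_refl [simp]: "changes_only A B s s"
  by (simp add: changes_only_def)

lemma changes_only_nwrite [simp]:
  "x \<in> A \<Longrightarrow> changes_only A B s (nwrite x i m s') \<longleftrightarrow> changes_only A B s s'"
  by (auto simp: changes_only_def)

lemma changes_only_qwrite [simp]: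
  "x \<in> B \<Longrightarrow> changes_only A B s (qwrite x i q s') \<longleftrightarrow> changes_only A B s s'"
  by (auto simp: changes_only_def)

lemma changes_only_trans:
  "changes_only A B s s' \<Longrightarrow> changes_only A' B' s' s'' \<Longrightarrow> A \<subseteq> C \<Longrightarrow> A' \<subseteq> C \<Longrightarrow> B \<subseteq> D \<Longrightarrow> B' \<subseteq> D \<Longrightarrow>
   changes_only C D s s''"
  unfolding changes_only_def by (metis subsetD)

text \<open>An odometer on the cells of \<open>x\<close>, with the highest cell outermost. The
  number of digits depends on \<open>k\<close> only, so it can be the nesting depth of a fixed
  program, and no index arithmetic is needed to decode tuples.\<close>

fun nest :: "(nat \<Rightarrow> nexp) \<Rightarrow> nat \<Rightarrow> com \<Rightarrow> com" where
  "nest b 0 p = p"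
| "nest b (Suc d) p = For ''x'' d 0 (b d) (nest b d p)"

text \<open>\<open>cov y\<close> says that the tuple \<open>y\<close> has been treated: the body
  establishes it for the current digits and preserves it for all others. As \<open>y\<close> is a
  whole array, it has to agree with \<open>x\<close> beyond the running digits. In the time bound,
  \<open>h j + 1\<close> is at most \<open>2 * h j\<close>, and 12 covers the loop overhead 10 and a
  limit of cost at most 2.\<close>

lemma runs_nest:
  assumes hi: "\<And>j s. j < d \<Longrightarrow> I s \<Longrightarrow> nval (b j) s = h j" and cost: "\<And>j. j < d \<Longrightarrow> ncost (b j) \<le> 2"
    and h: "\<And>j. j < d \<Longrightarrow> 0 < h j"
    and I: "\<And>j i s. j < d \<Longrightarrow> i \<le> h j \<Longrightarrow> I (nwrite ''x'' j i s) \<longleftrightarrow> I s"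
    and cov: "\<And>y j i s. cov y (nwrite ''x'' j i s) \<longleftrightarrow> cov y s"
    and body: "\<And>s. I s \<Longrightarrow> (\<forall>j<d. fst s ''x'' j < h j) \<Longrightarrow>
      runs p s T (\<lambda>s'. I s' \<and> fst s' ''x'' = fst s ''x'' \<and> cov (fst s ''x'') s' \<and>
        (\<forall>y. cov y s \<longrightarrow> cov y s'))"
    and s: "I s" "e \<le> d" "\<forall>j. e \<le> j \<and> j < d \<longrightarrow> fst s ''x'' j < h j"
  shows "runs (nest b e p) s ((\<Prod>j<e. 2 * h j) * (T + 12 * e))
    (\<lambda>s'. I s' \<and> (\<forall>j\<ge>e. fst s' ''x'' j = fst s ''x'' j) \<and>
       (\<forall>y. (\<forall>j<e. y j < h j) \<and> (\<forall>j\<ge>e. y j = fst s ''x'' j) \<longrightarrow> cov y s') \<and>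
       (\<forall>y. cov y s \<longrightarrow> cov y s'))"
  using s
proof (induction e arbitrary: s)
  case 0
  then show ?case
    using body[of s] by (auto elim!: runs_weaken simp: fun_eq_iff[symmetric])
next
  case (Suc e)
  define P where "P = (\<Prod>j<e. 2 * h j)"
  have P: "1 \<le> P" unfolding P_def using h Suc.prems by (intro prod_ge_1) (auto simp: Suc_le_eq)
  \<comment> \<open>Treated so far: all tuples with digit \<open>e\<close> below \<open>i\<close>
    and the outer digits of \<open>s\<close>.\<close>
  define J where "J i s' \<longleftrightarrow> I s' \<and> (\<forall>j\<ge>Suc e. fst s' ''x'' j = fst s ''x'' j) \<and>
      (\<forall>y. (\<forall>j<e. y j < h j) \<and> y e < i \<and> (\<forall>j\<ge>Suc e. y j = fst s ''x'' j) \<longrightarrow> cov y s') \<and>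
      (\<forall>y. cov y s \<longrightarrow> cov y s')" for i s'
  have "runs (For ''x'' e 0 (b e) (nest b e p)) s
      ((h e - 0 + 1) * (P * (T + 12 * e) + 10 + ncost (b e)))
      (\<lambda>s'. J (h e) s' \<and> fst s' ''x'' e = h e)"
  proof (rule runs_For)
    show "J 0 (nwrite ''x'' e 0 s)"
      using Suc.prems by (auto simp: J_def I cov)
    show "nval (b e) s' = h e" if "J i s'" for i s'
      using that Suc.prems by (auto simp: J_def hi)
    fix i s1 assume i: "i < h e" and s1: "J i s1" "fst s1 ''x'' e = i"
    have "runs (nest b e p) s1 (P * (T + 12 * e))
      (\<lambda>s'. I s' \<and> (\<forall>j\<ge>e. fst s' ''x'' j = fst s1 ''x'' j) \<and>
       (\<forall>y. (\<forall>j<e. y j < h j) \<and> (\<forall>j\<ge>e. y j = fst s1 ''x'' j) \<longrightarrow> cov y s') \<and>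
       (\<forall>y. cov y s1 \<longrightarrow> cov y s'))"
      unfolding P_def
    proof (rule Suc.IH)
      show "\<forall>j. e \<le> j \<and> j < d \<longrightarrow> fst s1 ''x'' j < h j"
      proof (intro allI impI)
        fix j assume "e \<le> j \<and> j < d"
        then show "fst s1 ''x'' j < h j"
          using i s1 Suc.prems by (cases "j = e") (auto simp: J_def)
      qed
    qed (use s1 Suc.prems in \<open>auto simp: J_def\<close>)
    then show "runs (nest b e p) s1 (P * (T + 12 * e))
        (\<lambda>s'. fst s' ''x'' e = i \<and> J (Suc i) (nwrite ''x'' e (Suc i) s'))"
    proof (rule runs_weaken[OF _ order_refl], elim conjE)
      fix s2 assume s2: "I s2" "\<forall>j\<ge>e. fst s2 ''x'' j = fst s1 ''x'' j"
        "\<forall>y. (\<forall>j<e. y j < h j) \<and> (\<forall>j\<ge>e. y j = fst s1 ''x'' j) \<longrightarrow> cov y s2"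
        "\<forall>y. cov y s1 \<longrightarrow> cov y s2"
      have "cov y s2" if y: "\<forall>j<e. y j < h j" "y e < Suc i" "\<forall>j\<ge>Suc e. y j = fst s ''x'' j" for y
      proof (cases "y e = i")
        case True
        have "y j = fst s1 ''x'' j" if "j \<ge> e" for j
          using that True y s1 by (cases "j = e") (auto simp: J_def)
        then show ?thesis using s2(3) y(1) by blast
      next
        case False
        then show ?thesis using y s1(1) s2(4) by (auto simp: J_def less_Suc_eq)
      qed
      then show "fst s2 ''x'' e = i \<and> J (Suc i) (nwrite ''x'' e (Suc i) s2)"
        using s1 s2 i Suc.prems by (auto simp: J_def I cov)
    qed
  qed simp
  then have R: "runs (For ''x'' e 0 (b e) (nest b e p)) s
      ((h e + 1) * (P * (T + 12 * e) + 10 + ncost (b e)))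
      (\<lambda>s'. J (h e) s' \<and> fst s' ''x'' e = h e)" by simp
  have time: "(h e + 1) * (P * (T + 12 * e) + 10 + ncost (b e))
      \<le> (\<Prod>j<Suc e. 2 * h j) * (T + 12 * Suc e)"
  proof -
    have "(h e + 1) * (P * (T + 12 * e) + 10 + ncost (b e))
        \<le> (2 * h e) * (P * (T + 12 * e) + P * 12)"
      using h[of e] cost[of e] P Suc.prems by (intro mult_mono) auto
    then show ?thesis by (simp add: P_def algebra_simps)
  qed
  show ?case
    unfolding nest.simps
  proof (rule runs_weaken[OF R time], elim conjE)
    fix s' assume s': "J (h e) s'" "fst s' ''x'' e = h e"
    then show "I s' \<and> (\<forall>j\<ge>Suc e. fst s' ''x'' j = fst s ''x'' j) \<and>
       (\<forall>y. (\<forall>j<Suc e. y j < h j) \<and> (\<forall>j\<ge>Suc e. y j = fst s ''x'' j) \<longrightarrow> cov y s') \<and>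
       (\<forall>y. cov y s \<longrightarrow> cov y s')"
      by (auto simp: J_def All_less_Suc)
  qed
qed

section \<open>The search program\<close>

abbreviation Var :: "name \<Rightarrow> nexp" where
  "Var x \<equiv> NRead x (NConst 0)"

abbreviation NEq :: "nexp \<Rightarrow> nexp \<Rightarrow> bexp" where
  "NEq a b \<equiv> BAnd (BNot (NLess a b)) (BNot (NLess b a))"

text \<open>The cells \<open>x[0], \<dots>, x[m - 1]\<close> hold the lower ends of the cut edges (\<open>0\<close> stands for no edge),
  \<open>x[m]\<close> holds the label of the root, and \<open>x[m + 1 + j]\<close> the label directly below the cut edge
  \<open>x[j]\<close>.\<close>

lemma changes_only_nwrite_left [simp]:
  "x \<in> A \<Longrightarrow> changes_only A B (nwrite x i m s) s' \<longleftrightarrow> changes_only A B s s'"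
  by (auto simp: changes_only_def)

text \<open>Later matches overwrite earlier ones, as in \<open>override\<close>. The padding digit 0
  never matches, because only vertices \<open>u >= 1\<close> are visited.\<close>

definition pick_code :: "nat \<Rightarrow> com" where
  "pick_code m = For ''j'' 0 0 (NConst m)
     (Cond (NEq (NRead ''x'' (Var ''j'')) (Var ''u''))
        (NWrite ''lab'' (Var ''u'') (NRead ''x'' (NPlus (NConst (m + 1)) (Var ''j''))))
        Skip)"

definition tally_code :: com where
  "tally_code =
     Seq (QWrite ''W'' (NRead ''lab'' (Var ''u''))
            (QPlus (QRead ''W'' (NRead ''lab'' (Var ''u''))) (QRead ''pw'' (Var ''u''))))
     (Cond (NEq (NRead ''lab'' (Var ''u'')) (NRead ''lab'' (NRead ''pp'' (Var ''u''))))
        Skip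
        (Seq (QWrite ''C'' (NRead ''lab'' (Var ''u''))
               (QPlus (QRead ''C'' (NRead ''lab'' (Var ''u''))) (QRead ''pc'' (Var ''u''))))
             (QWrite ''C'' (NRead ''lab'' (NRead ''pp'' (Var ''u'')))
               (QPlus (QRead ''C'' (NRead ''lab'' (NRead ''pp'' (Var ''u''))))
                  (QRead ''pc'' (Var ''u''))))))"

text \<open>Parents precede their children, so the inherited label is already final.\<close>

definition step_code :: "nat \<Rightarrow> com" where
  "step_code m =
     Seq (NWrite ''lab'' (Var ''u'') (NRead ''lab'' (NRead ''pp'' (Var ''u''))))
     (Seq (pick_code m) tally_code)"

text \<open>\<open>W\<close> and \<open>C\<close> still hold the sums of the previous tuple and are
  cleared. \<open>Var ''lab''\<close> is cell 0 of \<open>lab\<close>, the label of the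
  root.\<close>

definition label_code :: "nat \<Rightarrow> nat \<Rightarrow> com" where
  "label_code m L =
     Seq (NWrite ''lab'' (NConst 0) (NRead ''x'' (NConst m)))
     (Seq (For ''i'' 0 0 (NConst L)
             (Seq (QWrite ''W'' (Var ''i'') (QConst 0)) (QWrite ''C'' (Var ''i'') (QConst 0))))
     (Seq (QWrite ''W'' (Var ''lab'') (QRead ''pw'' (NConst 0)))
     (For ''u'' 0 1 (Var ''n'') (step_code m))))"

definition quot :: qexp where
  "quot = QDivide (QRead ''C'' (Var ''i'')) (QRead ''W'' (Var ''i''))"

text \<open>Vertex weights are positive, so an entry of \<open>W\<close> that is not positive
  reveals an empty class. The maximum may start from 0 because ratios are nonnegative.\<close>

definition ratio_code :: "nat \<Rightarrow> com" where
  "ratio_code k =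
     Seq (Seq (NWrite ''ok'' (NConst 0) (NConst 1))
       (Seq (QWrite ''mx'' (NConst 0) (QConst 0)) (QWrite ''sum'' (NConst 0) (QConst 0))))
     (For ''i'' 0 0 (NConst k)
       (Cond (QLess (QConst 0) (QRead ''W'' (Var ''i'')))
         (Seq (QWrite ''sum'' (NConst 0) (QPlus (QRead ''sum'' (NConst 0)) quot))
            (Cond (QLess (QRead ''mx'' (NConst 0)) quot) (QWrite ''mx'' (NConst 0) quot) Skip))
         (NWrite ''ok'' (NConst 0) (NConst 0))))"

text \<open>As long as \<open>found\<close> is 0, \<open>out\<close> holds no value to compare
  with.\<close>

definition update_code :: "nat \<Rightarrow> qexp \<Rightarrow> com" where
  "update_code l q =
     Cond (BAnd (NLess (NConst 0) (Var ''found'')) (BNot (QLess q (QRead ''out'' (NConst l)))))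
       Skip (QWrite ''out'' (NConst l) q)"

definition record_code :: "nat \<Rightarrow> com" where
  "record_code k =
     Cond (NLess (NConst 0) (Var ''ok''))
       (Seq (update_code 0 (QRead ''mx'' (NConst 0)))
       (Seq (update_code 1 (QTimes (QConst (1 / of_nat k)) (QRead ''sum'' (NConst 0))))
            (NWrite ''found'' (NConst 0) (NConst 1))))
       Skip"

definition eval_code :: "nat \<Rightarrow> nat \<Rightarrow> nat \<Rightarrow> com" where
  "eval_code m L k = Seq (label_code m L) (Seq (ratio_code k) (record_code k))"

definition digit_bound :: "nat \<Rightarrow> nat \<Rightarrow> nat \<Rightarrow> nexp" where
  "digit_bound m L j = (if j < m then Var ''n'' else NConst L)"

definition search_code :: "nat \<Rightarrow> nat \<Rightarrow> nat \<Rightarrow> com" where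
  "search_code m L k =
     Seq (NWrite ''found'' (NConst 0) (NConst 0))
         (nest (digit_bound m L) (2 * m + 1) (eval_code m L k))"

fun override :: "(nat \<Rightarrow> nat) \<Rightarrow> nat \<Rightarrow> nat \<Rightarrow> nat \<Rightarrow> nat \<Rightarrow> nat" where
  "override x m 0 u l = l"
| "override x m (Suc j) u l = (if x j = u then x (m + 1 + j) else override x m j u l)"

lemma override_less:
  "(\<forall>j. m \<le> j \<and> j < 2 * m + 1 \<longrightarrow> x j < L) \<Longrightarrow> j \<le> m \<Longrightarrow> l < L \<Longrightarrow> override x m j u l < L"
  by (induction j) auto

section \<open>Correctness and running time of the search program\<close>

context rooted_tree
begin

text \<open>The labelling encoded by the digits \<open>x\<close>; recursion along \<open>par\<close>
  determines it below \<open>n\<close>.\<close>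

definition labels :: "(nat \<Rightarrow> nat) \<Rightarrow> nat \<Rightarrow> (nat \<Rightarrow> nat) \<Rightarrow> bool" where
  "labels x m g \<longleftrightarrow> g 0 = x m \<and> (\<forall>u\<in>{1..<n}. g u = override x m m u (g (par u)))"

lemma labels_unique:
  assumes "labels x m g" "labels x m h"
  shows "t < n \<Longrightarrow> g t = h t"
proof (induction t rule: less_induct)
  case (less t)
  show ?case
  proof (cases "t = 0")
    case True
    then show ?thesis using assms by (simp add: labels_def)
  next
    case False
    then have "t \<in> {1..<n}" "par t < t" using less.prems par_less by auto
    then show ?thesis using assms less.IH[of "par t"] less.prems by (simp add: labels_def)
  qed
qed

lemma labels_less:
  assumes x: "\<forall>j. m \<le> j \<and> j < 2 * m + 1 \<longrightarrow> x j < L" and g: "labels x m g"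
  shows "t < n \<Longrightarrow> g t < L"
proof (induction t rule: less_induct)
  case (less t)
  show ?case
  proof (cases "t = 0")
    case True
    then show ?thesis using g x by (simp add: labels_def)
  next
    case False
    then have t: "t \<in> {1..<n}" "par t < t" using less.prems par_less by auto
    then have "override x m m t (g (par t)) < L"
      using less.IH[of "par t"] less.prems by (intro override_less[OF x]) auto
    then show ?thesis using g t by (simp add: labels_def)
  qed
qed

lemma ex_labels:
  assumes cuts: "card (cuts h) \<le> m" and h: "\<forall>t<n. h t < L"
  shows "\<exists>x. (\<forall>j<m. x j < n) \<and> (\<forall>j. m \<le> j \<and> j < 2 * m + 1 \<longrightarrow> x j < L) \<and>
    (\<forall>j\<ge>2 * m + 1. x j = y j) \<and> labels x m h"
proof -
  obtain cs where cs: "set cs = cuts h" "distinct cs"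
    using finite_distinct_list[OF finite_cuts] by blast
  then have len: "length cs \<le> m" using cuts distinct_card[of cs] by simp
  define e where "e j = (if j < length cs then cs ! j else 0)" for j
  \<comment> \<open>Beyond the digits \<open>x\<close> copies \<open>y\<close>, which will be the
    current content of the array.\<close>
  define x where "x j = (if j < m then e j else if j = m then h 0
    else if j < 2 * m + 1 then h (e (j - m - 1)) else y j)" for j
  have e: "e j < n" for j
    using n_pos cs(1) nth_mem[of j cs] by (auto simp: e_def cuts_def)
  \<comment> \<open>Repeated padding does no harm: the label stored for the digit \<open>e j\<close>
    is always \<open>h (e j)\<close>, so all matches agree.\<close>
  have ov: "override x m j u l = (if \<exists>i<j. e i = u then h u else l)" if "j \<le> m" for j u l
    using that
  proof (induction j)
    case (Suc j)
    have "x j = e j" "x (m + 1 + j) = h (e j)" using Suc.prems by (auto simp: x_def)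
    then show ?case using Suc by (auto simp: less_Suc_eq)
  qed simp
  have "h u = override x m m u (h (par u))" if u: "u \<in> {1..<n}" for u
  proof (cases "u \<in> cuts h")
    case True
    then obtain i where "i < length cs" "cs ! i = u" using cs by (metis in_set_conv_nth)
    then have "\<exists>i<m. e i = u" using len by (intro exI[of _ i]) (simp add: e_def)
    then show ?thesis by (simp add: ov)
  next
    case False
    then have "h u = h (par u)" using u by (simp add: cuts_def)
    then show ?thesis by (simp add: ov)
  qed
  moreover have "x m = h 0" by (simp add: x_def)
  ultimately have "labels x m h" by (simp add: labels_def)
  then show ?thesis
    using e h n_pos by (intro exI[of _ x]) (auto simp: x_def)
qed

definition tree_stored :: "state \<Rightarrow> bool" where
  "tree_stored s \<longleftrightarrow> fst s ''n'' 0 = n \<and> fst s ''pp'' = par \<and> snd s ''pw'' = w \<and> snd s ''pc'' = c"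

definition wt_upto :: "(nat \<Rightarrow> nat) \<Rightarrow> nat \<Rightarrow> nat \<Rightarrow> rat" where
  "wt_upto g u i = (\<Sum>v<u. if g v = i then w v else 0)"

definition bd_upto :: "(nat \<Rightarrow> nat) \<Rightarrow> nat \<Rightarrow> nat \<Rightarrow> rat" where
  "bd_upto g u i = (\<Sum>v\<in>{1..<u}. if (g v = i) \<noteq> (g (par v) = i) then c v else 0)"

lemma wt_upto_n: "wt_upto g n i = wt (cls g i)"
proof -
  have "cls g i = {v \<in> {..<n}. g v = i}" by (auto simp: cls_def)
  then show ?thesis
    unfolding wt_upto_def wt_def by (simp only: sum.inter_filter[OF finite_lessThan])
qed

lemma bd_upto_n: "bd_upto g n i = bd (cls g i)"
  unfolding bd_upto_def bd_def
  by (intro sum.cong refl) (use par_lt_n in \<open>auto simp: cross_def cls_def\<close>)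

lemma wt_upto_Suc:
  "wt_upto (g(u := l)) (Suc u) i = wt_upto g u i + (if l = i then w u else 0)"
proof -
  have "(\<Sum>v<u. if (g(u := l)) v = i then w v else 0) = wt_upto g u i"
    unfolding wt_upto_def by (intro sum.cong) auto
  then show ?thesis by (simp add: wt_upto_def)
qed

text \<open>No vertex up to \<open>u\<close> has \<open>u\<close> as its parent, so labelling
  \<open>u\<close> leaves the earlier edges unaffected.\<close>

lemma bd_upto_Suc:
  assumes "1 \<le> u" "u < n"
  shows "bd_upto (g(u := l)) (Suc u) i =
    bd_upto g u i + (if (l = i) \<noteq> (g (par u) = i) then c u else 0)"
proof -
  have "par v \<noteq> u" if "v \<in> {1..<Suc u}" for v
    using par_less[of v] that assms by auto
  then have "(\<Sum>v\<in>{1..<u}. if ((g(u := l)) v = i) \<noteq> ((g(u := l)) (par v) = i) then c v else 0)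
      = bd_upto g u i"
    unfolding bd_upto_def by (intro sum.cong) auto
  moreover have "par u \<noteq> u" using assms par_less[of u] by simp
  ultimately show ?thesis using assms by (simp add: bd_upto_def)
qed

definition step_inv :: "nat \<Rightarrow> nat \<Rightarrow> state \<Rightarrow> nat \<Rightarrow> state \<Rightarrow> bool" where
  "step_inv m L s0 u s \<longleftrightarrow> changes_only {''lab'', ''i'', ''u'', ''j''} {''W'', ''C''} s0 s \<and>
     fst s ''lab'' 0 = fst s0 ''x'' m \<and>
     (\<forall>v\<in>{1..<u}. fst s ''lab'' v = override (fst s0 ''x'') m m v (fst s ''lab'' (par v))) \<and>
     (\<forall>v<u. fst s ''lab'' v < L) \<and>
     (\<forall>i<L. snd s ''W'' i = wt_upto (fst s ''lab'') u i \<and> snd s ''C'' i = bd_upto (fst s ''lab'') u i)"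

text \<open>The numeric time bounds here and below are upper estimates of \<open>ccost\<close> and
  of loop overhead.\<close>

lemma runs_pick:
  assumes u: "fst s ''u'' 0 = u"
  shows "runs (pick_code m) s ((m + 1) * 41)
    (\<lambda>s'. changes_only {''lab'', ''j''} {} s s' \<and>
      fst s' ''lab'' = (fst s ''lab'')(u := override (fst s ''x'') m m u (fst s ''lab'' u)))"
proof -
  let ?I = "\<lambda>j s'. changes_only {''lab'', ''j''} {} s s' \<and>
      fst s' ''lab'' = (fst s ''lab'')(u := override (fst s ''x'') m j u (fst s ''lab'' u))"
  have "runs (pick_code m) s ((m - 0 + 1) * (30 + 10 + ncost (NConst m)))
      (\<lambda>s'. ?I m s' \<and> fst s' ''j'' 0 = m)"
    unfolding pick_code_def
  proof (rule runs_For[where I = ?I and h = m])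
    fix i s' assume I: "?I i s'" "fst s' ''j'' 0 = i"
    have "fst s' ''u'' 0 = u" "fst s' ''x'' = fst s ''x''"
      using I u by (auto simp: changes_only_def)
    then show "runs (Cond (NEq (NRead ''x'' (Var ''j'')) (Var ''u''))
        (NWrite ''lab'' (Var ''u'') (NRead ''x'' (NPlus (NConst (m + 1)) (Var ''j'')))) Skip) s' 30
        (\<lambda>s'. fst s' ''j'' 0 = i \<and> ?I (Suc i) (nwrite ''j'' 0 (Suc i) s'))"
      using I by (intro runs_sem) (auto simp: fun_eq_iff)
  qed (auto simp: fun_eq_iff)
  then show ?thesis by (rule runs_weaken) auto
qed

lemma runs_step:
  assumes stored: "tree_stored s0" and x: "\<forall>j. m \<le> j \<and> j < 2 * m + 1 \<longrightarrow> fst s0 ''x'' j < L"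
    and I: "step_inv m L s0 u s" and u: "1 \<le> u" "u < n" "fst s ''u'' 0 = u"
  shows "runs (step_code m) s (10 + ((m + 1) * 41 + 80))
    (\<lambda>s'. fst s' ''u'' 0 = u \<and> step_inv m L s0 (Suc u) (nwrite ''u'' 0 (Suc u) s'))"
proof -
  define X where "X = fst s0 ''x''"
  define g where "g = fst s ''lab''"
  define l where "l = override X m m u (g (par u))"
  have ch: "changes_only {''lab'', ''i'', ''u'', ''j''} {''W'', ''C''} s0 s"
    and g0: "g 0 = X m" and gs: "\<forall>v\<in>{1..<u}. g v = override X m m v (g (par v))"
    and gL: "\<forall>v<u. g v < L"
    and WC: "\<forall>i<L. snd s ''W'' i = wt_upto g u i \<and> snd s ''C'' i = bd_upto g u i"
    using I by (auto simp: step_inv_def g_def X_def)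
  have arr: "fst s ''pp'' = par" "snd s ''pw'' = w" "snd s ''pc'' = c" "fst s ''x'' = X"
    using ch stored by (auto simp: changes_only_def tree_stored_def X_def)
  have pu: "par u < u" using u par_less by auto
  have lL: "l < L"
    unfolding l_def using x gL pu by (intro override_less) (auto simp: X_def)
  let ?s1 = "nwrite ''lab'' u (g (par u)) s"
  have 1: "runs (NWrite ''lab'' (Var ''u'') (NRead ''lab'' (NRead ''pp'' (Var ''u'')))) s 10
      (\<lambda>s'. s' = ?s1)"
    by (rule runs_sem) (auto simp: u arr g_def)
  have 2: "runs (pick_code m) ?s1 ((m + 1) * 41)
      (\<lambda>s'. changes_only {''lab'', ''j''} {} s s' \<and> fst s' ''lab'' = g(u := l))"
    by (rule runs_weaken[OF runs_pick[of _ u]]) (use u arr in \<open>auto simp: l_def g_def\<close>)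
  have 3: "runs tally_code s2 80
      (\<lambda>s'. fst s' ''u'' 0 = u \<and> step_inv m L s0 (Suc u) (nwrite ''u'' 0 (Suc u) s'))"
    if ch2: "changes_only {''lab'', ''j''} {} s s2" and lab: "fst s2 ''lab'' = g(u := l)" for s2
  proof -
    have arr2: "fst s2 ''u'' 0 = u" "fst s2 ''pp'' = par" "snd s2 = snd s"
      using ch2 u arr by (auto simp: changes_only_def)
    have ch3: "changes_only {''lab'', ''i'', ''u'', ''j''} {''W'', ''C''} s0 s2"
      by (rule changes_only_trans[OF ch ch2]) auto
    let ?s3 = "sem tally_code s2"
    have f: "fst ?s3 = fst s2"
      by (simp add: tally_code_def)
    have W: "snd ?s3 ''W'' = (snd s ''W'')(l := snd s ''W'' l + w u)"
      using pu by (simp add: tally_code_def arr2 lab arr)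
    have C: "snd ?s3 ''C'' i = snd s ''C'' i + (if (l = i) \<noteq> (g (par u) = i) then c u else 0)" for i
      using pu by (auto simp: tally_code_def arr2 lab arr)
    have ch4: "changes_only {''lab'', ''i'', ''u'', ''j''} {''W'', ''C''} s0 (nwrite ''u'' 0 (Suc u) ?s3)"
      using ch3 by (auto simp: tally_code_def)
    have "step_inv m L s0 (Suc u) (nwrite ''u'' 0 (Suc u) ?s3)"
      unfolding step_inv_def
    proof (intro conjI ballI allI impI ch4)
      have lab': "fst (nwrite ''u'' 0 (Suc u) ?s3) ''lab'' = g(u := l)" by (simp add: f lab)
      show "fst (nwrite ''u'' 0 (Suc u) ?s3) ''lab'' 0 = fst s0 ''x'' m"
        unfolding lab' using g0 u by (simp add: X_def)
      fix v assume "v \<in> {1..<Suc u}"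
      then have v: "par v < v" "v = u \<or> v \<in> {1..<u}" using par_less[of v] u by auto
      have "(g(u := l)) v = override X m m v ((g(u := l)) (par v))"
      proof (cases "v = u")
        case True
        then show ?thesis using v(1) by (simp add: l_def)
      next
        case False
        then have "g v = override X m m v (g (par v))" "par v \<noteq> u" using v gs by auto
        then show ?thesis using False by (metis fun_upd_other)
      qed
      then show "fst (nwrite ''u'' 0 (Suc u) ?s3) ''lab'' v =
          override (fst s0 ''x'') m m v (fst (nwrite ''u'' 0 (Suc u) ?s3) ''lab'' (par v))"
        unfolding lab' X_def[symmetric] .
    next
      have lab': "fst (nwrite ''u'' 0 (Suc u) ?s3) ''lab'' = g(u := l)" by (simp add: f lab)
      show "fst (nwrite ''u'' 0 (Suc u) ?s3) ''lab'' v < L" if "v < Suc u" for v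
        unfolding lab' using gL lL that by (auto simp: less_Suc_eq)
      fix i assume i: "i < L"
      show "snd (nwrite ''u'' 0 (Suc u) ?s3) ''W'' i =
          wt_upto (fst (nwrite ''u'' 0 (Suc u) ?s3) ''lab'') (Suc u) i"
        unfolding lab' wt_upto_Suc using WC i by (auto simp: W)
      show "snd (nwrite ''u'' 0 (Suc u) ?s3) ''C'' i =
          bd_upto (fst (nwrite ''u'' 0 (Suc u) ?s3) ''lab'') (Suc u) i"
        unfolding lab' bd_upto_Suc[OF u(1,2)] using WC i by (simp add: C)
    qed
    then show ?thesis
      using f arr2 by (intro runs_sem) (auto simp: tally_code_def)
  qed
  show ?thesis
    unfolding step_code_def
    by (rule runs_Seq[OF 1], rule runs_Seq[where P = "\<lambda>s'. changes_only {''lab'', ''j''} {} s s' \<and>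
        fst s' ''lab'' = g(u := l)"]) (use 2 3 in auto)
qed

lemma runs_label:
  assumes stored: "tree_stored s0" and x: "\<forall>j. m \<le> j \<and> j < 2 * m + 1 \<longrightarrow> fst s0 ''x'' j < L"
  shows "runs (label_code m L) s0 (10 + ((L + 1) * 31 + (10 + n * ((m + 1) * 41 + 102))))
    (\<lambda>s. changes_only {''lab'', ''i'', ''u'', ''j''} {''W'', ''C''} s0 s \<and>
      labels (fst s0 ''x'') m (fst s ''lab'') \<and>
      (\<forall>i<L. snd s ''W'' i = wt (cls (fst s ''lab'') i) \<and> snd s ''C'' i = bd (cls (fst s ''lab'') i)))"
proof -
  let ?A = "{''lab'', ''i'', ''u'', ''j''}" and ?B = "{''W'', ''C''}"
  let ?ch = "\<lambda>s. changes_only ?A ?B s0 s \<and> fst s ''lab'' 0 = fst s0 ''x'' m"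
  have 1: "runs (NWrite ''lab'' (NConst 0) (NRead ''x'' (NConst m))) s0 10 ?ch"
    by (rule runs_sem) auto
  let ?I = "\<lambda>i s. ?ch s \<and> (\<forall>l<i. snd s ''W'' l = 0 \<and> snd s ''C'' l = 0)"
  have 2: "runs (For ''i'' 0 0 (NConst L)
      (Seq (QWrite ''W'' (Var ''i'') (QConst 0)) (QWrite ''C'' (Var ''i'') (QConst 0)))) s
      ((L + 1) * 31) (?I L)" if "?ch s" for s
  proof -
    have "runs (For ''i'' 0 0 (NConst L)
      (Seq (QWrite ''W'' (Var ''i'') (QConst 0)) (QWrite ''C'' (Var ''i'') (QConst 0)))) s
      ((L - 0 + 1) * (20 + 10 + ncost (NConst L))) (\<lambda>s. ?I L s \<and> fst s ''i'' 0 = L)"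
    proof (rule runs_For[where I = ?I and h = L])
      fix i s assume "?I i s" "fst s ''i'' 0 = i"
      then show "runs (Seq (QWrite ''W'' (Var ''i'') (QConst 0)) (QWrite ''C'' (Var ''i'') (QConst 0)))
        s 20 (\<lambda>s'. fst s' ''i'' 0 = i \<and> ?I (Suc i) (nwrite ''i'' 0 (Suc i) s'))"
        by (intro runs_sem) auto
    qed (use that in auto)
    then show ?thesis by (rule runs_weaken) auto
  qed
  have x0: "fst s0 ''x'' m < L" using x by simp
  have 3: "runs (QWrite ''W'' (Var ''lab'') (QRead ''pw'' (NConst 0))) s 10 (step_inv m L s0 1)"
    if "?I L s" for s
  proof -
    have "snd s ''pw'' = w" using that stored by (auto simp: changes_only_def tree_stored_def)
    then show ?thesis
      using that x0 by (intro runs_sem) (auto simp: step_inv_def wt_upto_def bd_upto_def)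
  qed
  have 4: "runs (For ''u'' 0 1 (Var ''n'') (step_code m)) s (n * ((m + 1) * 41 + 102)) (step_inv m L s0 n)"
    if "step_inv m L s0 1 s" for s
  proof -
    have "runs (For ''u'' 0 1 (Var ''n'') (step_code m)) s
      ((n - 1 + 1) * ((10 + ((m + 1) * 41 + 80)) + 10 + ncost (Var ''n'')))
      (\<lambda>s. step_inv m L s0 n s \<and> fst s ''u'' 0 = n)"
    proof (rule runs_For[where I = "step_inv m L s0" and h = n])
      show "nval (Var ''n'') s = n" if "step_inv m L s0 i s" for i s
        using that stored by (auto simp: step_inv_def changes_only_def tree_stored_def)
      show "runs (step_code m) s (10 + ((m + 1) * 41 + 80))
          (\<lambda>s'. fst s' ''u'' 0 = i \<and> step_inv m L s0 (Suc i) (nwrite ''u'' 0 (Suc i) s'))"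
        if "1 \<le> i" "i < n" "step_inv m L s0 i s" "fst s ''u'' 0 = i" for i s
        using that by (intro runs_step[OF stored x]) auto
    qed (use that n_pos in \<open>auto simp: step_inv_def\<close>)
    then show ?thesis
      by (rule runs_weaken) (use n_pos in auto)
  qed
  have "runs (label_code m L) s0 (10 + ((L + 1) * 31 + (10 + n * ((m + 1) * 41 + 102)))) (step_inv m L s0 n)"
    unfolding label_code_def by (rule runs_Seq[OF 1], rule runs_Seq[OF 2], assumption,
        rule runs_Seq[OF 3], assumption, rule 4)
  then show ?thesis
    by (rule runs_weaken) (auto simp: step_inv_def labels_def wt_upto_n bd_upto_n)
qed

definition covers :: "nat \<Rightarrow> (nat \<Rightarrow> nat) \<Rightarrow> bool" where
  "covers k g \<longleftrightarrow> (\<forall>i<k. cls g i \<noteq> {})"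

definition max_ratio :: "nat \<Rightarrow> (nat \<Rightarrow> nat) \<Rightarrow> rat" where
  "max_ratio k g = Max (ratio g ` {..<k})"

definition mean_ratio :: "nat \<Rightarrow> (nat \<Rightarrow> nat) \<Rightarrow> rat" where
  "mean_ratio k g = 1 / of_nat k * (\<Sum>i<k. ratio g i)"

lemma cls_cong: "(\<And>t. t < n \<Longrightarrow> g t = h t) \<Longrightarrow> cls g i = cls h i"
  by (auto simp: cls_def)

lemma ratio_cong: "(\<And>t. t < n \<Longrightarrow> g t = h t) \<Longrightarrow> ratio g i = ratio h i"
  using cls_cong[of g h] by (simp add: ratio_def)

lemma runs_ratio:
  assumes WC: "\<forall>i<k. snd s0 ''W'' i = wt (cls g i) \<and> snd s0 ''C'' i = bd (cls g i)" and k: "0 < k"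
  shows "runs (ratio_code k) s0 (10 + (k + 1) * 61)
    (\<lambda>s. changes_only {''ok'', ''i''} {''mx'', ''sum''} s0 s \<and>
      (fst s ''ok'' 0 \<noteq> 0 \<longleftrightarrow> covers k g) \<and>
      (covers k g \<longrightarrow> snd s ''mx'' 0 = max_ratio k g \<and> snd s ''sum'' 0 = (\<Sum>i<k. ratio g i)))"
proof -
  define M where "M i = Max (insert 0 (ratio g ` {..<i}))" for i
  define I where "I i s \<longleftrightarrow> changes_only {''ok'', ''i''} {''mx'', ''sum''} s0 s \<and>
      (fst s ''ok'' 0 \<noteq> 0 \<longleftrightarrow> covers i g) \<and>
      (covers i g \<longrightarrow> snd s ''mx'' 0 = M i \<and>
         snd s ''sum'' 0 = (\<Sum>i<i. ratio g i))" for i s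
  have 1: "runs (Seq (NWrite ''ok'' (NConst 0) (NConst 1))
       (Seq (QWrite ''mx'' (NConst 0) (QConst 0)) (QWrite ''sum'' (NConst 0) (QConst 0)))) s0 10 (I 0)"
    by (rule runs_sem) (auto simp: I_def covers_def M_def)
  let ?p = "Cond (QLess (QConst 0) (QRead ''W'' (Var ''i'')))
         (Seq (QWrite ''sum'' (NConst 0) (QPlus (QRead ''sum'' (NConst 0)) quot))
            (Cond (QLess (QRead ''mx'' (NConst 0)) quot) (QWrite ''mx'' (NConst 0) quot) Skip))
         (NWrite ''ok'' (NConst 0) (NConst 0))"
  have 2: "runs (For ''i'' 0 0 (NConst k) ?p) s
      ((k - 0 + 1) * (50 + 10 + ncost (NConst k))) (\<lambda>s. I k s \<and> fst s ''i'' 0 = k)"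
    if "I 0 s" for s
  proof (rule runs_For[where I = I and h = k])
    show "I 0 (nwrite ''i'' 0 0 s)" using that by (auto simp: I_def)
    fix i s assume i: "i < k" and I: "I i s" and si: "fst s ''i'' 0 = i"
    have WCi: "snd s ''W'' i = wt (cls g i)" "snd s ''C'' i = bd (cls g i)"
      using I WC i by (auto simp: I_def changes_only_def)
    have quot: "qval quot s' = ratio g i"
      if "fst s' ''i'' 0 = i" "snd s' ''W'' = snd s ''W''" "snd s' ''C'' = snd s ''C''" for s'
      using that WCi by (simp add: quot_def ratio_def)
    have cov: "covers (Suc i) g \<longleftrightarrow> covers i g \<and> cls g i \<noteq> {}"
      by (auto simp: covers_def less_Suc_eq)
    show "runs ?p s 50 (\<lambda>s'. fst s' ''i'' 0 = i \<and> I (Suc i) (nwrite ''i'' 0 (Suc i) s'))"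
    proof (cases "cls g i = {}")
      case True
      then have "wt (cls g i) = 0" by (simp add: wt_def)
      then show ?thesis
        using I si WCi True by (intro runs_sem) (auto simp: I_def cov quot_def)
    next
      case False
      then have pos: "0 < wt (cls g i)" by (rule wt_cls_pos)
      have M: "M (Suc i) = max (ratio g i) (M i)" unfolding M_def
        by (subst lessThan_Suc, subst image_insert, subst insert_commute, subst Max_insert) auto
      let ?s = "sem ?p s"
      have "fst ?s = fst s" "snd ?s ''sum'' 0 = snd s ''sum'' 0 + ratio g i"
        "snd ?s ''mx'' 0 = max (ratio g i) (snd s ''mx'' 0)"
        "changes_only {''ok'', ''i''} {''mx'', ''sum''} s0 s \<Longrightarrow>
          changes_only {''ok'', ''i''} {''mx'', ''sum''} s0 ?s"
        using si WCi pos by (auto simp: quot max_def)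
      then have "fst ?s ''i'' 0 = i \<and> I (Suc i) (nwrite ''i'' 0 (Suc i) ?s)"
        using I si False by (simp add: I_def cov M)
      then show ?thesis by (intro runs_sem) (auto simp: quot_def)
    qed
  qed auto
  have fin: "M k = max_ratio k g"
  proof -
    have ne: "ratio g ` {..<k} \<noteq> {}" using k by auto
    have "ratio g 0 \<le> Max (ratio g ` {..<k})" using k by (intro Max_ge) auto
    then have "0 \<le> Max (ratio g ` {..<k})" using ratio_nonneg[of g 0] by linarith
    then show ?thesis using ne by (simp add: M_def max_ratio_def max_def)
  qed
  have "runs (ratio_code k) s0 (10 + (k - 0 + 1) * (50 + 10 + ncost (NConst k)))
      (\<lambda>s. I k s \<and> fst s ''i'' 0 = k)"
    unfolding ratio_code_def by (rule runs_Seq[OF 1 2])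
  then show ?thesis
    by (rule runs_weaken) (auto simp: I_def fin)
qed

definition recorded :: "nat \<Rightarrow> (nat \<Rightarrow> nat) \<Rightarrow> state \<Rightarrow> state \<Rightarrow> bool" where
  "recorded k g s s' \<longleftrightarrow>
     (if covers k g then 0 < fst s' ''found'' 0 \<and>
        snd s' ''out'' 0 = (if 0 < fst s ''found'' 0 then min (snd s ''out'' 0) (max_ratio k g)
          else max_ratio k g) \<and>
        snd s' ''out'' 1 = (if 0 < fst s ''found'' 0 then min (snd s ''out'' 1) (mean_ratio k g)
          else mean_ratio k g)
      else fst s' ''found'' = fst s ''found'' \<and> snd s' ''out'' = snd s ''out'')"

lemma runs_record:
  assumes "fst s ''ok'' 0 \<noteq> 0 \<longleftrightarrow> covers k g"
    and "covers k g \<Longrightarrow> snd s ''mx'' 0 = max_ratio k g \<and> snd s ''sum'' 0 = (\<Sum>i<k. ratio g i)"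
  shows "runs (record_code k) s 80
    (\<lambda>s'. changes_only {''found''} {''out''} s s' \<and> recorded k g s s')"
proof (cases "covers k g")
  case True
  then show ?thesis
    using assms
    by (intro runs_sem)
      (auto simp: record_code_def update_code_def recorded_def min_def mean_ratio_def)
next
  case False
  then show ?thesis
    using assms by (intro runs_sem) (auto simp: record_code_def update_code_def recorded_def)
qed

abbreviation eval_time :: "nat \<Rightarrow> nat \<Rightarrow> nat \<Rightarrow> nat" where
  "eval_time m L k \<equiv> n * ((m + 1) * 41 + (L + 1) * 31 + (k + 1) * 61 + 212)"

lemma runs_eval:
  assumes stored: "tree_stored s" and x: "\<forall>j. m \<le> j \<and> j < 2 * m + 1 \<longrightarrow> fst s ''x'' j < L"
    and k: "0 < k" "k \<le> L"
  shows "runs (eval_code m L k) s (eval_time m L k)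
    (\<lambda>s'. changes_only {''lab'', ''i'', ''u'', ''j'', ''ok'', ''found''}
        {''W'', ''C'', ''mx'', ''sum'', ''out''} s s' \<and>
      (\<exists>g. labels (fst s ''x'') m g \<and> recorded k g s s'))"
proof -
  let ?R = "\<lambda>s'. changes_only {''lab'', ''i'', ''u'', ''j'', ''ok'', ''found''}
        {''W'', ''C'', ''mx'', ''sum'', ''out''} s s' \<and>
      (\<exists>g. labels (fst s ''x'') m g \<and> recorded k g s s')"
  have "runs (eval_code m L k) s ((10 + ((L + 1) * 31 + (10 + n * ((m + 1) * 41 + 102)))) +
      ((10 + (k + 1) * 61) + 80)) ?R"
    unfolding eval_code_def
  proof (rule runs_Seq[OF runs_label[OF stored x]], elim conjE)
    fix s1 :: state let ?g = "fst s1 ''lab''"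
    assume s1: "changes_only {''lab'', ''i'', ''u'', ''j''} {''W'', ''C''} s s1"
      "labels (fst s ''x'') m ?g"
      "\<forall>i<L. snd s1 ''W'' i = wt (cls ?g i) \<and> snd s1 ''C'' i = bd (cls ?g i)"
    have "\<forall>i<k. snd s1 ''W'' i = wt (cls ?g i) \<and> snd s1 ''C'' i = bd (cls ?g i)"
      using s1(3) k by auto
    note R = runs_ratio[OF this k(1)]
    show "runs (Seq (ratio_code k) (record_code k)) s1 ((10 + (k + 1) * 61) + 80) ?R"
    proof (rule runs_Seq[OF R], elim conjE)
      fix s2
      assume s2: "changes_only {''ok'', ''i''} {''mx'', ''sum''} s1 s2"
        "fst s2 ''ok'' 0 \<noteq> 0 \<longleftrightarrow> covers k ?g"
        "covers k ?g \<longrightarrow> snd s2 ''mx'' 0 = max_ratio k ?g \<and> snd s2 ''sum'' 0 = (\<Sum>i<k. ratio ?g i)"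
      have "runs (record_code k) s2 80
          (\<lambda>s'. changes_only {''found''} {''out''} s2 s' \<and> recorded k ?g s2 s')"
        using s2(2,3) by (intro runs_record) auto
      then show "runs (record_code k) s2 80 ?R"
      proof (rule runs_weaken[OF _ order_refl], elim conjE)
        fix s3 assume s3: "changes_only {''found''} {''out''} s2 s3" "recorded k ?g s2 s3"
        have "changes_only {''lab'', ''i'', ''u'', ''j'', ''ok''} {''W'', ''C'', ''mx'', ''sum''} s s2"
          by (rule changes_only_trans[OF s1(1) s2(1)]) auto
        then have "changes_only {''lab'', ''i'', ''u'', ''j'', ''ok'', ''found''}
            {''W'', ''C'', ''mx'', ''sum'', ''out''} s s3"
          by (rule changes_only_trans[OF _ s3(1)]) auto
        moreover have eq: "fst s2 ''found'' = fst s ''found''" "snd s2 ''out'' = snd s ''out''"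
          using s1(1) s2(1) by (auto simp: changes_only_def)
        have "recorded k ?g s s3" using s3(2) unfolding recorded_def eq .
        ultimately show "?R s3" using s1(2) by blast
      qed
    qed
  qed
  \<comment> \<open>The cost that does not depend on \<open>n\<close> is charged \<open>n\<close>
    times, as \<open>n >= 1\<close>.\<close>
  moreover have "(L + 1) * 31 + (k + 1) * 61 + 110 \<le> n * ((L + 1) * 31 + (k + 1) * 61 + 110)"
    using n_pos by (cases n) auto
  then have "(10 + ((L + 1) * 31 + (10 + n * ((m + 1) * 41 + 102)))) + ((10 + (k + 1) * 61) + 80)
      \<le> eval_time m L k"
    by (simp add: algebra_simps)
  ultimately show ?thesis by (rule runs_weaken) auto
qed

definition labelling :: "nat \<Rightarrow> nat \<Rightarrow> (nat \<Rightarrow> nat) \<Rightarrow> bool" where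
  "labelling L k g \<longleftrightarrow> (\<forall>t<n. g t < L) \<and> covers k g"

text \<open>A sandwich: each output is at most the value of every labelling with at most
  \<open>m\<close> cuts and is attained by some labelling. The guarantee is conditional because
  without such a labelling nothing need have been recorded.\<close>

theorem runs_search:
  assumes stored: "tree_stored s" and k: "0 < k" "k \<le> L"
  shows "runs (search_code m L k) s (3 + (2 * n) ^ m * (2 * L) ^ (m + 1) * (eval_time m L k + 12 * (2 * m + 1)))
    (\<lambda>s'. \<forall>h. labelling L k h \<and> card (cuts h) \<le> m \<longrightarrow>
       snd s' ''out'' 0 \<le> max_ratio k h \<and> snd s' ''out'' 1 \<le> mean_ratio k h \<and>
       (\<exists>g. labelling L k g \<and> snd s' ''out'' 0 = max_ratio k g) \<and>
       (\<exists>g. labelling L k g \<and> snd s' ''out'' 1 = mean_ratio k g))"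
proof -
  define I where "I s \<longleftrightarrow> tree_stored s \<and> (0 < fst s ''found'' 0 \<longrightarrow>
      (\<exists>g. labelling L k g \<and> snd s ''out'' 0 = max_ratio k g) \<and>
      (\<exists>g. labelling L k g \<and> snd s ''out'' 1 = mean_ratio k g))" for s
  \<comment> \<open>Labellings encoded by the same \<open>y\<close> agree below \<open>n\<close>, so
    evaluating one of them settles \<open>cov y\<close>.\<close>
  define cov where "cov y s \<longleftrightarrow> (\<forall>g. labels y m g \<and> covers k g \<longrightarrow> 0 < fst s ''found'' 0 \<and>
      snd s ''out'' 0 \<le> max_ratio k g \<and> snd s ''out'' 1 \<le> mean_ratio k g)" for y and s :: state
  define b where "b j = (if j < m then n else L)" for j
  have I_x: "I (nwrite ''x'' j i s) \<longleftrightarrow> I s" for j i s by (simp add: I_def tree_stored_def)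
  have cov_x: "cov y (nwrite ''x'' j i s) \<longleftrightarrow> cov y s" for y j i s by (simp add: cov_def)
  have body: "runs (eval_code m L k) s (eval_time m L k)
      (\<lambda>s'. I s' \<and> fst s' ''x'' = fst s ''x'' \<and> cov (fst s ''x'') s' \<and> (\<forall>y. cov y s \<longrightarrow> cov y s'))"
    if I: "I s" and x: "\<forall>j<2 * m + 1. fst s ''x'' j < b j" for s
  proof -
    have st: "tree_stored s" using I by (simp add: I_def)
    have xL: "\<forall>j. m \<le> j \<and> j < 2 * m + 1 \<longrightarrow> fst s ''x'' j < L"
      using x by (auto simp: b_def)
    show ?thesis
    proof (rule runs_weaken[OF runs_eval[OF st xL k] order_refl], elim conjE exE)
      fix s' g
      assume ch: "changes_only {''lab'', ''i'', ''u'', ''j'', ''ok'', ''found''}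
          {''W'', ''C'', ''mx'', ''sum'', ''out''} s s'"
        and g: "labels (fst s ''x'') m g" and r: "recorded k g s s'"
      have "tree_stored s'" "fst s' ''x'' = fst s ''x''"
        using st ch by (auto simp: tree_stored_def changes_only_def)
      moreover have "I s'"
      proof (cases "covers k g")
        case True
        then have "labelling L k g" using labels_less[OF xL g] by (simp add: labelling_def)
        then show ?thesis
          using I r True \<open>tree_stored s'\<close> by (auto simp: I_def recorded_def min_def)
      next
        case False
        then show ?thesis using I r \<open>tree_stored s'\<close> by (simp add: I_def recorded_def)
      qed
      moreover have "cov (fst s ''x'') s'"
        unfolding cov_def
      proof (intro allI impI, elim conjE)
        fix h assume h: "labels (fst s ''x'') m h" "covers k h"
        have eq: "h t = g t" if "t < n" for t using labels_unique[OF h(1) g that] .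
        then have "covers k g" "max_ratio k h = max_ratio k g" "mean_ratio k h = mean_ratio k g"
          using h(2) cls_cong[of h g] ratio_cong[of h g]
          by (auto simp: covers_def max_ratio_def mean_ratio_def)
        then show "0 < fst s' ''found'' 0 \<and> snd s' ''out'' 0 \<le> max_ratio k h \<and>
            snd s' ''out'' 1 \<le> mean_ratio k h"
          using r by (auto simp: recorded_def)
      qed
      moreover have "cov y s'" if "cov y s" for y
        using that r unfolding cov_def recorded_def
        by (cases "covers k g") (auto simp: min_le_iff_disj)
      ultimately show "I s' \<and> fst s' ''x'' = fst s ''x'' \<and> cov (fst s ''x'') s' \<and>
          (\<forall>y. cov y s \<longrightarrow> cov y s')" by blast
    qed
  qed
  let ?s = "nwrite ''found'' 0 0 s"
  have "runs (nest (digit_bound m L) (2 * m + 1) (eval_code m L k)) ?s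
      ((\<Prod>j<2 * m + 1. 2 * b j) * (eval_time m L k + 12 * (2 * m + 1)))
      (\<lambda>s'. I s' \<and> (\<forall>j\<ge>2 * m + 1. fst s' ''x'' j = fst ?s ''x'' j) \<and>
       (\<forall>y. (\<forall>j<2 * m + 1. y j < b j) \<and> (\<forall>j\<ge>2 * m + 1. y j = fst ?s ''x'' j) \<longrightarrow> cov y s') \<and>
       (\<forall>y. cov y ?s \<longrightarrow> cov y s'))"
  proof (rule runs_nest[where d = "2 * m + 1"])
    show "nval (digit_bound m L j) s = b j" if "I s" for j s
      using that by (simp add: digit_bound_def b_def I_def tree_stored_def)
    show "ncost (digit_bound m L j) \<le> 2" for j by (simp add: digit_bound_def)
    show "0 < b j" for j using n_pos k by (simp add: b_def)
    show "I ?s" using stored by (simp add: I_def tree_stored_def)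
  qed (use I_x cov_x body in auto)
  moreover have "(\<Prod>j<2 * m + 1. 2 * b j) = (2 * n) ^ m * (2 * L) ^ (m + 1)"
  proof -
    have "{..<2 * m + 1} = {..<m} \<union> {m..<2 * m + 1}" by auto
    moreover have "(\<Prod>j\<in>{..<m} \<union> {m..<2 * m + 1}. 2 * b j)
        = (\<Prod>j<m. 2 * b j) * (\<Prod>j=m..<2 * m + 1. 2 * b j)"
      by (rule prod.union_disjoint) auto
    ultimately have "(\<Prod>j<2 * m + 1. 2 * b j) = (\<Prod>j<m. 2 * b j) * (\<Prod>j=m..<2 * m + 1. 2 * b j)"
      by metis
    then show ?thesis by (simp add: b_def)
  qed
  ultimately have N: "runs (nest (digit_bound m L) (2 * m + 1) (eval_code m L k)) ?s
      ((2 * n) ^ m * (2 * L) ^ (m + 1) * (eval_time m L k + 12 * (2 * m + 1)))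
      (\<lambda>s'. I s' \<and> (\<forall>j\<ge>2 * m + 1. fst s' ''x'' j = fst ?s ''x'' j) \<and>
       (\<forall>y. (\<forall>j<2 * m + 1. y j < b j) \<and> (\<forall>j\<ge>2 * m + 1. y j = fst ?s ''x'' j) \<longrightarrow> cov y s') \<and>
       (\<forall>y. cov y ?s \<longrightarrow> cov y s'))"
    by (simp only:)
  have 1: "runs (NWrite ''found'' (NConst 0) (NConst 0)) s 3 (\<lambda>s'. s' = ?s)"
    by (rule runs_sem) auto
  show ?thesis
    unfolding search_code_def
  proof (rule runs_Seq[OF 1], simp only:, rule runs_weaken[OF N order_refl], elim conjE,
      intro allI impI, elim conjE)
    fix s' h
    assume s': "I s'" "\<forall>y. (\<forall>j<2 * m + 1. y j < b j) \<and>
        (\<forall>j\<ge>2 * m + 1. y j = fst ?s ''x'' j) \<longrightarrow> cov y s'"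
      and h: "labelling L k h" "card (cuts h) \<le> m"
    obtain y where y: "\<forall>j<m. y j < n" "\<forall>j. m \<le> j \<and> j < 2 * m + 1 \<longrightarrow> y j < L"
        "\<forall>j\<ge>2 * m + 1. y j = fst ?s ''x'' j" "labels y m h"
      using ex_labels[OF h(2), of L "fst ?s ''x''"] h(1) by (auto simp: labelling_def)
    then have "cov y s'" using s'(2) by (auto simp: b_def)
    then show "snd s' ''out'' 0 \<le> max_ratio k h \<and> snd s' ''out'' 1 \<le> mean_ratio k h \<and>
       (\<exists>g. labelling L k g \<and> snd s' ''out'' 0 = max_ratio k g) \<and>
       (\<exists>g. labelling L k g \<and> snd s' ''out'' 1 = mean_ratio k g)"
      using y(4) h(1) s'(1) by (auto simp: cov_def labelling_def I_def)
  qed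
qed

end

section \<open>Rooting the input tree\<close>

text \<open>\<open>pos\<close> is shifted by one, hence the subtraction in the parent position. The
  names are parameters because an edge may be listed in either orientation.\<close>

definition attach_code :: "name \<Rightarrow> name \<Rightarrow> com" where
  "attach_code x y =
     Cond (BAnd (NLess (NConst 0) (NRead ''pos'' (NRead x (Var ''j''))))
            (BNot (NLess (NConst 0) (NRead ''pos'' (NRead y (Var ''j''))))))
       (Seq (NWrite ''pp'' (Var ''cnt'') (NMinus (NRead ''pos'' (NRead x (Var ''j''))) (NConst 1)))
       (Seq (QWrite ''pc'' (Var ''cnt'') (QRead ''c'' (Var ''j'')))
       (Seq (QWrite ''pw'' (Var ''cnt'') (QRead ''w'' (NRead y (Var ''j''))))
       (Seq (NWrite ''pos'' (NRead y (Var ''j'')) (NPlus (Var ''cnt'') (NConst 1)))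
            (NWrite ''cnt'' (NConst 0) (NPlus (Var ''cnt'') (NConst 1)))))))
       Skip"

text \<open>\<open>pos[v]\<close> is one plus the position of the vertex \<open>v\<close>, and \<open>0\<close> for vertices not yet reached.
  The scan runs up to index \<open>n - 1\<close>, one beyond the last edge; the arrays are \<open>0\<close> there, which is
  a loop at the root and has no effect.\<close>

definition root_code :: com where
  "root_code =
     Seq (Seq (NWrite ''pos'' (NConst 0) (NConst 1))
       (Seq (QWrite ''pw'' (NConst 0) (QRead ''w'' (NConst 0))) (NWrite ''cnt'' (NConst 0) (NConst 1))))
     (For ''r'' 0 0 (Var ''n'') (For ''j'' 0 0 (Var ''n'')
        (Seq (attach_code ''fst'' ''snd'') (attach_code ''snd'' ''fst''))))"

section \<open>Correctness and running time of the rooting program\<close>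

locale presented_tree =
  fixes vs :: "'a list" and es :: "(nat \<times> nat) list" and V :: "'a set" and E :: "'a set set"
    and \<omega> :: "'a \<Rightarrow> rat" and c :: "'a set \<Rightarrow> rat"
  assumes tree: "weighted_tree V E \<omega> c" and pres: "presents vs es V E"
begin

abbreviation n :: nat where "n \<equiv> length vs"

lemma is_tree: "is_tree V E"
  using tree by (simp add: weighted_tree_def)

lemma dist_vs: "distinct vs" and set_vs: "set vs = V"
  using pres by (auto simp: presents_def)

lemma n_eq: "n = card V"
  using dist_vs set_vs distinct_card by metis

lemma n_pos: "0 < n"
  using is_tree set_vs by (auto simp: is_tree_def)

lemma es_less: "j < length es \<Longrightarrow> fst (es ! j) < n \<and> snd (es ! j) < n"
proof -
  assume "j < length es"
  moreover have "\<forall>p\<in>set es. fst p < n \<and> snd p < n" using pres by (auto simp: presents_def)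
  ultimately show ?thesis by simp
qed

lemma es_edge: "j < length es \<Longrightarrow> edge_of vs (es ! j) \<in> E"
  using pres by (auto simp: presents_def)

lemma ex_es: "e \<in> E \<Longrightarrow> \<exists>j<length es. e = edge_of vs (es ! j)"
proof -
  assume "e \<in> E"
  then obtain p where "p \<in> set es" "e = edge_of vs p"
    using pres by (auto simp: presents_def)
  then show ?thesis by (metis in_set_conv_nth)
qed

text \<open>The input does not tell the number of edges; this bound lets a scan up to
  \<open>n\<close> see all of them.\<close>

lemma length_es: "length es < n"
proof -
  have "distinct (map (edge_of vs) es)" "set (map (edge_of vs) es) = E"
    using pres by (simp_all only: presents_def)
  then have "length es = card E" by (metis distinct_card length_map)
  then show ?thesis using tree_card_edges[OF is_tree] n_eq by simp
qed

definition ends :: "nat \<Rightarrow> nat \<times> nat" where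
  "ends j = (if j < length es then es ! j else (0, 0))"

text \<open>\<open>ys\<close> is a ghost list: the vertex numbers in the order in which they were
  reached.\<close>

definition rooted :: "nat list \<Rightarrow> state \<Rightarrow> bool" where
  "rooted ys s \<longleftrightarrow>
     changes_only {''pos'', ''pp'', ''cnt'', ''r'', ''j''} {''pw'', ''pc''} (input_state vs es \<omega> c) s \<and>
     ys \<noteq> [] \<and> distinct ys \<and> set ys \<subseteq> {..<n} \<and> fst s ''cnt'' 0 = length ys \<and>
     (\<forall>t<length ys. fst s ''pos'' (ys ! t) = Suc t) \<and> (\<forall>i. i \<notin> set ys \<longrightarrow> fst s ''pos'' i = 0) \<and>
     grows E (map ((!) vs) ys) (fst s ''pp'') \<and>
     (\<forall>t<length ys. snd s ''pw'' t = \<omega> (vs ! (ys ! t))) \<and>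
     (\<forall>t\<in>{1..<length ys}. snd s ''pc'' t = c (par_edge (map ((!) vs) ys) (fst s ''pp'') t))"

definition crossing :: "nat list \<Rightarrow> nat \<Rightarrow> bool" where
  "crossing ys j \<longleftrightarrow> (fst (ends j) \<in> set ys) \<noteq> (snd (ends j) \<in> set ys)"

lemma input_arrays:
  assumes "rooted ys s"
  shows "fst s ''n'' 0 = n" "fst s ''fst'' j = fst (ends j)" "fst s ''snd'' j = snd (ends j)"
    "i < n \<Longrightarrow> snd s ''w'' i = \<omega> (vs ! i)"
    "j < length es \<Longrightarrow> snd s ''c'' j = c (edge_of vs (es ! j))"
  using assms by (auto simp: rooted_def changes_only_def input_state_def array_of_def ends_def)

lemma rooted_length: "rooted ys s \<Longrightarrow> length ys \<le> n"
  using card_mono[of "{..<n}" "set ys"] by (auto simp: rooted_def distinct_card)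

lemma rooted_loop_var:
  "x \<in> {''r'', ''j''} \<Longrightarrow> rooted ys (nwrite x i m s) \<longleftrightarrow> rooted ys s"
  by (auto simp: rooted_def)

lemma pos_pos_iff: "rooted ys s \<Longrightarrow> 0 < fst s ''pos'' i \<longleftrightarrow> i \<in> set ys"
  by (auto simp: rooted_def in_set_conv_nth)

lemma runs_attach:
  assumes R: "rooted ys s" and sj: "fst s ''j'' 0 = j"
    and xy: "x = ''fst'' \<and> y = ''snd'' \<and> a = fst (ends j) \<and> b = snd (ends j) \<or>
      x = ''snd'' \<and> y = ''fst'' \<and> a = snd (ends j) \<and> b = fst (ends j)"
  shows "runs (attach_code x y) s 55 (\<lambda>s'. fst s' ''j'' 0 = j \<and> fst s' ''r'' 0 = fst s ''r'' 0 \<and>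
    rooted (if a \<in> set ys \<and> b \<notin> set ys then ys @ [b] else ys) s')"
proof -
  have ab: "fst s x j = a" "fst s y j = b" using xy input_arrays(2,3)[OF R, of j] by auto
  have xn: "x \<noteq> ''pp''" "y \<noteq> ''pp''" "x \<noteq> ''pos''" "y \<noteq> ''pos''" using xy by auto
  show ?thesis
  proof (cases "a \<in> set ys \<and> b \<notin> set ys")
    case False
    then have "\<not> (0 < fst s ''pos'' a \<and> \<not> 0 < fst s ''pos'' b)"
      unfolding pos_pos_iff[OF R] .
    then have "sem (attach_code x y) s = sem Skip s"
      unfolding attach_code_def sem.simps(5) by (intro if_not_P) (simp add: ab sj)
    then show ?thesis using False R sj by (intro runs_sem) (auto simp: attach_code_def)
  next
    case True
    let ?s = "sem (attach_code x y) s" and ?l = "length ys"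
    have j: "j < length es" using True xy by (auto simp: ends_def split: if_splits)
    have b: "b < n" and edge: "{vs ! b, vs ! a} = edge_of vs (es ! j)"
      using xy j es_less[OF j] by (auto simp: ends_def edge_of_def)
    have cnt: "fst s ''cnt'' 0 = ?l" and dist: "distinct ys" and sub: "set ys \<subseteq> {..<n}"
      and pos: "\<forall>t<?l. fst s ''pos'' (ys ! t) = Suc t" "\<forall>i. i \<notin> set ys \<longrightarrow> fst s ''pos'' i = 0"
      and gR: "grows E (map ((!) vs) ys) (fst s ''pp'')"
      and pw: "\<forall>t<?l. snd s ''pw'' t = \<omega> (vs ! (ys ! t))"
      and pc: "\<forall>t\<in>{1..<?l}. snd s ''pc'' t = c (par_edge (map ((!) vs) ys) (fst s ''pp'') t)"
      using R unfolding rooted_def by simp_all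
    obtain p where p: "p < ?l" "ys ! p = a" using True by (auto simp: in_set_conv_nth)
    then have pa: "fst s ''pos'' a = Suc p" using pos(1) by auto
    have pb: "fst s ''pos'' b = 0" using pos(2) True by simp
    have s': "fst ?s ''pp'' = (fst s ''pp'')(?l := p)" "fst ?s ''cnt'' 0 = Suc ?l"
      "fst ?s ''pos'' = (fst s ''pos'')(b := Suc ?l)"
      "snd ?s ''pw'' = (snd s ''pw'')(?l := \<omega> (vs ! b))"
      "snd ?s ''pc'' = (snd s ''pc'')(?l := c (edge_of vs (es ! j)))"
      "fst ?s ''j'' 0 = j" "fst ?s ''r'' 0 = fst s ''r'' 0"
      "changes_only {''pos'', ''pp'', ''cnt'', ''r'', ''j''} {''pw'', ''pc''} (input_state vs es \<omega> c) ?s"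
      using R ab sj pa pb cnt xn input_arrays(4)[OF R b] input_arrays(5)[OF R j]
      by (auto simp: attach_code_def rooted_def)
    let ?xs = "map ((!) vs) ys" and ?pp = "(fst s ''pp'')(?l := p)"
    have inj: "inj_on ((!) vs) {..<n}" using dist_vs by (intro inj_on_nth) auto
    have "vs ! b \<notin> set ?xs"
      using True b sub inj_onD[OF inj, of b] by auto
    moreover have "{vs ! b, ?xs ! p} \<in> E" using p edge es_edge[OF j] by simp
    moreover have "grows E ?xs ?pp"
      by (rule grows_cong[OF gR]) simp
    ultimately have g: "grows E (?xs @ [vs ! b]) ?pp"
      using p by (simp add: grows_snoc)
    have pe: "par_edge (?xs @ [vs ! b]) ?pp t = par_edge ?xs (fst s ''pp'') t" if "t \<in> {1..<?l}" for t
    proof -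
      have "par_edge (?xs @ [vs ! b]) ?pp t = par_edge ?xs ?pp t"
        using that by (intro par_edge_snoc[OF g]) auto
      then show ?thesis using that by (simp add: par_edge_def)
    qed
    have pe': "par_edge (?xs @ [vs ! b]) ?pp ?l = edge_of vs (es ! j)"
      using p edge by (simp add: par_edge_def nth_append)
    have "rooted (ys @ [b]) ?s"
      unfolding rooted_def s'
    proof (intro conjI allI impI ballI)
      show "grows E (map ((!) vs) (ys @ [b])) ?pp" using g by simp
      show "((fst s ''pos'')(b := Suc ?l)) ((ys @ [b]) ! t) = Suc t" if "t < length (ys @ [b])" for t
      proof (cases "t = ?l")
        case False
        then have "t < ?l" using that by simp
        then show ?thesis using pos(1) True nth_mem[of t ys] by (auto simp: nth_append)
      qed simp
      show "((snd s ''pw'')(?l := \<omega> (vs ! b))) t = \<omega> (vs ! ((ys @ [b]) ! t))"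
        if "t < length (ys @ [b])" for t
        using that pw by (auto simp: nth_append less_Suc_eq)
      show "((snd s ''pc'')(?l := c (edge_of vs (es ! j)))) t =
          c (par_edge (map ((!) vs) (ys @ [b])) ?pp t)" if "t \<in> {1..<length (ys @ [b])}" for t
      proof (cases "t = ?l")
        case True
        then show ?thesis using pe' by simp
      next
        case False
        then have "t \<in> {1..<?l}" using that by auto
        then show ?thesis using pe[of t] pc False by simp
      qed
    qed (use dist sub pos(2) True b s' in auto)
    then show ?thesis
      using True s' by (intro runs_sem) (auto simp: attach_code_def)
  qed
qed

text \<open>While a vertex is missing, connectivity gives an edge between reached and unreached
  vertices, and its index is below \<open>n\<close>.\<close>

lemma full_if_no_crossing:
  assumes R: "rooted ys s" and no: "\<forall>j<n. \<not> crossing ys j"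
  shows "length ys = n"
proof (rule ccontr)
  assume "length ys \<noteq> n"
  moreover have ys: "distinct ys" "set ys \<subseteq> {..<n}" "ys \<noteq> []" using R by (auto simp: rooted_def)
  ultimately have "set ys \<noteq> {..<n}" using distinct_card[of ys] by auto
  then obtain i where i: "i < n" "i \<notin> set ys" using ys by blast
  have inj: "inj_on ((!) vs) {..<n}" using dist_vs by (intro inj_on_nth) auto
  let ?S = "(!) vs ` set ys"
  have mem: "vs ! a \<in> ?S \<longleftrightarrow> a \<in> set ys" if "a < n" for a
    using inj_on_image_mem_iff[OF inj, of a "set ys"] that ys by auto
  have h: "hd ys \<in> set ys" "hd ys < n" using ys by (cases ys; auto)+
  have conn: "graph_connected V E" using is_tree by (simp add: is_tree_def)
  have "vs ! hd ys \<in> V" "vs ! hd ys \<in> ?S" "vs ! i \<in> V" "vs ! i \<notin> ?S"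
    using h i mem set_vs nth_mem by blast+
  from connected_frontier[OF conn this]
  obtain u v where uv: "u \<in> ?S" "v \<notin> ?S" "{u, v} \<in> E" by blast
  obtain j where j: "j < length es" "{u, v} = edge_of vs (es ! j)"
    using ex_es[OF uv(3)] by blast
  let ?a = "fst (es ! j)" and ?b = "snd (es ! j)"
  have "vs ! ?a \<in> ?S \<longleftrightarrow> ?a \<in> set ys" "vs ! ?b \<in> ?S \<longleftrightarrow> ?b \<in> set ys"
    using es_less[OF j(1)] by (auto intro!: mem)
  moreover have "u = vs ! ?a \<and> v = vs ! ?b \<or> u = vs ! ?b \<and> v = vs ! ?a"
    using j(2) by (simp add: edge_of_def doubleton_eq_iff)
  ultimately have "(?a \<in> set ys) \<noteq> (?b \<in> set ys)" using uv(1,2) by metis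
  then have "crossing ys j" using j(1) by (simp add: crossing_def ends_def)
  then show False using no j length_es by auto
qed

text \<open>A round that attaches nothing has met no crossing edge, so every vertex is already
  reached; hence \<open>n\<close> rounds suffice. The quadratic cost is harmless, as both target
  bounds are at least quadratic.\<close>

theorem runs_root:
  "runs root_code (input_state vs es \<omega> c) (20 + (n + 1) * ((n + 1) * 122 + 12))
    (\<lambda>s. \<exists>ys. rooted ys s \<and> length ys = n)"
proof -
  let ?s0 = "input_state vs es \<omega> c"
  let ?init = "Seq (NWrite ''pos'' (NConst 0) (NConst 1))
       (Seq (QWrite ''pw'' (NConst 0) (QRead ''w'' (NConst 0))) (NWrite ''cnt'' (NConst 0) (NConst 1)))"
  have 1: "runs ?init ?s0 20 (rooted [0])"
    by (rule runs_sem)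
      (use n_pos in \<open>auto simp: rooted_def grows_def input_state_def array_of_def changes_only_def\<close>)
  let ?p = "Seq (attach_code ''fst'' ''snd'') (attach_code ''snd'' ''fst'')"
  \<comment> \<open>\<open>ys0\<close> is the list at the start of the round: it has grown since, or
    no edge scanned so far crosses it.\<close>
  define J where "J ys0 r j s \<longleftrightarrow> fst s ''r'' 0 = r \<and> (\<exists>ys. rooted ys s \<and>
      (length ys0 < length ys \<or> ys = ys0 \<and> (\<forall>i<j. \<not> crossing ys0 i)))" for ys0 r j and s :: state
  have body: "runs ?p s (55 + 55) (\<lambda>s'. fst s' ''j'' 0 = j \<and> J ys0 r (Suc j) (nwrite ''j'' 0 (Suc j) s'))"
    if Js: "J ys0 r j s" and sj: "fst s ''j'' 0 = j" for ys0 r j s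
  proof -
    obtain ys where R: "rooted ys s"
      and ys: "length ys0 < length ys \<or> ys = ys0 \<and> (\<forall>i<j. \<not> crossing ys0 i)"
      using Js by (auto simp: J_def)
    let ?a = "fst (ends j)" and ?b = "snd (ends j)"
    let ?ys1 = "if ?a \<in> set ys \<and> ?b \<notin> set ys then ys @ [?b] else ys"
    let ?ys2 = "if ?b \<in> set ?ys1 \<and> ?a \<notin> set ?ys1 then ?ys1 @ [?a] else ?ys1"
    have alt: "length ys0 < length ?ys2 \<or> ?ys2 = ys0 \<and> (\<forall>i<Suc j. \<not> crossing ys0 i)"
      using ys by (auto simp: crossing_def less_Suc_eq)
    have 1: "runs (attach_code ''fst'' ''snd'') s 55 (\<lambda>s'. fst s' ''j'' 0 = j \<and>
        fst s' ''r'' 0 = fst s ''r'' 0 \<and> rooted ?ys1 s')"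
      by (rule runs_attach[OF R sj]) simp
    have "runs ?p s (55 + 55) (\<lambda>s'. fst s' ''j'' 0 = j \<and>
        fst s' ''r'' 0 = fst s ''r'' 0 \<and> rooted ?ys2 s')"
    proof (rule runs_Seq[OF 1], elim conjE)
      fix s1 :: state
      assume s1: "fst s1 ''j'' 0 = j" "fst s1 ''r'' 0 = fst s ''r'' 0" "rooted ?ys1 s1"
      have "runs (attach_code ''snd'' ''fst'') s1 55 (\<lambda>s'. fst s' ''j'' 0 = j \<and>
          fst s' ''r'' 0 = fst s1 ''r'' 0 \<and> rooted ?ys2 s')"
        by (rule runs_attach[OF s1(3,1)]) simp
      then show "runs (attach_code ''snd'' ''fst'') s1 55 (\<lambda>s'. fst s' ''j'' 0 = j \<and>
          fst s' ''r'' 0 = fst s ''r'' 0 \<and> rooted ?ys2 s')"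
        unfolding s1(2) .
    qed
    then show ?thesis
    proof (rule runs_weaken[OF _ order_refl], elim conjE)
      fix s' assume s': "fst s' ''j'' 0 = j" "fst s' ''r'' 0 = fst s ''r'' 0" "rooted ?ys2 s'"
      then show "fst s' ''j'' 0 = j \<and> J ys0 r (Suc j) (nwrite ''j'' 0 (Suc j) s')"
        using alt Js unfolding J_def by (auto simp: rooted_loop_var)
    qed
  qed
  define K where "K r s \<longleftrightarrow> (\<exists>ys. rooted ys s \<and> min n (r + 1) \<le> length ys)" for r and s :: state
  have inner: "runs (For ''j'' 0 0 (Var ''n'') ?p) s ((n - 0 + 1) * (110 + 10 + ncost (Var ''n'')))
      (\<lambda>s'. fst s' ''r'' 0 = r \<and> K (Suc r) (nwrite ''r'' 0 (Suc r) s'))"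
    if K: "K r s" "fst s ''r'' 0 = r" for r s
  proof -
    obtain ys0 where ys0: "rooted ys0 s" "min n (r + 1) \<le> length ys0"
      using K by (auto simp: K_def)
    have "runs (For ''j'' 0 0 (Var ''n'') ?p) s ((n - 0 + 1) * (110 + 10 + ncost (Var ''n'')))
      (\<lambda>s'. J ys0 r n s' \<and> fst s' ''j'' 0 = n)"
    proof (rule runs_For[where I = "J ys0 r" and h = n])
      show "J ys0 r 0 (nwrite ''j'' 0 0 s)"
        using ys0 K(2) unfolding J_def by (auto simp: rooted_loop_var)
      show "nval (Var ''n'') s = n" if "J ys0 r i s" for i s
        using that unfolding J_def by (elim conjE exE) (simp add: input_arrays(1))
      show "runs ?p s 110 (\<lambda>s'. fst s' ''j'' 0 = i \<and> J ys0 r (Suc i) (nwrite ''j'' 0 (Suc i) s'))"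
        if "J ys0 r i s" "fst s ''j'' 0 = i" for i s
        using body[OF that] by simp
    qed simp
    then show ?thesis
    proof (rule runs_weaken[OF _ order_refl], elim conjE)
      fix s' assume J: "J ys0 r n s'"
      then obtain ys where R: "rooted ys s'"
        and ys: "length ys0 < length ys \<or> ys = ys0 \<and> (\<forall>i<n. \<not> crossing ys0 i)"
        by (auto simp: J_def)
      have "min n (Suc r + 1) \<le> length ys"
        using ys full_if_no_crossing[OF R] ys0(2) by auto
      then show "fst s' ''r'' 0 = r \<and> K (Suc r) (nwrite ''r'' 0 (Suc r) s')"
        using J R by (auto simp: J_def K_def rooted_loop_var)
    qed
  qed
  have 2: "runs (For ''r'' 0 0 (Var ''n'') (For ''j'' 0 0 (Var ''n'') ?p)) s
      ((n - 0 + 1) * ((n - 0 + 1) * (110 + 10 + ncost (Var ''n'')) + 10 + ncost (Var ''n'')))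
      (\<lambda>s'. K n s' \<and> fst s' ''r'' 0 = n)" if "rooted [0] s" for s
  proof (rule runs_For[where I = K and h = n])
    show "K 0 (nwrite ''r'' 0 0 s)"
      unfolding K_def by (rule exI[of _ "[0]"]) (use that in \<open>auto simp: rooted_loop_var\<close>)
    show "nval (Var ''n'') s = n" if "K i s" for i s
      using that unfolding K_def by (elim conjE exE) (simp add: input_arrays(1))
  qed (use inner in auto)
  have "runs root_code ?s0 (20 + (n - 0 + 1) * ((n - 0 + 1) * (110 + 10 + ncost (Var ''n'')) + 10 + ncost (Var ''n'')))
      (\<lambda>s'. K n s' \<and> fst s' ''r'' 0 = n)"
    unfolding root_code_def by (rule runs_Seq[OF 1 2])
  then show ?thesis
    by (rule runs_weaken) (use rooted_length in \<open>force simp: K_def\<close>)+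
qed

end

section \<open>Isoperimetric numbers as optima over labellings\<close>

locale ordered_tree =
  fixes xs :: "'a list" and V :: "'a set" and E :: "'a set set"
    and \<omega> :: "'a \<Rightarrow> rat" and c :: "'a set \<Rightarrow> rat" and par :: "nat \<Rightarrow> nat" and w cc :: "nat \<Rightarrow> rat"
  assumes tree: "weighted_tree V E \<omega> c" and grows: "grows E xs par" and set_xs: "set xs = V"
    and w: "t < length xs \<Longrightarrow> w t = \<omega> (xs ! t)"
    and cc: "t \<in> {1..<length xs} \<Longrightarrow> cc t = c (par_edge xs par t)"
begin

lemma is_tree: "is_tree V E"
  using tree by (simp add: weighted_tree_def)

lemma dist_xs: "distinct xs"
  using grows by (simp add: grows_def)

lemma length_xs: "length xs = card V"
  using dist_xs set_xs distinct_card by metis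

lemma edges: "E = par_edge xs par ` {1..<length xs}"
  by (rule grows_edges[OF grows]) (use is_tree set_xs in \<open>auto simp: is_tree_def\<close>)

lemma inj_xs: "inj_on ((!) xs) {..<length xs}"
  using dist_xs by (intro inj_on_nth) auto

end

sublocale ordered_tree \<subseteq> rooted_tree "length xs" par w cc
proof
  show "0 < length xs" using is_tree set_xs by (auto simp: is_tree_def)
  show "par t < t" if "0 < t" "t < length xs" for t using grows that by (simp add: grows_def)
  show "0 < w t" if "t < length xs" for t
    using tree w[OF that] set_xs that by (auto simp: weighted_tree_def)
  show "0 < cc t" if "0 < t" "t < length xs" for t
  proof -
    have "t \<in> {1..<length xs}" using that by simp
    then show ?thesis using tree edges cc[of t] by (auto simp: weighted_tree_def)
  qed
qed

context ordered_tree
begin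

text \<open>\<open>par_edge\<close> maps the positions \<open>{1..<length xs}\<close> injectively
  onto the edges, so the sum over edges becomes a sum over positions.\<close>

lemma normalized_cut_image:
  assumes "B \<subseteq> {..<length xs}"
  shows "normalized_cut E \<omega> c ((!) xs ` B) = bd B / wt B"
proof -
  have mem: "xs ! t \<in> (!) xs ` B \<longleftrightarrow> t \<in> B" if "t < length xs" for t
    using inj_on_image_mem_iff[OF inj_xs _ assms] that by simp
  have crs: "card (par_edge xs par t \<inter> (!) xs ` B) = 1 \<longleftrightarrow> cross B t" if t: "t \<in> {1..<length xs}" for t
  proof -
    have p: "par t < t" "par t < length xs" "t < length xs"
      using t par_less[of t] by auto
    then have "xs ! t \<noteq> xs ! par t" using dist_xs by (simp add: nth_eq_iff_index_eq)
    then show ?thesis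
      using mem[OF p(2)] mem[OF p(3)] unfolding par_edge_def cross_def by (auto simp: Int_insert_left)
  qed
  have "cut_weight E c ((!) xs ` B) = (\<Sum>e\<in>E. if card (e \<inter> (!) xs ` B) = 1 then c e else 0)"
    unfolding cut_weight_def edges by (simp add: sum.inter_filter)
  also have "\<dots> = (\<Sum>t\<in>{1..<length xs}. if card (par_edge xs par t \<inter> (!) xs ` B) = 1
      then c (par_edge xs par t) else 0)"
    unfolding edges by (subst sum.reindex[OF inj_on_par_edge[OF grows]]) (simp only: o_def)
  also have "\<dots> = bd B"
    unfolding bd_def by (intro sum.cong refl) (simp only: crs cc)
  finally have 1: "cut_weight E c ((!) xs ` B) = bd B" .
  have "(\<Sum>u\<in>(!) xs ` B. \<omega> u) = wt B"
    unfolding wt_def using assms w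
    by (subst sum.reindex[OF inj_on_subset[OF inj_xs assms]]) (auto intro!: sum.cong)
  then show ?thesis using 1 by (simp add: normalized_cut_def)
qed

section \<open>Correspondence between labellings and families of vertex sets\<close>

definition family :: "nat \<Rightarrow> (nat \<Rightarrow> nat) \<Rightarrow> 'a set set" where
  "family k g = (\<lambda>i. (!) xs ` cls g i) ` {..<k}"

lemma inj_on_family:
  assumes "covers k g"
  shows "inj_on (\<lambda>i. (!) xs ` cls g i) {..<k}"
proof (rule inj_onI)
  fix i j assume ij: "i \<in> {..<k}" "j \<in> {..<k}" "(!) xs ` cls g i = (!) xs ` cls g j"
  then have eq: "cls g i = cls g j"
    using inj_on_image_eq_iff[OF inj_xs cls_subset cls_subset] by blast
  have "cls g i \<noteq> {}" using assms ij by (simp add: covers_def)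
  then obtain t where "t \<in> cls g i" "t \<in> cls g j" using eq by blast
  then show "i = j" by (simp add: cls_def)
qed

lemma normalized_cut_cls: "normalized_cut E \<omega> c ((!) xs ` cls g i) = ratio g i"
  using normalized_cut_image[OF cls_subset] by (simp add: ratio_def)

lemma Max_family: "Max (normalized_cut E \<omega> c ` family k g) = max_ratio k g"
  by (simp add: family_def image_image normalized_cut_cls max_ratio_def)

lemma mean_family:
  "covers k g \<Longrightarrow> 1 / of_nat k * (\<Sum>A\<in>family k g. normalized_cut E \<omega> c A) = mean_ratio k g"
  by (simp add: family_def sum.reindex inj_on_family normalized_cut_cls mean_ratio_def)

lemma family_subpartition:
  assumes "covers k g"
  shows "family k g \<in> subpartitions V k"
proof -
  have "disjoint (family k g)"
  proof (rule disjointI)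
    fix A B assume "A \<in> family k g" "B \<in> family k g" "A \<noteq> B"
    then obtain i j where ij: "A = (!) xs ` cls g i" "B = (!) xs ` cls g j" "i \<noteq> j"
      by (auto simp: family_def)
    have "cls g i \<inter> cls g j = {}" using ij(3) by (auto simp: cls_def)
    then show "A \<inter> B = {}"
      unfolding ij using inj_on_image_Int[OF inj_xs cls_subset cls_subset, of g i g j] by simp
  qed
  moreover have "card (family k g) = k"
    unfolding family_def by (simp add: card_image inj_on_family[OF assms])
  moreover have "\<Union>(family k g) \<subseteq> V"
    using set_xs by (auto simp: family_def cls_def)
  moreover have "finite (family k g)" "{} \<notin> family k g"
    using assms by (auto simp: family_def covers_def)
  ultimately show ?thesis by (simp add: subpartitions_def)
qed

lemma family_partition:
  assumes "labelling k k g"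
  shows "family k g \<in> partitions V k"
proof -
  have "V \<subseteq> \<Union>(family k g)"
  proof
    fix v assume "v \<in> V"
    then obtain t where "t < length xs" "xs ! t = v"
      using set_xs by (metis in_set_conv_nth)
    then show "v \<in> \<Union>(family k g)"
      using assms by (auto simp: family_def labelling_def cls_def)
  qed
  moreover have "family k g \<in> subpartitions V k"
    using assms by (intro family_subpartition) (simp add: labelling_def)
  ultimately show ?thesis by (auto simp: partitions_def subpartitions_def)
qed

text \<open>Number the members of \<open>F\<close> by a bijection and send vertices outside all
  members to \<open>k\<close>; disjointness makes the choice of a member unique.\<close>

lemma ex_labelling:
  assumes F: "F \<in> subpartitions V k"
  shows "\<exists>g. labelling (k + 1) k g \<and> family k g = F \<and> (\<Union>F = V \<longrightarrow> labelling k k g)"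
proof -
  have fin: "finite F" "card F = k" and sub: "\<Union>F \<subseteq> V" and disj: "disjoint F" and ne: "{} \<notin> F"
    using F by (auto simp: subpartitions_def)
  obtain A where A: "bij_betw A {..<k} F"
    using ex_bij_betw_nat_finite[OF fin(1)] fin(2) by (auto simp: atLeast0LessThan)
  have AF: "A i \<in> F" if "i < k" for i using A that by (auto simp: bij_betw_def)
  have uniq: "i = j" if "i < k" "j < k" "v \<in> A i" "v \<in> A j" for i j v
  proof -
    have "A i = A j" using disjointD[OF disj AF[OF that(1)] AF[OF that(2)]] that by blast
    then show ?thesis using A that by (auto simp: bij_betw_def inj_on_def)
  qed
  define g where "g t = (if \<exists>i<k. xs ! t \<in> A i then SOME i. i < k \<and> xs ! t \<in> A i else k)" for t
  have g: "g t = i \<longleftrightarrow> xs ! t \<in> A i" if "i < k" for t i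
  proof
    assume "xs ! t \<in> A i"
    moreover from this have "(SOME i. i < k \<and> xs ! t \<in> A i) < k \<and> xs ! t \<in> A (SOME i. i < k \<and> xs ! t \<in> A i)"
      using that by (intro someI[of "\<lambda>i. i < k \<and> xs ! t \<in> A i" i]) simp
    ultimately show "g t = i" using uniq that by (auto simp: g_def)
  next
    assume gi: "g t = i"
    then have "\<exists>i<k. xs ! t \<in> A i" using that by (auto simp: g_def split: if_splits)
    then show "xs ! t \<in> A i"
      using gi someI_ex[of "\<lambda>i. i < k \<and> xs ! t \<in> A i"] by (auto simp: g_def)
  qed
  have gk: "g t \<le> k" for t
  proof (cases "\<exists>i<k. xs ! t \<in> A i")
    case True
    then have "g t < k" using g by metis
    then show ?thesis by simp
  next
    case False
    then show ?thesis unfolding g_def by (subst if_not_P) auto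
  qed
  have img: "(!) xs ` cls g i = A i" if "i < k" for i
  proof -
    have "cls g i = {t. t < length xs \<and> xs ! t \<in> A i}"
      unfolding cls_def g[OF that] ..
    moreover have "A i \<subseteq> set xs" using AF[OF that] sub set_xs by blast
    then have "(!) xs ` {t. t < length xs \<and> xs ! t \<in> A i} = A i"
      unfolding set_conv_nth by blast
    ultimately show ?thesis by simp
  qed
  have cov: "covers k g"
    using img AF ne unfolding covers_def by (metis image_is_empty)
  have fam: "family k g = F"
    using A img by (simp add: family_def bij_betw_def)
  have "g t < k" if "\<Union>F = V" "t < length xs" for t
  proof -
    have "xs ! t \<in> \<Union>F" using nth_mem[OF that(2)] that(1) set_xs by simp
    then obtain i where "i < k" "xs ! t \<in> A i" using A by (auto simp: bij_betw_def)
    then show ?thesis using g[of i t] by simp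
  qed
  then show ?thesis
    using cov fam gk by (intro exI[of _ g]) (auto simp: labelling_def less_Suc_eq_le)
qed

lemma finite_subpartitions: "finite (subpartitions V k)"
proof (rule finite_subset)
  show "subpartitions V k \<subseteq> Pow (Pow V)" unfolding subpartitions_def by blast
  show "finite (Pow (Pow V))" using is_tree by (simp add: is_tree_def)
qed

lemma finite_partitions: "finite (partitions V k)"
  by (rule finite_subset[OF _ finite_subpartitions[of k]]) (auto simp: partitions_def)

text \<open>Supplies a labelling to start from, so that the conditional guarantee of the search
  applies. In the witness the positions below \<open>k - 1\<close> get labels of their own, and all
  others share \<open>k - 1\<close>.\<close>

lemma ex_base_labelling:
  assumes "0 < k" "k \<le> card V"
  shows "\<exists>g. labelling k k g"
proof (intro exI)
  show "labelling k k (\<lambda>t. min t (k - 1))"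
    unfolding labelling_def covers_def
  proof (intro conjI allI impI)
    fix i assume "i < k"
    then have "i \<in> cls (\<lambda>t. min t (k - 1)) i" using assms(2) unfolding length_xs[symmetric] by (simp add: cls_def)
    then show "cls (\<lambda>t. min t (k - 1)) i \<noteq> {}" by blast
  qed (use assms in auto)
qed

lemma max_ratio_mono: "0 < k \<Longrightarrow> (\<And>i. i < k \<Longrightarrow> ratio h i \<le> ratio g i) \<Longrightarrow> max_ratio k h \<le> max_ratio k g"
proof -
  assume k: "0 < k" and le: "\<And>i. i < k \<Longrightarrow> ratio h i \<le> ratio g i"
  have "ratio h i \<le> Max (ratio g ` {..<k})" if "i < k" for i
    by (rule order_trans[OF le[OF that] Max_ge]) (use that in auto)
  then show ?thesis
    unfolding max_ratio_def using k by (subst Max_le_iff) (auto simp: lessThan_empty_iff)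
qed

lemma mean_ratio_mono: "(\<And>i. i < k \<Longrightarrow> ratio h i \<le> ratio g i) \<Longrightarrow> mean_ratio k h \<le> mean_ratio k g"
  unfolding mean_ratio_def by (intro mult_left_mono sum_mono) auto

text \<open>Every labelling is dominated by one with at most \<open>m\<close> cuts, so a lower bound
  for the latter is one for all. The condition on \<open>m\<close> says
  \<open>m >= (3 * k - 3) div 2\<close>.\<close>

lemma iso_eqI:
  assumes k: "2 \<le> k" "k \<le> card V" and m: "3 * k \<le> 2 * m + 4"
    and out: "\<And>h. labelling (k + 1) k h \<Longrightarrow> card (cuts h) \<le> m \<Longrightarrow>
       a \<le> max_ratio k h \<and> b \<le> mean_ratio k h \<and>
       (\<exists>g. labelling (k + 1) k g \<and> a = max_ratio k g) \<and>
       (\<exists>g. labelling (k + 1) k g \<and> b = mean_ratio k g)"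
  shows "iso_max V E \<omega> c k = a" "iso_mean V E \<omega> c k = b"
proof -
  have few: "\<exists>h. labelling (k + 1) k h \<and> card (cuts h) \<le> m \<and> max_ratio k h \<le> max_ratio k g \<and>
      mean_ratio k h \<le> mean_ratio k g" if g: "labelling (k + 1) k g" for g
  proof -
    have "\<forall>t<length xs. g t \<le> k" "\<forall>i<k. cls g i \<noteq> {}"
      using g by (auto simp: labelling_def covers_def less_Suc_eq_le)
    then obtain h where h: "dominates k h g" "2 * card (cuts h) + 3 \<le> 3 * k"
      using few_cuts_subpartition[OF k(1)] by blast
    then have "labelling (k + 1) k h" "\<And>i. i < k \<Longrightarrow> ratio h i \<le> ratio g i"
      by (auto simp: dominates_def labelling_def covers_def less_Suc_eq_le)
    moreover have "card (cuts h) \<le> m" using h(2) m by linarith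
    ultimately show ?thesis using k max_ratio_mono mean_ratio_mono by (metis less_le_trans pos2)
  qed
  obtain g0 where "labelling k k g0" using ex_base_labelling[of k] k by auto
  then have "labelling (k + 1) k g0" by (auto simp: labelling_def intro: less_SucI)
  then obtain h0 where h0: "labelling (k + 1) k h0" "card (cuts h0) \<le> m" using few by blast
  obtain ga gb where ga: "labelling (k + 1) k ga" "a = max_ratio k ga"
    and gb: "labelling (k + 1) k gb" "b = mean_ratio k gb" using out[OF h0] by blast
  have le: "a \<le> max_ratio k g \<and> b \<le> mean_ratio k g" if "labelling (k + 1) k g" for g
    using few[OF that] out by (meson order_trans)
  show "iso_max V E \<omega> c k = a"
    unfolding iso_max_def
  proof (rule Min_eqI)
    show "a \<in> (\<lambda>F. Max (normalized_cut E \<omega> c ` F)) ` subpartitions V k"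
      using ga family_subpartition[of k ga] Max_family[of k ga]
      by (intro image_eqI[of _ _ "family k ga"]) (auto simp: labelling_def)
    fix x assume "x \<in> (\<lambda>F. Max (normalized_cut E \<omega> c ` F)) ` subpartitions V k"
    then obtain F where F: "F \<in> subpartitions V k" "x = Max (normalized_cut E \<omega> c ` F)" by blast
    then show "a \<le> x" using ex_labelling[OF F(1)] Max_family le by metis
  qed (use finite_subpartitions in simp)
  show "iso_mean V E \<omega> c k = b"
    unfolding iso_mean_def
  proof (rule Min_eqI)
    show "b \<in> (\<lambda>F. 1 / of_nat k * (\<Sum>A\<in>F. normalized_cut E \<omega> c A)) ` subpartitions V k"
      using gb family_subpartition[of k gb] mean_family[of k gb]
      by (intro image_eqI[of _ _ "family k gb"]) (auto simp: labelling_def)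
    fix x assume "x \<in> (\<lambda>F. 1 / of_nat k * (\<Sum>A\<in>F. normalized_cut E \<omega> c A)) ` subpartitions V k"
    then obtain F where F: "F \<in> subpartitions V k"
      "x = 1 / of_nat k * (\<Sum>A\<in>F. normalized_cut E \<omega> c A)" by blast
    obtain g where "labelling (k + 1) k g" "family k g = F" using ex_labelling[OF F(1)] by blast
    then show "b \<le> x" using F(2) mean_family[of k g] le[of g] by (simp add: labelling_def)
  qed (use finite_subpartitions in simp)
qed

text \<open>Each labelling \<open>g\<close> is compared with one of few cuts by taking its own
  maximum as the bound \<open>b\<close>, so the optimum need not be known in advance.\<close>

lemma iso_partition_eqI:
  assumes k: "4 \<le> k" "k \<le> card V" and m: "2 * (k * (k - 3)) \<le> m + 3"
    and out: "\<And>h. labelling k k h \<Longrightarrow> card (cuts h) \<le> m \<Longrightarrow>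
       a \<le> max_ratio k h \<and> (\<exists>g. labelling k k g \<and> a = max_ratio k g)"
  shows "iso_max_partition V E \<omega> c k = a"
proof -
  have few: "\<exists>h. labelling k k h \<and> card (cuts h) \<le> m \<and> max_ratio k h \<le> max_ratio k g"
    if g: "labelling k k g" for g
  proof -
    let ?b = "max_ratio k g"
    have ge: "ratio g i \<le> ?b" if "i < k" for i
      using that by (simp add: max_ratio_def)
    have excess: "excess b (cls h i) \<le> 0 \<longleftrightarrow> ratio h i \<le> b" if "cls h i \<noteq> {}" for b h i
      using wt_cls_pos[OF that] by (simp add: excess_def ratio_def pos_divide_le_eq)
    have "admissible k ?b g"
      using g ge excess by (auto simp: admissible_def labelling_def covers_def)
    moreover have "0 \<le> ?b" using ratio_nonneg[of g 0] ge[of 0] k by simp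
    ultimately obtain h where h: "admissible k ?b h" "card (cuts h) + 3 \<le> 2 * (k * (k - 3))"
      using few_cuts_partition[OF k(1)] by blast
    then have "labelling k k h"
      by (auto simp: admissible_def labelling_def covers_def)
    moreover have "ratio h i \<le> ?b" if "i < k" for i
      using h(1) that excess[of h i ?b] by (simp add: admissible_def)
    then have "max_ratio k h \<le> ?b"
      using k unfolding max_ratio_def[of k h] by (subst Max_le_iff) (auto simp: lessThan_empty_iff)
    moreover have "card (cuts h) \<le> m" using h(2) m by linarith
    ultimately show ?thesis by blast
  qed
  obtain g0 where "labelling k k g0" using ex_base_labelling[of k] k by auto
  then obtain h0 where h0: "labelling k k h0" "card (cuts h0) \<le> m" using few by blast
  obtain ga where ga: "labelling k k ga" "a = max_ratio k ga" using out[OF h0] by blast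
  have le: "a \<le> max_ratio k g" if "labelling k k g" for g
    using few[OF that] out by (meson order_trans)
  show ?thesis
    unfolding iso_max_partition_def
  proof (rule Min_eqI)
    show "a \<in> (\<lambda>F. Max (normalized_cut E \<omega> c ` F)) ` partitions V k"
      using ga family_partition[of k ga] Max_family[of k ga]
      by (intro image_eqI[of _ _ "family k ga"]) auto
    fix x assume "x \<in> (\<lambda>F. Max (normalized_cut E \<omega> c ` F)) ` partitions V k"
    then obtain F where F: "F \<in> subpartitions V k" "\<Union>F = V" "x = Max (normalized_cut E \<omega> c ` F)"
      by (auto simp: partitions_def)
    then show "a \<le> x" using ex_labelling[OF F(1)] Max_family le by metis
  qed (use finite_partitions in simp)
qed

end

section \<open>The algorithms\<close>

definition main_code :: "nat \<Rightarrow> nat \<Rightarrow> nat \<Rightarrow> com" where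
  "main_code m L k = Seq root_code (search_code m L k)"

definition main_time :: "nat \<Rightarrow> nat \<Rightarrow> nat \<Rightarrow> nat \<Rightarrow> nat" where
  "main_time m L k n = (20 + (n + 1) * ((n + 1) * 122 + 12)) +
     (3 + (2 * n) ^ m * (2 * L) ^ (m + 1) *
       (n * ((m + 1) * 41 + (L + 1) * 31 + (k + 1) * 61 + 212) + 12 * (2 * m + 1)))"

lemma main_correct:
  assumes tree: "weighted_tree V E \<omega> c" and pres: "presents vs es V E" and k: "0 < k" "k \<le> L"
  shows "\<exists>t s xs par w cc. exec (main_code m L k) (input_state vs es \<omega> c) t s \<and>
    t \<le> main_time m L k (card V) \<and> ordered_tree xs V E \<omega> c par w cc \<and>
    (\<forall>h. rooted_tree.labelling (length xs) L k h \<and> card (rooted_tree.cuts (length xs) par h) \<le> m \<longrightarrow>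
       snd s ''out'' 0 \<le> rooted_tree.max_ratio (length xs) par w cc k h \<and>
       snd s ''out'' 1 \<le> rooted_tree.mean_ratio (length xs) par w cc k h \<and>
       (\<exists>g. rooted_tree.labelling (length xs) L k g \<and>
         snd s ''out'' 0 = rooted_tree.max_ratio (length xs) par w cc k g) \<and>
       (\<exists>g. rooted_tree.labelling (length xs) L k g \<and>
         snd s ''out'' 1 = rooted_tree.mean_ratio (length xs) par w cc k g))"
proof -
  interpret presented_tree vs es V E \<omega> c by unfold_locales fact+
  obtain t1 s1 ys where 1: "exec root_code (input_state vs es \<omega> c) t1 s1"
      "t1 \<le> 20 + (n + 1) * ((n + 1) * 122 + 12)" and R: "rooted ys s1" "length ys = n"
    using runs_root unfolding runs_def by blast
  define xs where "xs = map ((!) vs) ys"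
  have len: "length xs = n" by (simp add: xs_def R)
  have ys: "distinct ys" "set ys \<subseteq> {..<n}" and g: "grows E xs (fst s1 ''pp'')"
    and w: "\<forall>t<length ys. snd s1 ''pw'' t = \<omega> (vs ! (ys ! t))"
    and cc: "\<forall>t\<in>{1..<length ys}. snd s1 ''pc'' t = c (par_edge xs (fst s1 ''pp'') t)"
    using R(1) unfolding rooted_def xs_def by simp_all
  have "set ys = {..<n}"
    using ys R(2) by (intro card_subset_eq) (auto simp: distinct_card)
  then have "set xs = (!) vs ` {..<n}" by (simp add: xs_def)
  also have "\<dots> = V" unfolding set_vs[symmetric] set_conv_nth by blast
  finally interpret O: ordered_tree xs V E \<omega> c "fst s1 ''pp''" "snd s1 ''pw''" "snd s1 ''pc''"
    by unfold_locales (use tree g w cc R(2) in \<open>auto simp: xs_def\<close>)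
  have "O.tree_stored s1"
    unfolding O.tree_stored_def using input_arrays(1)[OF R(1)] len by simp
  from O.runs_search[OF this k, of m]
  obtain t2 s2 where 2: "exec (search_code m L k) s1 t2 s2"
      "t2 \<le> 3 + (2 * n) ^ m * (2 * L) ^ (m + 1) *
         (n * ((m + 1) * 41 + (L + 1) * 31 + (k + 1) * 61 + 212) + 12 * (2 * m + 1))"
      "\<forall>h. O.labelling L k h \<and> card (O.cuts h) \<le> m \<longrightarrow>
       snd s2 ''out'' 0 \<le> O.max_ratio k h \<and> snd s2 ''out'' 1 \<le> O.mean_ratio k h \<and>
       (\<exists>g. O.labelling L k g \<and> snd s2 ''out'' 0 = O.max_ratio k g) \<and>
       (\<exists>g. O.labelling L k g \<and> snd s2 ''out'' 1 = O.mean_ratio k g)"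
    unfolding runs_def len by blast
  have "exec (main_code m L k) (input_state vs es \<omega> c) (t1 + t2) s2"
    unfolding main_code_def by (rule exec_Seq[OF 1(1) 2(1)])
  moreover have "t1 + t2 \<le> main_time m L k (card V)"
    using 1(2) 2(2) unfolding main_time_def n_eq[symmetric] by (rule add_mono)
  ultimately show ?thesis using 2(3) O.ordered_tree_axioms by blast
qed

text \<open>Rooting is quadratic and the search has order \<open>n ^ (m + 1)\<close>, hence the two
  hypotheses on \<open>d\<close>; factors in \<open>m\<close>, \<open>L\<close> and \<open>k\<close>
  go into \<open>D\<close>.\<close>

lemma main_time_bound:
  assumes "m + 1 \<le> d" "2 \<le> d"
  shows "\<exists>D. \<forall>n\<ge>1. main_time m L k n \<le> D * n ^ d"
proof (intro exI allI impI)
  fix n :: nat assume n: "1 \<le> n"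
  let ?K = "(m + 1) * 41 + (L + 1) * 31 + (k + 1) * 61 + 212"
  let ?M = "12 * (2 * m + 1)"
  have n2: "n ^ 2 \<le> n ^ d" by (rule power_increasing[OF assms(2) n])
  have nm: "n ^ (m + 1) \<le> n ^ d" by (rule power_increasing[OF assms(1) n])
  have n0: "1 \<le> n ^ d" using n by (rule one_le_power)
  have "(n + 1) * ((n + 1) * 122 + 12) \<le> (2 * n) * (2 * n * 122 + 12 * n)"
    using n by (intro mult_mono add_mono) auto
  also have "\<dots> = 512 * n ^ 2" by (simp add: power2_eq_square)
  also have "\<dots> \<le> 512 * n ^ d" using n2 by simp
  \<comment> \<open>535 collects 512 and the additive constants 20 and 3.\<close>
  finally have 1: "20 + (n + 1) * ((n + 1) * 122 + 12) + 3 \<le> 535 * n ^ d" using n0 by linarith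
  have "?M \<le> n * ?M" using n by (cases n) auto
  then have "(2 * n) ^ m * (2 * L) ^ (m + 1) * (n * ?K + ?M)
      \<le> (2 * n) ^ m * (2 * L) ^ (m + 1) * (n * ?K + n * ?M)"
    by (intro mult_left_mono add_left_mono) auto
  also have "\<dots> = 2 ^ m * (2 * L) ^ (m + 1) * (?K + ?M) * n ^ (m + 1)"
    by (simp add: power_mult_distrib algebra_simps)
  also have "\<dots> \<le> 2 ^ m * (2 * L) ^ (m + 1) * (?K + ?M) * n ^ d"
    using nm by (rule mult_left_mono) simp
  finally show "main_time m L k n \<le> (535 + 2 ^ m * (2 * L) ^ (m + 1) * (?K + ?M)) * n ^ d"
    using 1 unfolding main_time_def add_mult_distrib by linarith
qed

text \<open>\<open>b\<close> clears the denominator of the target bound, a factorial that is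
  constant for fixed \<open>k\<close>.\<close>

lemma main_time_bigo:
  assumes "m + 1 \<le> d" "2 \<le> d" and f: "\<And>n. 1 \<le> n \<Longrightarrow> real n ^ d \<le> b * f n"
  shows "(\<lambda>n. real (main_time m L k n)) \<in> O(f)"
proof -
  obtain D where D: "\<forall>n\<ge>1. main_time m L k n \<le> D * n ^ d"
    using main_time_bound[OF assms(1,2)] by blast
  have "norm (real (main_time m L k n)) \<le> (real D * \<bar>b\<bar>) * norm (f n)" if "1 \<le> n" for n
  proof -
    have "real (main_time m L k n) \<le> real (D * n ^ d)" using D that by (simp only: of_nat_le_iff)
    also have "\<dots> = real D * real n ^ d" by simp
    also have "\<dots> \<le> real D * (b * f n)" by (rule mult_left_mono[OF f[OF that]]) simp
    also have "\<dots> \<le> real D * (\<bar>b\<bar> * \<bar>f n\<bar>)"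
      by (intro mult_left_mono) (auto simp: abs_mult[symmetric])
    finally show ?thesis by simp
  qed
  then show ?thesis
    by (intro bigoI[of _ "real D * \<bar>b\<bar>"] eventually_sequentiallyI[of 1]) auto
qed

lemma computes_iso:
  assumes k: "2 \<le> k" and m: "3 * k \<le> 2 * m + 4"
  shows "computes_within (main_code m (k + 1) k) k
    (\<lambda>V E \<omega> c. [iso_max V E \<omega> c k, iso_mean V E \<omega> c k]) (main_time m (k + 1) k)"
  unfolding computes_within_def
proof (intro allI impI)
  fix V :: "nat set" and E \<omega> c vs es
  assume tree: "weighted_tree V E \<omega> c" and kV: "k \<le> card V" and pres: "presents vs es V E"
  obtain t s xs par w cc where
    ex: "exec (main_code m (k + 1) k) (input_state vs es \<omega> c) t s" "t \<le> main_time m (k + 1) k (card V)"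
    and O: "ordered_tree xs V E \<omega> c par w cc"
    and out: "\<And>h. rooted_tree.labelling (length xs) (k + 1) k h \<Longrightarrow>
       card (rooted_tree.cuts (length xs) par h) \<le> m \<Longrightarrow>
       snd s ''out'' 0 \<le> rooted_tree.max_ratio (length xs) par w cc k h \<and>
       snd s ''out'' 1 \<le> rooted_tree.mean_ratio (length xs) par w cc k h \<and>
       (\<exists>g. rooted_tree.labelling (length xs) (k + 1) k g \<and>
         snd s ''out'' 0 = rooted_tree.max_ratio (length xs) par w cc k g) \<and>
       (\<exists>g. rooted_tree.labelling (length xs) (k + 1) k g \<and>
         snd s ''out'' 1 = rooted_tree.mean_ratio (length xs) par w cc k g)"
    using main_correct[OF tree pres, of k "k + 1" m] k by auto
  note eq = ordered_tree.iso_eqI[OF O k kV m out]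
  have "snd s ''out'' i = [iso_max V E \<omega> c k, iso_mean V E \<omega> c k] ! i"
    if "i < length [iso_max V E \<omega> c k, iso_mean V E \<omega> c k]" for i
    using that eq by (auto simp: less_Suc_eq)
  then show "\<exists>t s. exec (main_code m (k + 1) k) (input_state vs es \<omega> c) t s \<and>
      t \<le> main_time m (k + 1) k (card V) \<and>
      (\<forall>i<length [iso_max V E \<omega> c k, iso_mean V E \<omega> c k].
         snd s ''out'' i = [iso_max V E \<omega> c k, iso_mean V E \<omega> c k] ! i)"
    using ex by blast
qed

lemma computes_iso_partition:
  assumes k: "4 \<le> k" and m: "2 * (k * (k - 3)) \<le> m + 3"
  shows "computes_within (main_code m k k) k
    (\<lambda>V E \<omega> c. [iso_max_partition V E \<omega> c k]) (main_time m k k)"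
  unfolding computes_within_def
proof (intro allI impI)
  fix V :: "nat set" and E \<omega> c vs es
  assume tree: "weighted_tree V E \<omega> c" and kV: "k \<le> card V" and pres: "presents vs es V E"
  obtain t s xs par w cc where
    ex: "exec (main_code m k k) (input_state vs es \<omega> c) t s" "t \<le> main_time m k k (card V)"
    and O: "ordered_tree xs V E \<omega> c par w cc"
    and out: "\<And>h. rooted_tree.labelling (length xs) k k h \<Longrightarrow>
       card (rooted_tree.cuts (length xs) par h) \<le> m \<Longrightarrow>
       snd s ''out'' 0 \<le> rooted_tree.max_ratio (length xs) par w cc k h \<and>
       (\<exists>g. rooted_tree.labelling (length xs) k k g \<and>
         snd s ''out'' 0 = rooted_tree.max_ratio (length xs) par w cc k g)"
    using main_correct[OF tree pres, of k k m] k by auto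
  have eq: "iso_max_partition V E \<omega> c k = snd s ''out'' 0"
    by (rule ordered_tree.iso_partition_eqI[OF O k kV m out])
  then show "\<exists>t s. exec (main_code m k k) (input_state vs es \<omega> c) t s \<and>
      t \<le> main_time m k k (card V) \<and>
      (\<forall>i<length [iso_max_partition V E \<omega> c k].
         snd s ''out'' i = [iso_max_partition V E \<omega> c k] ! i)"
    by (intro exI[of _ t] exI[of _ s] conjI ex) (simp add: eq)
qed

theorem theorem5:
  fixes k :: nat
  assumes "2 \<le> k"
  shows
    "(\<exists>p \<tau>. computes_within p k (\<lambda>V E \<omega> c. [iso_max V E \<omega> c k, iso_mean V E \<omega> c k]) \<tau> \<and>
        (\<lambda>n. real (\<tau> n)) \<in> O(\<lambda>n. real n ^ ((3 * k - 1) div 2) / fact (k - 1))) \<and>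
     (6 * k + 3 \<le> 2 * k\<^sup>2 \<longrightarrow>
       (\<exists>p \<tau>. computes_within p k (\<lambda>V E \<omega> c. [iso_max_partition V E \<omega> c k]) \<tau> \<and>
        (\<lambda>n. real (\<tau> n)) \<in>
          O(\<lambda>n. (real n + real (Stirling (2 * k\<^sup>2 - 6 * k - 2) k)) *
                  real n ^ (2 * k\<^sup>2 - 6 * k - 3) / fact (k - 2))))"
proof (intro conjI impI)
  \<comment> \<open>The largest number allowed by \<open>2 * m + 3 <= 3 * k\<close>; linear
    evaluation adds one to the exponent.\<close>
  define m where "m = (3 * k - 3) div 2"
  have m: "3 * k \<le> 2 * m + 4" "m + 1 = (3 * k - 1) div 2" "2 \<le> (3 * k - 1) div 2"
    using assms by (auto simp: m_def)
  have "(\<lambda>n. real (main_time m (k + 1) k n)) \<in> O(\<lambda>n. real n ^ ((3 * k - 1) div 2) / fact (k - 1))"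
    by (rule main_time_bigo[where b = "fact (k - 1)"]) (use m in auto)
  then show "\<exists>p \<tau>. computes_within p k (\<lambda>V E \<omega> c. [iso_max V E \<omega> c k, iso_mean V E \<omega> c k]) \<tau> \<and>
      (\<lambda>n. real (\<tau> n)) \<in> O(\<lambda>n. real n ^ ((3 * k - 1) div 2) / fact (k - 1))"
    using computes_iso[OF assms m(1)] by blast
next
  assume big: "6 * k + 3 \<le> 2 * k\<^sup>2"
  \<comment> \<open>\<open>big\<close> states that the exponent is not truncated, which fails for
    \<open>k = 2\<close> and \<open>k = 3\<close>.\<close>
  have k: "4 \<le> k"
  proof (rule ccontr)
    assume "\<not> 4 \<le> k"
    then have "k = 2 \<or> k = 3" using assms by auto
    then show False using big by auto
  qed
  \<comment> \<open>Equal to \<open>2 * (k * (k - 3)) - 3\<close>, the number of cut edges that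
    suffices for partitions.\<close>
  define m where "m = 2 * k\<^sup>2 - 6 * k - 3"
  have "4 * k \<le> k\<^sup>2" using k by (simp add: power2_eq_square)
  then have "1 \<le> m" using k unfolding m_def by linarith
  moreover have "2 * (k * (k - 3)) \<le> m + 3"
    by (simp add: m_def power2_eq_square diff_mult_distrib2)
  ultimately have m: "2 * (k * (k - 3)) \<le> m + 3" "1 \<le> m" by auto
  let ?f = "\<lambda>n. (real n + real (Stirling (2 * k\<^sup>2 - 6 * k - 2) k)) * real n ^ m / fact (k - 2)"
  have "(\<lambda>n. real (main_time m k k n)) \<in> O(?f)"
    \<comment> \<open>The factor containing the Stirling number is at least \<open>real n\<close>,
      which pays for the linear evaluation.\<close>
    by (rule main_time_bigo[where d = "m + 1" and b = "fact (k - 2)"])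
      (use m in \<open>auto intro: mult_right_mono\<close>)
  then show "\<exists>p \<tau>. computes_within p k (\<lambda>V E \<omega> c. [iso_max_partition V E \<omega> c k]) \<tau> \<and>
      (\<lambda>n. real (\<tau> n)) \<in>
        O(\<lambda>n. (real n + real (Stirling (2 * k\<^sup>2 - 6 * k - 2) k)) *
                real n ^ (2 * k\<^sup>2 - 6 * k - 3) / fact (k - 2))"
    using computes_iso_partition[OF k m(1)] unfolding m_def by blast
qed

end
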